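(* Let $X$ be a minimal shift space of finite topological rank $n$. Then, for every pseudovariety of semigroups $\mathsf V$ containing $\mathsf{LSl}$, the Schützenberger group $G_{\mathsf V}(X)$ is a profinite group of rank at most $n$.
   Context: A shift space over a finite alphabet $A$ is a nonempty closed subset $X\subseteq A^{\mathbb Z}$ with $T(X)=X$, $T$ the shift map; it is minimal if it is minimal for inclusion among shift spaces. $L(X)\subseteq A^+$ is the set of nonempty finite factors of elements of $X$. Topological rank: an ordered Bratteli diagram consists of finite nonempty vertex sets $V_0=\{v_0\},V_1,V_2,\dots$ and finite edge sets $E_i$ ($i\ge1$) of edges from $V_{i-1}$ to $V_i$, such that every vertex is the source of some edge, every vertex other than $v_0$ is the range of some edge, and the edges with a common range are linearly ordered. It is properly ordered if it is simple (for each $i$ there is $j>i$ such that every vertex of $V_i$ is joined by a path to every vertex of $V_j$) and has a unique infinite path all of whose edges are maximal and a unique infinite path all of whose edges are minimal. The Vershik map on the space of infinite paths from $v_0$ is the successor map on non-maximal paths and sends the maximal path to the minimal one. A minimal shift space $X$ is represented by such a diagram if $(X,T)$ is topologically conjugate to the corresponding Vershik system. $X$ has finite topological rank if it has such a representation with $\sup_i|V_i|<\infty$, and the topological rank is the least value of this bound over all such representations. (It is a known fact, due to Donoso, Durand, Maass and Petite, that $X$ has topological rank at most $n$ iff it is topologically conjugate to the shift space $X(\boldsymbol{\sigma})$ of some proper, recognizable, primitive directive sequence $\boldsymbol{\sigma}$ of alphabet rank at most $n$.) A pseudovariety of semigroups is a class of finite semigroups closed under subsemigroups, homomorphic images and finite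 direct products. $\mathsf{LSl}$ is the pseudovariety of finite semigroups $S$ such that $eSe$ is a semilattice (commutative with all elements idempotent) for every idempotent $e\in S$. $\overline{\Omega}_A\mathsf V$ is the free pro-$\mathsf V$ semigroup on $A$ (pro-$\mathsf V$: inverse limit of members of $\mathsf V$ with discrete topologies); for the $\mathsf V$ considered it contains $A^+$ as a dense subsemigroup. For $X\subseteq A^{\mathbb Z}$ a minimal shift space, the set $\overline{L(X)}\setminus L(X)$ (closure in $\overline{\Omega}_A\mathsf V$) is contained in a single regular $\mathcal J$-class $J_{\mathsf V}(X)$ of $\overline{\Omega}_A\mathsf V$; the maximal subgroups in $J_{\mathsf V}(X)$ are all isomorphic profinite groups, and $G_{\mathsf V}(X)$ denotes any of them. The rank of a finitely generated profinite semigroup $S$ is the least positive integer $k$ such that some subset of $S$ with at most $k$ elements generates a dense subsemigroup. *)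

theory Defs
  imports "HOL-Algebra.Group" "HOL-Analysis.Analysis"
begin

section \<open>Shift spaces\<close>

definition shift :: "(int \<Rightarrow> 'a) \<Rightarrow> (int \<Rightarrow> 'a)" where
  "shift x = (\<lambda>i. x (i + 1))"

definition full_shift_top :: "'a set \<Rightarrow> (int \<Rightarrow> 'a) topology" where
  "full_shift_top A = product_topology (\<lambda>_. discrete_topology A) UNIV"

definition shift_space :: "'a set \<Rightarrow> (int \<Rightarrow> 'a) set \<Rightarrow> bool" where
  "shift_space A X \<longleftrightarrow> X \<noteq> {} \<and> closedin (full_shift_top A) X \<and> shift ` X = X"

definition minimal_shift_space :: "'a set \<Rightarrow> (int \<Rightarrow> 'a) set \<Rightarrow> bool" where
  "minimal_shift_space A X \<longleftrightarrow>
     shift_space A X \<and> (\<forall>Y. shift_space A Y \<and> Y \<subseteq> X \<longrightarrow> Y = X)"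

definition language :: "(int \<Rightarrow> 'a) set \<Rightarrow> 'a list set" where
  "language X = {map x [i..j] | x i j. x \<in> X \<and> i \<le> j}"


section \<open>Ordered Bratteli diagrams and topological rank\<close>

text \<open>
  Since all vertex and edge sets are finite, vertices and edges can be taken to be natural
  numbers. Vertices and edges are always used together with their level, so the sets at
  different levels need not be disjoint. Edge levels start at 0: the set \<open>bd_E B i\<close>
  consists of the edges from \<open>bd_V B i\<close> to \<open>bd_V B (Suc i)\<close>, i.e. it is the set usually
  written with index \<open>i + 1\<close>. Only pairs of edges with the same range are compared by
  \<open>bd_ord B i\<close>; other pairs in that relation are irrelevant.
\<close>

record bratteli =
  bd_V :: "nat \<Rightarrow> nat set"
  bd_E :: "nat \<Rightarrow> nat set"
  bd_src :: "nat \<Rightarrow> nat \<Rightarrow> nat"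
  bd_rng :: "nat \<Rightarrow> nat \<Rightarrow> nat"
  bd_ord :: "nat \<Rightarrow> (nat \<times> nat) set"

definition edges_into :: "bratteli \<Rightarrow> nat \<Rightarrow> nat \<Rightarrow> nat set" where
  "edges_into B i v = {e \<in> bd_E B i. bd_rng B i e = v}"

definition ordered_bratteli_diagram :: "bratteli \<Rightarrow> bool" where
  "ordered_bratteli_diagram B \<longleftrightarrow>
     (\<exists>v0. bd_V B 0 = {v0}) \<and>
     (\<forall>i. finite (bd_V B i) \<and> bd_V B i \<noteq> {} \<and> finite (bd_E B i)) \<and>
     (\<forall>i. \<forall>e \<in> bd_E B i. bd_src B i e \<in> bd_V B i \<and> bd_rng B i e \<in> bd_V B (Suc i)) \<and>
     (\<forall>i. \<forall>v \<in> bd_V B i. \<exists>e \<in> bd_E B i. bd_src B i e = v) \<and>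
     (\<forall>i. \<forall>v \<in> bd_V B (Suc i). edges_into B i v \<noteq> {}) \<and>
     (\<forall>i. \<forall>v \<in> bd_V B (Suc i).
        linear_order_on (edges_into B i v) (Restr (bd_ord B i) (edges_into B i v)))"

definition bd_paths :: "bratteli \<Rightarrow> (nat \<Rightarrow> nat) set" where
  "bd_paths B = {p. (\<forall>i. p i \<in> bd_E B i) \<and> (\<forall>i. bd_rng B i (p i) = bd_src B (Suc i) (p (Suc i)))}"

definition bd_path_top :: "bratteli \<Rightarrow> (nat \<Rightarrow> nat) topology" where
  "bd_path_top B =
     subtopology (product_topology (\<lambda>i. discrete_topology (bd_E B i)) UNIV) (bd_paths B)"

definition joined_by_path :: "bratteli \<Rightarrow> nat \<Rightarrow> nat \<Rightarrow> nat \<Rightarrow> nat \<Rightarrow> bool" where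
  "joined_by_path B i u j v \<longleftrightarrow>
     (\<exists>p. (\<forall>k. i \<le> k \<and> k < j \<longrightarrow> p k \<in> bd_E B k) \<and>
          (\<forall>k. i \<le> k \<and> Suc k < j \<longrightarrow> bd_rng B k (p k) = bd_src B (Suc k) (p (Suc k))) \<and>
          bd_src B i (p i) = u \<and> bd_rng B (j - 1) (p (j - 1)) = v)"

definition bd_simple :: "bratteli \<Rightarrow> bool" where
  "bd_simple B \<longleftrightarrow>
     (\<forall>i. \<exists>j > i. \<forall>u \<in> bd_V B i. \<forall>v \<in> bd_V B j. joined_by_path B i u j v)"

definition max_path :: "bratteli \<Rightarrow> (nat \<Rightarrow> nat) \<Rightarrow> bool" where
  "max_path B p \<longleftrightarrow> p \<in> bd_paths B \<and>
     (\<forall>i. \<forall>e \<in> edges_into B i (bd_rng B i (p i)). (e, p i) \<in> bd_ord B i)"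

definition min_path :: "bratteli \<Rightarrow> (nat \<Rightarrow> nat) \<Rightarrow> bool" where
  "min_path B p \<longleftrightarrow> p \<in> bd_paths B \<and>
     (\<forall>i. \<forall>e \<in> edges_into B i (bd_rng B i (p i)). (p i, e) \<in> bd_ord B i)"

definition properly_ordered :: "bratteli \<Rightarrow> bool" where
  "properly_ordered B \<longleftrightarrow> ordered_bratteli_diagram B \<and> bd_simple B \<and>
     (\<exists>!p. max_path B p) \<and> (\<exists>!p. min_path B p)"

text \<open>
  The order on infinite paths: two distinct cofinal paths are compared at the last edge where
  they differ. The two edges there have the same range, because the paths agree afterwards.
\<close>

definition path_less :: "bratteli \<Rightarrow> (nat \<Rightarrow> nat) \<Rightarrow> (nat \<Rightarrow> nat) \<Rightarrow> bool" where
  "path_less B p q \<longleftrightarrow> p \<in> bd_paths B \<and> q \<in> bd_paths B \<and>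
     (\<exists>k. p k \<noteq> q k \<and> (p k, q k) \<in> bd_ord B k \<and> (\<forall>j > k. p j = q j))"

definition path_succ :: "bratteli \<Rightarrow> (nat \<Rightarrow> nat) \<Rightarrow> (nat \<Rightarrow> nat) \<Rightarrow> bool" where
  "path_succ B p q \<longleftrightarrow> path_less B p q \<and> \<not> (\<exists>r. path_less B p r \<and> path_less B r q)"

definition vershik :: "bratteli \<Rightarrow> (nat \<Rightarrow> nat) \<Rightarrow> (nat \<Rightarrow> nat)" where
  "vershik B p = (if max_path B p then (THE q. min_path B q) else (THE q. path_succ B p q))"

definition represented_by :: "'a set \<Rightarrow> (int \<Rightarrow> 'a) set \<Rightarrow> bratteli \<Rightarrow> bool" where
  "represented_by A X B \<longleftrightarrow> properly_ordered B \<and>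
     (\<exists>\<phi>. homeomorphic_map (subtopology (full_shift_top A) X) (bd_path_top B) \<phi> \<and>
          (\<forall>x \<in> X. \<phi> (shift x) = vershik B (\<phi> x)))"

definition representation_bounds :: "'a set \<Rightarrow> (int \<Rightarrow> 'a) set \<Rightarrow> nat set" where
  "representation_bounds A X =
     {SUP i. card (bd_V B i) | B. represented_by A X B \<and> bdd_above (range (\<lambda>i. card (bd_V B i)))}"

definition finite_topological_rank :: "'a set \<Rightarrow> (int \<Rightarrow> 'a) set \<Rightarrow> bool" where
  "finite_topological_rank A X \<longleftrightarrow> representation_bounds A X \<noteq> {}"

definition topological_rank :: "'a set \<Rightarrow> (int \<Rightarrow> 'a) set \<Rightarrow> nat" where
  "topological_rank A X = (LEAST n. n \<in> representation_bounds A X)"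


section \<open>Semigroups\<close>

record 'a sgrp = "'a partial_object" +
  sg_mult :: "'a \<Rightarrow> 'a \<Rightarrow> 'a"

definition is_semigroup :: "'a sgrp \<Rightarrow> bool" where
  "is_semigroup S \<longleftrightarrow> carrier S \<noteq> {} \<and>
     (\<forall>x \<in> carrier S. \<forall>y \<in> carrier S. sg_mult S x y \<in> carrier S) \<and>
     (\<forall>x \<in> carrier S. \<forall>y \<in> carrier S. \<forall>z \<in> carrier S.
        sg_mult S (sg_mult S x y) z = sg_mult S x (sg_mult S y z))"

definition is_group :: "'a sgrp \<Rightarrow> bool" where
  "is_group S \<longleftrightarrow> (\<exists>e. group \<lparr>carrier = carrier S, monoid.mult = sg_mult S, one = e\<rparr>)"

definition restrict_sgrp :: "'a sgrp \<Rightarrow> 'a set \<Rightarrow> 'a sgrp" where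
  "restrict_sgrp S H = \<lparr>carrier = H, sg_mult = sg_mult S\<rparr>"

definition subsemigroup :: "'a set \<Rightarrow> 'a sgrp \<Rightarrow> bool" where
  "subsemigroup H S \<longleftrightarrow> H \<subseteq> carrier S \<and> is_semigroup (restrict_sgrp S H)"

definition sg_hom :: "'a sgrp \<Rightarrow> 'b sgrp \<Rightarrow> ('a \<Rightarrow> 'b) set" where
  "sg_hom S T = {h \<in> carrier S \<rightarrow> carrier T.
     \<forall>x \<in> carrier S. \<forall>y \<in> carrier S. h (sg_mult S x y) = sg_mult T (h x) (h y)}"

definition sg_iso :: "'a sgrp \<Rightarrow> 'b sgrp \<Rightarrow> ('a \<Rightarrow> 'b) set" where
  "sg_iso S T = {h \<in> sg_hom S T. bij_betw h (carrier S) (carrier T)}"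

definition direct_prod :: "'i set \<Rightarrow> ('i \<Rightarrow> 'a sgrp) \<Rightarrow> ('i \<Rightarrow> 'a) sgrp" where
  "direct_prod I S = \<lparr>carrier = Pi\<^sub>E I (\<lambda>i. carrier (S i)),
     sg_mult = (\<lambda>x y. \<lambda>i \<in> I. sg_mult (S i) (x i) (y i))\<rparr>"

inductive_set sg_generate :: "'a sgrp \<Rightarrow> 'a set \<Rightarrow> 'a set"
  for S :: "'a sgrp" and B :: "'a set" where
  base: "b \<in> B \<Longrightarrow> b \<in> sg_generate S B"
| mult: "x \<in> sg_generate S B \<Longrightarrow> y \<in> sg_generate S B \<Longrightarrow> sg_mult S x y \<in> sg_generate S B"

fun word_prod :: "'a sgrp \<Rightarrow> 'a list \<Rightarrow> 'a" where
  "word_prod S [] = undefined"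
| "word_prod S [x] = x"
| "word_prod S (x # y # xs) = sg_mult S x (word_prod S (y # xs))"


subsection \<open>Green's relation J and maximal subgroups\<close>

definition principal_ideal :: "'a sgrp \<Rightarrow> 'a \<Rightarrow> 'a set" where
  "principal_ideal S x =
     {x} \<union> {sg_mult S s x | s. s \<in> carrier S} \<union> {sg_mult S x t | t. t \<in> carrier S} \<union>
     {sg_mult S (sg_mult S s x) t | s t. s \<in> carrier S \<and> t \<in> carrier S}"

definition J_classes :: "'a sgrp \<Rightarrow> 'a set set" where
  "J_classes S =
     {{y \<in> carrier S. principal_ideal S y = principal_ideal S x} | x. x \<in> carrier S}"

definition maximal_subgroups :: "'a sgrp \<Rightarrow> 'a set set" where
  "maximal_subgroups S = {H. H \<subseteq> carrier S \<and> is_group (restrict_sgrp S H) \<and>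
     (\<forall>K. K \<subseteq> carrier S \<and> is_group (restrict_sgrp S K) \<and> H \<subseteq> K \<longrightarrow> K = H)}"


subsection \<open>Inverse limits, profinite groups and rank\<close>

definition inverse_system ::
    "'i set \<Rightarrow> ('i \<Rightarrow> 'i \<Rightarrow> bool) \<Rightarrow> ('i \<Rightarrow> 'a sgrp) \<Rightarrow> ('i \<Rightarrow> 'i \<Rightarrow> 'a \<Rightarrow> 'a) \<Rightarrow> bool" where
  "inverse_system I rel F f \<longleftrightarrow>
     I \<noteq> {} \<and>
     (\<forall>i \<in> I. rel i i) \<and>
     (\<forall>i \<in> I. \<forall>j \<in> I. \<forall>k \<in> I. rel i j \<and> rel j k \<longrightarrow> rel i k) \<and>
     (\<forall>i \<in> I. \<forall>j \<in> I. \<exists>k \<in> I. rel i k \<and> rel j k) \<and>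
     (\<forall>i \<in> I. is_semigroup (F i)) \<and>
     (\<forall>i \<in> I. \<forall>j \<in> I. rel i j \<longrightarrow> f i j \<in> sg_hom (F j) (F i)) \<and>
     (\<forall>i \<in> I. \<forall>x \<in> carrier (F i). f i i x = x) \<and>
     (\<forall>i \<in> I. \<forall>j \<in> I. \<forall>k \<in> I. rel i j \<and> rel j k \<longrightarrow>
        (\<forall>x \<in> carrier (F k). f i j (f j k x) = f i k x))"

definition inverse_limit ::
    "'i set \<Rightarrow> ('i \<Rightarrow> 'i \<Rightarrow> bool) \<Rightarrow> ('i \<Rightarrow> 'a sgrp) \<Rightarrow> ('i \<Rightarrow> 'i \<Rightarrow> 'a \<Rightarrow> 'a) \<Rightarrow> ('i \<Rightarrow> 'a) sgrp" where
  "inverse_limit I rel F f = restrict_sgrp (direct_prod I F)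
     {x \<in> carrier (direct_prod I F). \<forall>i \<in> I. \<forall>j \<in> I. rel i j \<longrightarrow> f i j (x j) = x i}"

definition inverse_limit_top ::
    "'i set \<Rightarrow> ('i \<Rightarrow> 'i \<Rightarrow> bool) \<Rightarrow> ('i \<Rightarrow> 'a sgrp) \<Rightarrow> ('i \<Rightarrow> 'i \<Rightarrow> 'a \<Rightarrow> 'a) \<Rightarrow> ('i \<Rightarrow> 'a) topology" where
  "inverse_limit_top I rel F f =
     subtopology (product_topology (\<lambda>i. discrete_topology (carrier (F i))) I)
       (carrier (inverse_limit I rel F f))"

text \<open>
  A profinite group is a topological group isomorphic (algebraically and topologically) to an
  inverse limit of finite discrete groups. Fixing the index type to \<open>'g set\<close> loses nothing:
  a profinite group is the inverse limit of its quotients by its open normal subgroups.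
\<close>

definition profinite_group :: "'g sgrp \<Rightarrow> 'g topology \<Rightarrow> bool" where
  "profinite_group G \<tau> \<longleftrightarrow> is_group G \<and> topspace \<tau> = carrier G \<and>
     (\<exists>(I :: 'g set set) rel (F :: 'g set \<Rightarrow> nat sgrp) f \<psi>.
        inverse_system I rel F f \<and>
        (\<forall>i \<in> I. finite (carrier (F i)) \<and> is_group (F i)) \<and>
        \<psi> \<in> sg_iso G (inverse_limit I rel F f) \<and>
        homeomorphic_map \<tau> (inverse_limit_top I rel F f) \<psi>)"

definition top_generates :: "'a sgrp \<Rightarrow> 'a topology \<Rightarrow> 'a set \<Rightarrow> bool" where
  "top_generates S \<tau> B \<longleftrightarrow> B \<subseteq> carrier S \<and> \<tau> closure_of (sg_generate S B) = topspace \<tau>"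

definition top_finitely_generated :: "'a sgrp \<Rightarrow> 'a topology \<Rightarrow> bool" where
  "top_finitely_generated S \<tau> \<longleftrightarrow> (\<exists>B. finite B \<and> top_generates S \<tau> B)"

text \<open>Meaningful only for topologically finitely generated semigroups.\<close>

definition profinite_rank :: "'a sgrp \<Rightarrow> 'a topology \<Rightarrow> nat" where
  "profinite_rank S \<tau> = (LEAST k. 0 < k \<and> (\<exists>B. finite B \<and> card B \<le> k \<and> top_generates S \<tau> B))"


subsection \<open>Pseudovarieties and free pro-V semigroups\<close>

text \<open>
  A class of finite semigroups closed under isomorphism is given by its members whose carrier
  is a set of natural numbers. Closure under isomorphism is included in closure under
  homomorphic images. Finite direct products include the empty one; a product has carrier type
  \<open>nat \<Rightarrow> nat\<close>, so the closure condition is about its isomorphic copies on natural numbers.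
\<close>

definition pseudovariety :: "nat sgrp set \<Rightarrow> bool" where
  "pseudovariety V \<longleftrightarrow>
     (\<forall>S \<in> V. is_semigroup S \<and> finite (carrier S)) \<and>
     (\<forall>S \<in> V. \<forall>H. subsemigroup H S \<longrightarrow> restrict_sgrp S H \<in> V) \<and>
     (\<forall>S \<in> V. \<forall>T h. is_semigroup T \<and> h \<in> sg_hom S T \<and> h ` carrier S = carrier T \<longrightarrow> T \<in> V) \<and>
     (\<forall>(k :: nat) S T h. (\<forall>i < k. S i \<in> V) \<and> is_semigroup T \<and>
        h \<in> sg_iso (direct_prod {..<k} S) T \<longrightarrow> T \<in> V)"

definition is_semilattice :: "'a sgrp \<Rightarrow> bool" where
  "is_semilattice S \<longleftrightarrow> is_semigroup S \<and>
     (\<forall>x \<in> carrier S. sg_mult S x x = x) \<and>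
     (\<forall>x \<in> carrier S. \<forall>y \<in> carrier S. sg_mult S x y = sg_mult S y x)"

definition LSl :: "nat sgrp set" where
  "LSl = {S. is_semigroup S \<and> finite (carrier S) \<and>
     (\<forall>e \<in> carrier S. sg_mult S e e = e \<longrightarrow>
        is_semilattice (restrict_sgrp S {sg_mult S (sg_mult S e s) e | s. s \<in> carrier S}))}"

text \<open>
  The free pro-V semigroup on \<open>A\<close> is the inverse limit of the \<open>A\<close>-generated members of V.
  These are pairs of a member \<open>S\<close> and a map \<open>\<phi>\<close> from \<open>A\<close> onto a generating set of \<open>S\<close>; they are
  preordered by the existence of a homomorphism that respects the generators. That
  homomorphism is unique on the carrier when it exists, so the choice made in
  \<open>gen_trans\<close> is immaterial.
\<close>

type_synonym 'a gen_sgrp = "nat sgrp \<times> ('a \<Rightarrow> nat)"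

definition generated_members :: "nat sgrp set \<Rightarrow> 'a set \<Rightarrow> 'a gen_sgrp set" where
  "generated_members V A =
     {(S, \<phi>). S \<in> V \<and> \<phi> \<in> A \<rightarrow>\<^sub>E carrier S \<and> sg_generate S (\<phi> ` A) = carrier S}"

definition gen_homs :: "'a set \<Rightarrow> 'a gen_sgrp \<Rightarrow> 'a gen_sgrp \<Rightarrow> (nat \<Rightarrow> nat) set" where
  "gen_homs A i j = {h \<in> sg_hom (fst j) (fst i). \<forall>a \<in> A. h (snd j a) = snd i a}"

definition gen_le :: "'a set \<Rightarrow> 'a gen_sgrp \<Rightarrow> 'a gen_sgrp \<Rightarrow> bool" where
  "gen_le A i j \<longleftrightarrow> gen_homs A i j \<noteq> {}"

definition gen_trans :: "'a set \<Rightarrow> 'a gen_sgrp \<Rightarrow> 'a gen_sgrp \<Rightarrow> nat \<Rightarrow> nat" where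
  "gen_trans A i j = (SOME h. h \<in> gen_homs A i j)"

definition free_pro :: "nat sgrp set \<Rightarrow> 'a set \<Rightarrow> ('a gen_sgrp \<Rightarrow> nat) sgrp" where
  "free_pro V A = inverse_limit (generated_members V A) (gen_le A) fst (gen_trans A)"

definition free_pro_top :: "nat sgrp set \<Rightarrow> 'a set \<Rightarrow> ('a gen_sgrp \<Rightarrow> nat) topology" where
  "free_pro_top V A = inverse_limit_top (generated_members V A) (gen_le A) fst (gen_trans A)"

text \<open>The canonical map from nonempty words over \<open>A\<close> to the free pro-V semigroup.\<close>

definition word_embed :: "nat sgrp set \<Rightarrow> 'a set \<Rightarrow> 'a list \<Rightarrow> ('a gen_sgrp \<Rightarrow> nat)" where
  "word_embed V A w = (\<lambda>(S, \<phi>) \<in> generated_members V A. word_prod S (map \<phi> w))"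


section \<open>The Schuetzenberger group of a minimal shift space\<close>

definition J_class_of ::
    "nat sgrp set \<Rightarrow> 'a set \<Rightarrow> (int \<Rightarrow> 'a) set \<Rightarrow> ('a gen_sgrp \<Rightarrow> nat) set" where
  "J_class_of V A X = (THE J. J \<in> J_classes (free_pro V A) \<and>
     free_pro_top V A closure_of (word_embed V A ` language X) - word_embed V A ` language X \<subseteq> J)"

text \<open>
  The Schuetzenberger group is only determined up to isomorphism: it is any one of the maximal
  subgroups contained in the J-class.
\<close>

definition schutzenberger_groups ::
    "nat sgrp set \<Rightarrow> 'a set \<Rightarrow> (int \<Rightarrow> 'a) set \<Rightarrow> ('a gen_sgrp \<Rightarrow> nat) set set" where
  "schutzenberger_groups V A X = {H \<in> maximal_subgroups (free_pro V A). H \<subseteq> J_class_of V A X}"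

end

theory Submission
  imports Defs
begin

text \<open>
  Let \<open>xs\<close> be the point of \<open>X\<close> that corresponds to the minimal path of a diagram with at most
  \<open>n\<close> vertices per level. The paths whose first \<open>m\<close> edges are minimal form clopen sets that
  shrink to \<open>xs\<close>, and the first return word of such a path depends only on the vertex that it
  reaches at level \<open>m\<close>. So \<open>xs\<close> has arbitrarily small clopen neighbourhoods with at most
  \<open>n\<close> return words, and neither recognizability nor directive sequences are needed.

  Let \<open>e\<close> be an idempotent that is a limit of prefixes \<open>xs[0,l)\<close> whose length \<open>l\<close> is a return
  time of \<open>xs\<close> to ever smaller neighbourhoods of itself. In a finite quotient, every return word
  \<open>u\<close> of a small neighbourhood commutes with \<open>e\<close>, and \<open>e u\<close> is a unit of the local monoid at
  \<open>e\<close>. Conversely, since V contains LSl, an element of the maximal subgroup at \<open>e\<close> is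
  approximated by words between two occurrences of the centre of \<open>xs\<close> all of whose short factors
  occur in \<open>X\<close>, and such words are products of return words. A limit \<open>(g\<^sub>1, \<dots>, g\<^sub>n)\<close> of
  the tuples of return words of shrinking neighbourhoods therefore gives topological generators
  \<open>e g\<^sub>1 e, \<dots>, e g\<^sub>n e\<close>. The other maximal subgroups of the J-class are conjugate.
\<close>

section \<open>Finite semigroups\<close>

text \<open>Two obstacles shape the proof. First, a word that represents a group element in some
  finite quotient need not lie in the language of \<open>X\<close>, so it cannot simply be cut at
  its visits to a neighbourhood of \<open>xs\<close>. A quotient in \<open>LSl\<close> controls only
  factors of bounded length. This is enough because returns have bounded gaps: from a visit, the
  next one is always visible in a window of fixed length. Secondly, how small the neighbourhood must
  be depends on the finite quotient, whereas the generators have to be fixed before any quotient is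
  chosen. Listing the return words as \<open>n\<close>-tuples, with repetitions, makes a compactness
  argument possible: in every quotient, the coordinates of the limit tuple are values of return
  words of arbitrarily small neighbourhoods. Existence statements in the free pro-V semigroup are
  obtained in the finite quotients, where J-equivalence is stable, and lifted either by uniqueness
  of the witnesses or by compactness.\<close>

lemma is_semigroupD:
  assumes "is_semigroup S"
  shows "carrier S \<noteq> {}"
    and "\<And>x y. x \<in> carrier S \<Longrightarrow> y \<in> carrier S \<Longrightarrow> sg_mult S x y \<in> carrier S"
    and "\<And>x y z. x \<in> carrier S \<Longrightarrow> y \<in> carrier S \<Longrightarrow> z \<in> carrier S \<Longrightarrow>
           sg_mult S (sg_mult S x y) z = sg_mult S x (sg_mult S y z)"
  using assms unfolding is_semigroup_def by auto

locale sgrp =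
  fixes S :: "'b sgrp"
  assumes sgrp: "is_semigroup S"
begin

abbreviation mult (infixl "\<odot>" 70) where "x \<odot> y \<equiv> sg_mult S x y"

lemma closed [simp, intro]: "x \<in> carrier S \<Longrightarrow> y \<in> carrier S \<Longrightarrow> x \<odot> y \<in> carrier S"
  and assoc: "x \<in> carrier S \<Longrightarrow> y \<in> carrier S \<Longrightarrow> z \<in> carrier S \<Longrightarrow> x \<odot> y \<odot> z = x \<odot> (y \<odot> z)"
  using is_semigroupD[OF sgrp] by auto

text \<open>A semigroup has no unit, so powers appear as iterated multiplication operators:
  \<open>((\<odot>) a ^^ n) t\<close> stands for a power of \<open>a\<close> times \<open>t\<close>
  and makes sense for \<open>n = 0\<close> too.\<close>

lemma funpow_closed:
  "a \<in> carrier S \<Longrightarrow> t \<in> carrier S \<Longrightarrow> ((\<odot>) a ^^ n) t \<in> carrier S"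
  "a \<in> carrier S \<Longrightarrow> t \<in> carrier S \<Longrightarrow> ((\<lambda>x. x \<odot> a) ^^ n) t \<in> carrier S"
  by (induction n) auto

lemma funpow_mult:
  "a \<in> carrier S \<Longrightarrow> s \<in> carrier S \<Longrightarrow> t \<in> carrier S \<Longrightarrow> ((\<odot>) a ^^ n) s \<odot> t = ((\<odot>) a ^^ n) (s \<odot> t)"
  "a \<in> carrier S \<Longrightarrow> s \<in> carrier S \<Longrightarrow> t \<in> carrier S \<Longrightarrow>
     s \<odot> ((\<lambda>x. x \<odot> a) ^^ n) t = ((\<lambda>x. x \<odot> a) ^^ n) (s \<odot> t)"
  by (induction n) (auto simp: assoc funpow_closed, simp flip: assoc add: funpow_closed)

end

locale finite_sgrp = sgrp +
  assumes fin: "finite (carrier S)"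
begin

text \<open>
  Iterating \<open>t = a t d\<close> gives \<open>t = a\<^sup>n t d\<^sup>n\<close> for all \<open>n\<close>; by finiteness
  \<open>a\<^sup>i t = a\<^sup>j t\<close> for some \<open>i < j\<close>, whence \<open>t = a\<^sup>j\<^sup>-\<^sup>i t\<close>.
\<close>

lemma absorb_left:
  assumes c: "a \<in> carrier S" "t \<in> carrier S" "d \<in> carrier S" and t: "t = a \<odot> t \<odot> d"
  shows "\<exists>n. ((\<odot>) a ^^ Suc n) t = t"
proof -
  define L where "L n = ((\<odot>) a ^^ n) t" for n
  define R where "R n x = ((\<lambda>x. x \<odot> d) ^^ n) x" for n x
  have L: "L n \<in> carrier S" for n
    unfolding L_def by (intro funpow_closed c)
  have R: "x \<in> carrier S \<Longrightarrow> R n x \<in> carrier S" for n x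
    unfolding R_def by (intro funpow_closed c)
  have comm: "R n (a \<odot> x) = a \<odot> R n x" if "x \<in> carrier S" for n x
    unfolding R_def using funpow_mult(2)[of d a x n] c that by simp
  have Lpow: "R n (((\<odot>) a ^^ k) x) = ((\<odot>) a ^^ k) (R n x)" if "x \<in> carrier S" for n k x
    using that by (induction k) (auto simp: comm funpow_closed c)
  have tn: "R n (L n) = t" for n
  proof (induction n)
    case (Suc n)
    have "R (Suc n) (L (Suc n)) = R n (L (Suc n) \<odot> d)"
      by (simp add: R_def funpow_Suc_right del: funpow.simps)
    also have "L (Suc n) \<odot> d = ((\<odot>) a ^^ n) (a \<odot> t \<odot> d)"
      unfolding L_def funpow_Suc_right comp_def using c funpow_mult(1)[of a "a \<odot> t" d n] by simp
    also have "\<dots> = L n" using t by (simp add: L_def)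
    finally show ?case using Suc by simp
  qed (simp add: R_def L_def)
  have "\<not> inj L"
  proof
    assume "inj L"
    moreover have "range L \<subseteq> carrier S" using L by auto
    ultimately show False using fin by (meson finite_imageD finite_subset infinite_UNIV_nat)
  qed
  then obtain i j where ij: "L i = L j" "i < j"
    unfolding inj_def by (metis linorder_neqE_nat)
  define k where "k = j - i - 1"
  have j: "j = Suc k + i" using ij unfolding k_def by simp
  have "t = R i (L j)" using tn[of i] ij by simp
  also have "L j = ((\<odot>) a ^^ Suc k) (L i)"
    unfolding j L_def funpow_add by simp
  also have "R i \<dots> = ((\<odot>) a ^^ Suc k) t"
    using Lpow[OF L, of i "Suc k" i] tn by (simp only:)
  finally show ?thesis by metis
qed

text \<open>Stability of finite semigroups: an element J-equivalent to its left multiple by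
  \<open>p\<close> is even L-equivalent to it. Regrouped as \<open>t = (c p) t d\<close>, the
  equation makes \<open>t\<close> a fixed point of a positive power of \<open>c p\<close> by
  \<open>absorb_left\<close>; splitting off the last \<open>p\<close> leaves
  \<open>y\<close>.\<close>

lemma stable_left:
  assumes c: "c \<in> carrier S" "t \<in> carrier S" "d \<in> carrier S" "p \<in> carrier S"
    and t: "t = c \<odot> (p \<odot> t) \<odot> d"
  shows "\<exists>y\<in>carrier S. t = y \<odot> (p \<odot> t)"
proof -
  have "t = (c \<odot> p) \<odot> t \<odot> d" using t c by (simp add: assoc)
  then obtain n where n: "((\<odot>) (c \<odot> p) ^^ Suc n) t = t"
    using absorb_left[of "c \<odot> p" t d] c by auto
  have "((\<odot>) (c \<odot> p) ^^ n) c \<odot> (p \<odot> t) = ((\<odot>) (c \<odot> p) ^^ n) (c \<odot> (p \<odot> t))"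
    using c by (intro funpow_mult) auto
  also have "\<dots> = t"
    using n c unfolding funpow_Suc_right by (simp add: assoc)
  finally show ?thesis using c by (intro bexI[of _ "((\<odot>) (c \<odot> p) ^^ n) c"]) (auto simp: funpow_closed)
qed

end

text \<open>Serves to derive \<open>stable_right\<close> from \<open>stable_left\<close>.\<close>

definition op_sgrp :: "'b sgrp \<Rightarrow> 'b sgrp" where
  "op_sgrp S = \<lparr>carrier = carrier S, sg_mult = (\<lambda>x y. sg_mult S y x)\<rparr>"

context finite_sgrp
begin

lemma op: "finite_sgrp (op_sgrp S)"
  using fin is_semigroupD[OF sgrp] by unfold_locales (auto simp: op_sgrp_def is_semigroup_def)

lemma stable_right:
  assumes c: "c \<in> carrier S" "t \<in> carrier S" "d \<in> carrier S" "p \<in> carrier S"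
    and t: "t = c \<odot> (t \<odot> p) \<odot> d"
  shows "\<exists>y\<in>carrier S. t = t \<odot> p \<odot> y"
proof -
  interpret o: finite_sgrp "op_sgrp S" by (rule op)
  show ?thesis using o.stable_left[of d t c p] c t by (auto simp: op_sgrp_def assoc)
qed

text \<open>Stability gives a left inverse \<open>y\<close> and a right inverse \<open>z\<close> of
  \<open>g\<close> relative to \<open>e\<close>. Compressed to the local monoid at \<open>e\<close>
  they coincide, as in any monoid.\<close>

lemma local_unit:
  assumes c: "c \<in> carrier S" "d \<in> carrier S" "e \<in> carrier S" "g \<in> carrier S"
    and g: "e \<odot> g = g" "g \<odot> e = g" and e: "e \<odot> e = e" and j: "e = c \<odot> g \<odot> d"
  shows "\<exists>y\<in>carrier S. e \<odot> y = y \<and> y \<odot> e = y \<and> y \<odot> g = e \<and> g \<odot> y = e"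
proof -
  obtain y where y: "y \<in> carrier S" "e = y \<odot> g"
    using stable_left[of c e d g] c g j by auto
  obtain z where z: "z \<in> carrier S" "e = g \<odot> z"
    using stable_right[of c e d g] c g j by auto
  have 1: "e \<odot> y \<odot> e = e \<odot> y \<odot> (g \<odot> z)" using z by simp
  also have "\<dots> = e \<odot> (y \<odot> g) \<odot> z" using y(1) z(1) c by (simp add: assoc)
  also have "\<dots> = e \<odot> z" using y e by simp
  finally have yz: "e \<odot> y \<odot> e = e \<odot> z" .
  have "e \<odot> y \<odot> e \<odot> g = e" using y c g e by (simp add: assoc)
  moreover have "g \<odot> (e \<odot> y \<odot> e) = e"
    unfolding yz using z c g by (simp flip: assoc)
  moreover have "e \<odot> (e \<odot> y \<odot> e) = e \<odot> y \<odot> e" "(e \<odot> y \<odot> e) \<odot> e = e \<odot> y \<odot> e"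
    using y c e by (simp_all add: assoc) (simp flip: assoc add: e)
  ultimately show ?thesis using y c by (intro bexI[of _ "e \<odot> y \<odot> e"]) auto
qed

text \<open>By \<open>local_unit\<close>, \<open>k\<close> is invertible in the local monoid at
  \<open>f\<close>, and an invertible idempotent is the identity.\<close>

lemma idempotent_below_eq:
  assumes "c \<in> carrier S" "d \<in> carrier S" "f \<in> carrier S" "k \<in> carrier S"
    and "f \<odot> k = k" "k \<odot> f = k" "f \<odot> f = f" "k \<odot> k = k" "f = c \<odot> k \<odot> d"
  shows "k = f"
proof -
  obtain y where "y \<in> carrier S" "y \<odot> k = f" using local_unit[of c d f k] assms by auto
  then show ?thesis using assms by (metis assoc)
qed

lemma idempotent_exists:
  assumes K: "K \<noteq> {}" "K \<subseteq> carrier S" "\<And>x y. x \<in> K \<Longrightarrow> y \<in> K \<Longrightarrow> x \<odot> y \<in> K"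
  shows "\<exists>e\<in>K. e \<odot> e = e"
proof -
  obtain s where s: "s \<in> K" using K by auto
  have sc: "s \<in> carrier S" using s K by auto
  define P where "P n = ((\<odot>) s ^^ n) s" for n
  have PK: "P n \<in> K" for n unfolding P_def using s K(3) by (induction n) auto
  have Pc: "P n \<in> carrier S" for n using PK K by auto
  \<comment> \<open>\<open>P n\<close> is the power of \<open>s\<close> with exponent
    \<open>n + 1\<close>, hence the extra successor.\<close>
  have add: "P m \<odot> P n = P (Suc (m + n))" for m n
  proof -
    have "P m \<odot> P n = ((\<odot>) s ^^ m) (s \<odot> P n)"
      unfolding P_def[of m] using funpow_mult(1)[of s s "P n" m] sc Pc by simp
    also have "\<dots> = P (Suc (m + n))"
      unfolding P_def using funpow_add[of m "Suc n" "(\<odot>) s"] by simp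
    finally show ?thesis .
  qed
  have "\<not> inj P"
  proof
    assume "inj P"
    moreover have "range P \<subseteq> carrier S" using Pc by auto
    ultimately show False using fin by (meson finite_imageD finite_subset infinite_UNIV_nat)
  qed
  then obtain i j where ij: "P i = P j" "i < j"
    unfolding inj_def by (metis linorder_neqE_nat)
  define p where "p = j - i"
  have p: "p > 0" "j = i + p" using ij by (auto simp: p_def)
  have per: "P (k + p) = P k" if "k \<ge> i" for k
  proof (cases "k = i")
    case True then show ?thesis using ij p by simp
  next
    case False
    then have "P (k + p) = P j \<odot> P (k - i - 1)" "P k = P i \<odot> P (k - i - 1)"
      unfolding add using that p by (auto intro!: arg_cong[of _ _ P])
    then show ?thesis using ij by simp
  qed
  have pern: "P (k + q * p) = P k" if "k \<ge> i" for k q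
  proof (induction q)
    case (Suc q)
    have "P (k + Suc q * p) = P ((k + q * p) + p)" by (simp add: algebra_simps)
    then show ?case using per[of "k + q * p"] that Suc by simp
  qed simp
  \<comment> \<open>The exponent of \<open>P k\<close> is then \<open>(i + 1) p\<close>, a multiple
    of the period beyond the preperiod, so squaring only adds full periods.\<close>
  define k where "k = Suc i * p - 1"
  have k: "k \<ge> i" "Suc k = Suc i * p"
    using p unfolding k_def by (cases p; simp)+
  have "P k \<odot> P k = P (k + Suc i * p)" unfolding add using k by (metis add_Suc_right)
  also have "\<dots> = P k" by (rule pern[OF k(1)])
  finally show ?thesis using PK by auto
qed

end

section \<open>Words and generated members\<close>

definition words :: "'a set \<Rightarrow> 'a list set" where
  "words A = {w. w \<noteq> [] \<and> set w \<subseteq> A}"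

definition ev :: "'a gen_sgrp \<Rightarrow> 'a list \<Rightarrow> nat" where
  "ev i w = word_prod (fst i) (map (snd i) w)"

lemma words_append [intro]: "u \<in> words A \<Longrightarrow> v \<in> words A \<Longrightarrow> u @ v \<in> words A"
  by (auto simp: words_def)

lemma word_prod_Cons: "w \<noteq> [] \<Longrightarrow> word_prod S (x # w) = sg_mult S x (word_prod S w)"
  by (cases w) auto

lemma word_prod_closed:
  assumes "is_semigroup S" "w \<noteq> []" "set w \<subseteq> carrier S"
  shows "word_prod S w \<in> carrier S"
  using assms(2,3)
  by (induction w rule: list_nonempty_induct) (auto simp: word_prod_Cons is_semigroupD[OF assms(1)])

lemma word_prod_append:
  assumes "is_semigroup S" "u \<noteq> []" "v \<noteq> []" "set u \<subseteq> carrier S" "set v \<subseteq> carrier S"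
  shows "word_prod S (u @ v) = sg_mult S (word_prod S u) (word_prod S v)"
  using assms(2,4)
proof (induction u rule: list_nonempty_induct)
  case (cons x xs)
  then show ?case
    using assms word_prod_closed[OF assms(1), of xs] word_prod_closed[OF assms(1), of v]
    by (simp add: word_prod_Cons is_semigroupD[OF assms(1)])
qed (use assms in \<open>simp add: word_prod_Cons\<close>)

lemma word_prod_hom:
  assumes "h \<in> sg_hom S T" "is_semigroup S" "w \<noteq> []" "set w \<subseteq> carrier S"
  shows "h (word_prod S w) = word_prod T (map h w)"
  using assms(3,4)
proof (induction w rule: list_nonempty_induct)
  case (cons x xs)
  then show ?case
    using assms(1) word_prod_closed[OF assms(2), of xs]
    by (simp add: word_prod_Cons sg_hom_def)
qed simp

lemma sg_generate_closed:
  assumes "is_semigroup S" "B \<subseteq> carrier S" "x \<in> sg_generate S B"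
  shows "x \<in> carrier S"
  using assms(3) by induction (use assms is_semigroupD[OF assms(1)] in auto)

lemma sg_generate_words:
  assumes S: "is_semigroup S" and \<phi>: "\<phi> ` A \<subseteq> carrier S"
  shows "sg_generate S (\<phi> ` A) = (\<lambda>w. word_prod S (map \<phi> w)) ` words A"
proof
  show "sg_generate S (\<phi> ` A) \<subseteq> (\<lambda>w. word_prod S (map \<phi> w)) ` words A"
  proof
    fix x assume "x \<in> sg_generate S (\<phi> ` A)"
    then show "x \<in> (\<lambda>w. word_prod S (map \<phi> w)) ` words A"
    proof induction
      case (base b)
      then obtain a where "a \<in> A" "b = \<phi> a" by auto
      then show ?case by (intro image_eqI[of _ _ "[a]"]) (auto simp: words_def)
    next
      case (mult x y)
      then obtain u v where "u \<in> words A" "x = word_prod S (map \<phi> u)"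
        "v \<in> words A" "y = word_prod S (map \<phi> v)" by auto
      moreover from this have "word_prod S (map \<phi> (u @ v)) = sg_mult S x y"
        using \<phi> word_prod_append[OF S, of "map \<phi> u" "map \<phi> v"]
        by (auto simp: words_def image_subset_iff subset_iff)
      ultimately show ?case by (metis image_eqI words_append)
    qed
  qed
  have "word_prod S (map \<phi> w) \<in> sg_generate S (\<phi> ` A)" if "w \<noteq> []" "set w \<subseteq> A" for w
    using that by (induction w rule: list_nonempty_induct)
      (auto simp: word_prod_Cons intro: sg_generate.intros)
  then show "(\<lambda>w. word_prod S (map \<phi> w)) ` words A \<subseteq> sg_generate S (\<phi> ` A)"
    by (auto simp: words_def)
qed

lemma generate_restrict:
  assumes "B \<subseteq> H" shows "sg_generate (restrict_sgrp S H) B = sg_generate S B"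
proof -
  have "x \<in> sg_generate S B" if "x \<in> sg_generate (restrict_sgrp S H) B" for x
    using that by induction (auto simp: restrict_sgrp_def intro: sg_generate.intros)
  moreover have "x \<in> sg_generate (restrict_sgrp S H) B" if "x \<in> sg_generate S B" for x
    using that
  proof induction
    case (mult x y)
    then show ?case using sg_generate.mult[OF mult.IH] by (simp add: restrict_sgrp_def)
  qed (rule sg_generate.base)
  ultimately show ?thesis by auto
qed

lemma word_prod_restrict: "word_prod (restrict_sgrp S H) w = word_prod S w"
  by (induction S w rule: word_prod.induct) (auto simp: restrict_sgrp_def)

text \<open>Members of \<open>V\<close> live on natural numbers, whereas products are built on
  functions; this copies a finite semigroup back.\<close>

lemma transport_nat:
  fixes S :: "'b sgrp"
  assumes S: "is_semigroup S" "finite (carrier S)"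
  obtains T :: "nat sgrp" and g where "is_semigroup T" "finite (carrier T)" "g \<in> sg_iso S T"
proof -
  obtain g :: "'b \<Rightarrow> nat" where g: "bij_betw g (carrier S) {0..<card (carrier S)}"
    using ex_bij_betw_finite_nat[OF S(2)] by blast
  define r where "r = inv_into (carrier S) g"
  define T where "T = \<lparr>carrier = g ` carrier S, sg_mult = (\<lambda>x y. g (sg_mult S (r x) (r y)))\<rparr>"
  have r: "r (g x) = x" if "x \<in> carrier S" for x
    unfolding r_def using g that by (auto simp: bij_betw_def)
  have "is_semigroup T"
    unfolding is_semigroup_def T_def using is_semigroupD[OF S(1)] by (auto simp: r)
  moreover have "g \<in> sg_iso S T"
    unfolding sg_iso_def sg_hom_def T_def using g by (auto simp: r bij_betw_def)
  moreover have "finite (carrier T)" using S(2) by (simp add: T_def)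
  ultimately show ?thesis using that by blast
qed

lemma direct_prod_semigroup:
  assumes "\<And>i. i \<in> I \<Longrightarrow> is_semigroup (F i)"
  shows "is_semigroup (direct_prod I F)"
  unfolding is_semigroup_def direct_prod_def
  using is_semigroupD[OF assms] by (auto simp: PiE_eq_empty_iff PiE_iff)

locale pro_setting =
  fixes V :: "nat sgrp set" and A :: "'a set"
  assumes pv: "pseudovariety V" and lsl: "LSl \<subseteq> V" and finA: "finite A" and neA: "A \<noteq> {}"
begin

abbreviation "GM \<equiv> generated_members V A"

lemma V_semigroup: "S \<in> V \<Longrightarrow> is_semigroup S" and V_finite: "S \<in> V \<Longrightarrow> finite (carrier S)"
  and V_sub: "S \<in> V \<Longrightarrow> subsemigroup H S \<Longrightarrow> restrict_sgrp S H \<in> V"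
  using pv unfolding pseudovariety_def by blast+

lemma GM_D:
  assumes "i \<in> GM"
  shows "fst i \<in> V" "is_semigroup (fst i)" "finite (carrier (fst i))" "snd i \<in> A \<rightarrow>\<^sub>E carrier (fst i)"
    "sg_generate (fst i) (snd i ` A) = carrier (fst i)"
  using assms V_semigroup V_finite unfolding generated_members_def by auto

lemma GM_finite_sgrp: "i \<in> GM \<Longrightarrow> finite_sgrp (fst i)"
  by unfold_locales (simp_all add: GM_D)

lemma ev_closed [intro]: "i \<in> GM \<Longrightarrow> w \<in> words A \<Longrightarrow> ev i w \<in> carrier (fst i)"
  unfolding ev_def using GM_D[of i]
  by (intro word_prod_closed) (auto simp: words_def)

lemma ev_append:
  assumes "i \<in> GM" "u \<in> words A" "v \<in> words A"
  shows "ev i (u @ v) = sg_mult (fst i) (ev i u) (ev i v)"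
  unfolding ev_def map_append using GM_D[of i] assms
  by (intro word_prod_append) (auto simp: words_def)

lemma ev_surj:
  assumes "i \<in> GM" shows "carrier (fst i) = ev i ` words A"
proof -
  have "snd i ` A \<subseteq> carrier (fst i)" using GM_D(4)[OF assms] by auto
  then show ?thesis
    using sg_generate_words[OF GM_D(2)[OF assms], of "snd i" A] GM_D(5)[OF assms] 
    by (simp add: ev_def[abs_def])
qed

lemma ev_hom:
  assumes "j \<in> GM" "h \<in> gen_homs A i j" "w \<in> words A"
  shows "h (ev j w) = ev i w"
proof -
  have "h (ev j w) = word_prod (fst i) (map h (map (snd j) w))"
    unfolding ev_def using assms GM_D[OF assms(1)]
    by (intro word_prod_hom[of h "fst j"]) (auto simp: words_def gen_homs_def)
  also have "map h (map (snd j) w) = map (snd i) w"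
    using assms(2,3) by (auto simp: gen_homs_def words_def)
  finally show ?thesis by (simp add: ev_def)
qed

lemma ev_trans: "j \<in> GM \<Longrightarrow> gen_le A i j \<Longrightarrow> w \<in> words A \<Longrightarrow> gen_trans A i j (ev j w) = ev i w"
  unfolding gen_trans_def gen_le_def by (rule ev_hom) (auto simp: some_in_eq)

lemma gen_trans_hom: "gen_le A i j \<Longrightarrow> gen_trans A i j \<in> sg_hom (fst j) (fst i)"
  unfolding gen_trans_def gen_le_def
  using some_in_eq[of "gen_homs A i j"] by (auto simp: gen_homs_def)

text \<open>The preorder is inclusion of the kernels of the evaluation maps on words;
  \<open>h\<close> evaluates any word with the given value.\<close>

lemma gen_leI:
  assumes ij: "i \<in> GM" "j \<in> GM"
    and ker: "\<And>u v. u \<in> words A \<Longrightarrow> v \<in> words A \<Longrightarrow> ev j u = ev j v \<Longrightarrow> ev i u = ev i v"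
  shows "gen_le A i j"
proof -
  define h where "h x = ev i (SOME w. w \<in> words A \<and> ev j w = x)" for x
  have h: "h (ev j w) = ev i w" if "w \<in> words A" for w
    unfolding h_def by (rule someI2[of _ w]) (use that in \<open>auto intro: ker\<close>)
  have "h \<in> sg_hom (fst j) (fst i)"
    unfolding sg_hom_def ev_surj[OF ij(2)]
    using ij by (auto simp: h words_append simp flip: ev_append)
  moreover have "h (snd j a) = snd i a" if "a \<in> A" for a
    using h[of "[a]"] that by (simp add: words_def ev_def)
  ultimately show ?thesis unfolding gen_le_def gen_homs_def by auto
qed

lemma gen_le_refl: "i \<in> GM \<Longrightarrow> gen_le A i i"
  by (rule gen_leI)

lemma gen_le_trans: "i \<in> GM \<Longrightarrow> j \<in> GM \<Longrightarrow> k \<in> GM \<Longrightarrow> gen_le A i j \<Longrightarrow> gen_le A j k \<Longrightarrow> gen_le A i k"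
  by (rule gen_leI) (auto simp flip: ev_trans[of j i] ev_trans[of k j])

lemma gen_trans_comp:
  assumes "i \<in> GM" "j \<in> GM" "k \<in> GM" "gen_le A i j" "gen_le A j k" "x \<in> carrier (fst k)"
  shows "gen_trans A i j (gen_trans A j k x) = gen_trans A i k x"
proof -
  obtain w where "w \<in> words A" "x = ev k w" using assms ev_surj by auto
  then show ?thesis using assms by (simp add: ev_trans gen_le_trans[OF assms(1-5)])
qed

text \<open>The image of \<open>A\<close> need not generate \<open>T\<close>, but the subsemigroup
  that it generates is again in \<open>V\<close> and gives words the same values.\<close>

lemma member_of_map:
  assumes T: "T \<in> V" and \<phi>: "\<phi> ` A \<subseteq> carrier T"
  shows "\<exists>k\<in>GM. \<forall>w\<in>words A. ev k w = word_prod T (map \<phi> w)"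
proof -
  define H where "H = sg_generate T (\<phi> ` A)"
  have sT: "is_semigroup T" using V_semigroup[OF T] .
  have \<phi>H: "restrict \<phi> A ` A \<subseteq> H" "\<phi> ` A = restrict \<phi> A ` A"
    unfolding H_def by (auto intro!: sg_generate.base)
  have HT: "H \<subseteq> carrier T" unfolding H_def using sg_generate_closed[OF sT \<phi>] by auto
  have "H \<noteq> {}" using neA \<phi>H(1) by (meson image_is_empty subset_empty)
  moreover have "sg_mult T x y \<in> H" if "x \<in> H" "y \<in> H" for x y
    using that unfolding H_def by (rule sg_generate.mult)
  moreover have "sg_mult T (sg_mult T x y) z = sg_mult T x (sg_mult T y z)"
    if "x \<in> H" "y \<in> H" "z \<in> H" for x y z
    using that HT by (intro is_semigroupD[OF sT]) auto
  ultimately have "subsemigroup H T"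
    using HT by (simp add: subsemigroup_def is_semigroup_def restrict_sgrp_def)
  then have "restrict_sgrp T H \<in> V" by (rule V_sub[OF T])
  moreover have "sg_generate (restrict_sgrp T H) (restrict \<phi> A ` A) = H"
    using generate_restrict[OF \<phi>H(1), of T] unfolding \<phi>H(2)[symmetric] by (simp only: H_def)
  ultimately have "(restrict_sgrp T H, restrict \<phi> A) \<in> GM"
    unfolding generated_members_def using \<phi>H(1) by (auto simp: restrict_sgrp_def)
  moreover have "ev (restrict_sgrp T H, restrict \<phi> A) w = word_prod T (map \<phi> w)" if "w \<in> words A" for w
    unfolding ev_def using that
    by (auto simp: word_prod_restrict words_def intro!: arg_cong[of _ _ "word_prod T"])
  ultimately show ?thesis by blast
qed

text \<open>An upper bound is the subsemigroup of the product of the two members generated by the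
  pairs of corresponding generators.\<close>

lemma directed:
  assumes "i \<in> GM" "j \<in> GM"
  shows "\<exists>k\<in>GM. gen_le A i k \<and> gen_le A j k"
proof -
  define F where "F l = fst (if l = (0::nat) then i else j)" for l
  define \<phi> where "\<phi> a = (\<lambda>l\<in>{..<2::nat}. snd (if l = 0 then i else j) a)" for a
  have F: "F l \<in> V" "is_semigroup (F l)" "finite (carrier (F l))" for l
    using GM_D[OF assms(1)] GM_D[OF assms(2)] by (auto simp: F_def)
  have D: "is_semigroup (direct_prod {..<2} F)" "finite (carrier (direct_prod {..<2} F))"
    using direct_prod_semigroup[of "{..<2}" F] F by (auto simp: direct_prod_def intro!: finite_PiE)
  obtain T :: "nat sgrp" and g where T: "is_semigroup T" "g \<in> sg_iso (direct_prod {..<2} F) T"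
    using transport_nat[OF D] by metis
  have "T \<in> V" using pv T F(1) unfolding pseudovariety_def by blast
  have \<phi>: "\<phi> a \<in> carrier (direct_prod {..<2} F)" if "a \<in> A" for a
    using GM_D[OF assms(1)] GM_D[OF assms(2)] that by (auto simp: \<phi>_def direct_prod_def F_def)
  have gh: "g \<in> sg_hom (direct_prod {..<2} F) T" "inj_on g (carrier (direct_prod {..<2} F))"
    using T by (auto simp: sg_iso_def bij_betw_def)
  have "(g \<circ> \<phi>) ` A \<subseteq> carrier T" using \<phi> gh(1) by (auto simp: sg_hom_def Pi_iff)
  from member_of_map[OF \<open>T \<in> V\<close> this]
  obtain k where k: "k \<in> GM" "\<And>w. w \<in> words A \<Longrightarrow> ev k w = word_prod T (map (g \<circ> \<phi>) w)"
    by auto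
  define P where "P w = word_prod (direct_prod {..<2} F) (map \<phi> w)" for w
  have Pc: "P w \<in> carrier (direct_prod {..<2} F)" if "w \<in> words A" for w
    unfolding P_def using that \<phi> by (intro word_prod_closed D) (auto simp: words_def)
  have Pl: "P w l = ev (if l = 0 then i else j) w" if "w \<in> words A" "l < 2" for w l
  proof -
    have "(\<lambda>x. x l) \<in> sg_hom (direct_prod {..<2} F) (F l)"
      using that by (auto simp: sg_hom_def direct_prod_def)
    from word_prod_hom[OF this D(1), of "map \<phi> w"]
    have "P w l = word_prod (F l) (map ((\<lambda>x. x l) \<circ> \<phi>) w)"
      unfolding P_def using that \<phi> by (auto simp: words_def)
    also have "(\<lambda>x. x l) \<circ> \<phi> = snd (if l = 0 then i else j)"
      using that by (auto simp: \<phi>_def)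
    finally show ?thesis by (simp add: ev_def F_def)
  qed
  have evk: "ev k w = g (P w)" if "w \<in> words A" for w
  proof -
    have "set (map \<phi> w) \<subseteq> carrier (direct_prod {..<2} F)" "map \<phi> w \<noteq> []"
      using that \<phi> by (auto simp: words_def)
    from word_prod_hom[OF gh(1) D(1) this(2,1)] show ?thesis
      unfolding k(2)[OF that] P_def by simp
  qed
  have P_eq: "P u = P v" if "u \<in> words A" "v \<in> words A" "ev k u = ev k v" for u v
    using inj_onD[OF gh(2) _ Pc Pc] that evk by simp
  have "ev i u = ev i v" "ev j u = ev j v"
    if "u \<in> words A" "v \<in> words A" "ev k u = ev k v" for u v
    using Pl[OF that(1), of 0] Pl[OF that(2), of 0] Pl[OF that(1), of 1] Pl[OF that(2), of 1] P_eq[OF that]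
    by simp_all
  then have "gen_le A i k" "gen_le A j k"
    by (auto intro!: gen_leI assms k(1))
  with k(1) show ?thesis by blast
qed

lemma directed_finite:
  assumes "finite K" "K \<subseteq> GM" "K \<noteq> {}"
  shows "\<exists>k\<in>GM. \<forall>i\<in>K. gen_le A i k"
  using assms(1,3,2)
proof (induction K rule: finite_ne_induct)
  case (singleton x)
  then show ?case using gen_le_refl[of x] by (intro bexI[of _ x]) auto
next
  case (insert x F)
  then obtain k where k: "k \<in> GM" "\<forall>i\<in>F. gen_le A i k" by auto
  obtain l where l: "l \<in> GM" "gen_le A x l" "gen_le A k l"
    using directed[of x k] insert k by auto
  have "gen_le A i l" if "i \<in> F" for i
    using gen_le_trans[of i k l] insert k l that by auto
  then show ?case using l by auto
qed

text \<open>The only place where \<open>V\<close> contains \<open>LSl\<close> enters. The kernel of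
  \<open>\<theta>\<close> is a congruence of finite index; a word \<open>w\<close> with
  \<open>\<theta> (w @ w) = \<theta> w\<close> represents an idempotent, the words
  \<open>w @ u @ w\<close> represent its local monoid, and the last two hypotheses say that this
  monoid is a semilattice. So the quotient is in \<open>LSl\<close>.\<close>

lemma local_semilattice_quotient:
  fixes \<theta> :: "'a list \<Rightarrow> 'c"
  assumes fin: "finite (\<theta> ` words A)"
    and cong: "\<And>u u' v v'. \<lbrakk>u \<in> words A; u' \<in> words A; v \<in> words A; v' \<in> words A;
        \<theta> u = \<theta> u'; \<theta> v = \<theta> v'\<rbrakk> \<Longrightarrow> \<theta> (u @ v) = \<theta> (u' @ v')"
    and idem: "\<And>w u. \<lbrakk>w \<in> words A; u \<in> words A; \<theta> (w @ w) = \<theta> w\<rbrakk> \<Longrightarrow>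
        \<theta> ((w @ u @ w) @ w @ u @ w) = \<theta> (w @ u @ w)"
    and comm: "\<And>w u v. \<lbrakk>w \<in> words A; u \<in> words A; v \<in> words A; \<theta> (w @ w) = \<theta> w\<rbrakk> \<Longrightarrow>
        \<theta> ((w @ u @ w) @ w @ v @ w) = \<theta> ((w @ v @ w) @ w @ u @ w)"
  shows "\<exists>k\<in>GM. \<forall>u\<in>words A. \<forall>v\<in>words A. ev k u = ev k v \<longrightarrow> \<theta> u = \<theta> v"
proof -
  obtain g :: "'c \<Rightarrow> nat" where g: "inj_on g (\<theta> ` words A)"
    using ex_bij_betw_finite_nat[OF fin] by (metis bij_betw_imp_inj_on)
  define \<gamma> where "\<gamma> w = g (\<theta> w)" for w
  have \<gamma>_eq: "\<gamma> u = \<gamma> v \<longleftrightarrow> \<theta> u = \<theta> v" if "u \<in> words A" "v \<in> words A" for u v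
    unfolding \<gamma>_def using g that by (auto dest: inj_onD)
  define r where "r x = (SOME w. w \<in> words A \<and> \<gamma> w = x)" for x
  have r: "r (\<gamma> w) \<in> words A" "\<theta> (r (\<gamma> w)) = \<theta> w" if "w \<in> words A" for w
  proof -
    have "r (\<gamma> w) \<in> words A \<and> \<gamma> (r (\<gamma> w)) = \<gamma> w"
      unfolding r_def by (rule someI2[of _ w]) (use that in auto)
    then show "r (\<gamma> w) \<in> words A" "\<theta> (r (\<gamma> w)) = \<theta> w" using \<gamma>_eq that by auto
  qed
  define T where "T = \<lparr>carrier = \<gamma> ` words A, sg_mult = (\<lambda>x y. \<gamma> (r x @ r y))\<rparr>"
  have Tm: "sg_mult T (\<gamma> u) (\<gamma> v) = \<gamma> (u @ v)" if "u \<in> words A" "v \<in> words A" for u v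
    unfolding T_def using that r \<gamma>_eq by (auto intro!: cong simp: words_append)
  have Tc: "carrier T = \<gamma> ` words A" by (simp add: T_def)
  have "\<exists>a. a \<in> A" using neA by auto
  then have W: "words A \<noteq> {}" unfolding words_def by (auto intro: exI[of _ "[_]"])
  have sT: "is_semigroup T"
    unfolding is_semigroup_def Tc using W by (auto simp: Tm words_append)
  have "finite (carrier T)" using fin unfolding Tc \<gamma>_def by (metis finite_imageI image_image)
  have "T \<in> LSl"
    unfolding LSl_def mem_Collect_eq
  proof (intro conjI ballI impI sT \<open>finite (carrier T)\<close>)
    fix e assume "e \<in> carrier T" and ee: "sg_mult T e e = e"
    then obtain w where w: "w \<in> words A" "e = \<gamma> w" by (auto simp: Tc)
    have \<theta>w: "\<theta> (w @ w) = \<theta> w" using ee w Tm \<gamma>_eq by (metis words_append)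
    have E: "{sg_mult T (sg_mult T e s) e |s. s \<in> carrier T} = (\<lambda>u. \<gamma> (w @ u @ w)) ` words A"
      (is "?E = _")
    proof -
      have "sg_mult T (sg_mult T e (\<gamma> u)) e = \<gamma> (w @ u @ w)" if "u \<in> words A" for u
        using w that by (simp add: Tm words_append)
      then show ?thesis unfolding Tc by (force simp: image_iff)
    qed
    have "\<gamma> (w @ u @ w @ w @ v @ w) \<in> (\<lambda>u. \<gamma> (w @ u @ w)) ` words A"
      if "u \<in> words A" "v \<in> words A" for u v
      using that w(1) by (intro image_eqI[of _ _ "u @ w @ w @ v"]) (auto simp: words_append)
    then have "is_semigroup (restrict_sgrp T ?E)"
      unfolding is_semigroup_def restrict_sgrp_def E
      using W w(1) by (auto simp: Tm words_append)
    then show "is_semilattice (restrict_sgrp T ?E)"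
      unfolding is_semilattice_def restrict_sgrp_def E
      using w(1) by (auto simp: Tm words_append \<gamma>_eq idem[OF _ _ \<theta>w, simplified] comm[OF _ _ _ \<theta>w, simplified])
  qed
  then have TV: "T \<in> V" using lsl by auto
  have "(\<lambda>a. \<gamma> [a]) ` A \<subseteq> carrier T" by (auto simp: Tc words_def)
  from member_of_map[OF TV this] obtain k where k: "k \<in> GM"
    "\<And>w. w \<in> words A \<Longrightarrow> ev k w = word_prod T (map (\<lambda>a. \<gamma> [a]) w)" by blast
  have *: "word_prod T (map (\<lambda>a. \<gamma> [a]) w) = \<gamma> w" if "w \<noteq> []" "set w \<subseteq> A" for w
    using that
  proof (induction w rule: list_nonempty_induct)
    case (cons x xs)
    then show ?case using Tm[of "[x]" xs] by (simp add: word_prod_Cons words_def)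
  qed simp
  have "ev k w = \<gamma> w" if "w \<in> words A" for w
    using k(2)[OF that] * that by (simp add: words_def)
  then show ?thesis using \<gamma>_eq k(1) by (intro bexI[of _ k]) auto
qed

end

section \<open>Prefixes, suffixes and factors of bounded length are recognised by LSl\<close>

definition factors :: "nat \<Rightarrow> 'a list \<Rightarrow> 'a list set" where
  "factors N w = {f. length f \<le> N \<and> (\<exists>a b. w = a @ f @ b)}"

text \<open>A factor no longer than \<open>w\<close> cannot reach into both \<open>x\<close> and
  \<open>y\<close>.\<close>

lemma factors_cut:
  assumes "f \<in> factors N (x @ w @ y)" "N \<le> length w"
  shows "f \<in> factors N (x @ w) \<or> f \<in> factors N (w @ y)"
proof -
  obtain a b where ab: "x @ w @ y = a @ f @ b" and f: "length f \<le> N"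
    using assms by (auto simp: factors_def)
  show ?thesis
  proof (cases "length a + length f \<le> length x + length w")
    case True
    have "a @ f = take (length (a @ f)) (x @ w @ y)" using ab by simp
    also have "\<dots> = take (length (a @ f)) (x @ w)" using True by simp
    finally have "x @ w = (a @ f) @ drop (length (a @ f)) (x @ w)"
      by (metis append_take_drop_id)
    then have "\<exists>a b. x @ w = a @ f @ b" by (metis append.assoc)
    then show ?thesis using f by (simp add: factors_def)
  next
    case False
    then have l: "length x \<le> length a" using assms f by simp
    have "w @ y = drop (length x) (a @ f @ b)" by (simp flip: ab)
    then have "w @ y = drop (length x) a @ f @ b" using l by simp
    then have "\<exists>a b. w @ y = a @ f @ b" by blast
    then show ?thesis using f by (simp add: factors_def)
  qed
qed

lemma factors_mono: "factors N w \<subseteq> factors N (x @ w @ y)"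
proof
  fix f assume "f \<in> factors N w"
  then obtain a b where "length f \<le> N" "w = a @ f @ b" by (auto simp: factors_def)
  then have "length f \<le> N" "x @ w @ y = (x @ a) @ f @ (b @ y)" by auto
  then show "f \<in> factors N (x @ w @ y)" unfolding factors_def by blast
qed

text \<open>All lengths up to \<open>N\<close> are recorded, so that a word shorter than
  \<open>N\<close> is determined by its set of prefixes.\<close>

definition prefixes_upto :: "nat \<Rightarrow> 'a list \<Rightarrow> 'a list set" where
  "prefixes_upto N w = {t. length t \<le> N \<and> (\<exists>b. w = t @ b)}"

definition suffixes_upto :: "nat \<Rightarrow> 'a list \<Rightarrow> 'a list set" where
  "suffixes_upto N w = {s. length s \<le> N \<and> (\<exists>a. w = a @ s)}"

text \<open>The delicate prefixes are those that run through \<open>u\<close> into \<open>v\<close>.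
  Then \<open>u\<close> is shorter than \<open>N\<close>, and equal prefix sets force
  \<open>u' = u\<close>: a further letter of \<open>u'\<close> would show up in a recorded
  prefix.\<close>

lemma prefixes_upto_append:
  assumes "prefixes_upto N u = prefixes_upto N u'" "prefixes_upto N v = prefixes_upto N v'"
  shows "prefixes_upto N (u @ v) \<subseteq> prefixes_upto N (u' @ v')"
proof
  fix t assume "t \<in> prefixes_upto N (u @ v)"
  then obtain b where t: "length t \<le> N" "u @ v = t @ b" by (auto simp: prefixes_upto_def)
  then consider c where "u = t @ c" | c where "t = u @ c" "v = c @ b" "length u \<le> N"
    by (fastforce simp: append_eq_append_conv2)
  then show "t \<in> prefixes_upto N (u' @ v')"
  proof cases
    case 1
    then have "t \<in> prefixes_upto N u" using t by (auto simp: prefixes_upto_def)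
    then have "t \<in> prefixes_upto N u'" unfolding assms .
    then show ?thesis by (auto simp: prefixes_upto_def)
  next
    case 2
    show ?thesis
    proof (cases "c = []")
      case True
      then have "t \<in> prefixes_upto N u" using t 2 by (auto simp: prefixes_upto_def)
      then have "t \<in> prefixes_upto N u'" unfolding assms .
      then show ?thesis by (auto simp: prefixes_upto_def)
    next
      case False
      then have lu: "length u < N" using 2 t by (cases c) auto
      have "u \<in> prefixes_upto N u" using lu by (auto simp: prefixes_upto_def)
      then obtain d where d: "u' = u @ d" unfolding assms by (auto simp: prefixes_upto_def)
      have "d = []"
      proof (rule ccontr)
        assume "d \<noteq> []"
        then obtain x d' where "d = x # d'" by (cases d) auto
        then have "u @ [x] \<in> prefixes_upto N u'" using d lu by (auto simp: prefixes_upto_def)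
        then show False unfolding assms(1)[symmetric] by (auto simp: prefixes_upto_def)
      qed
      moreover have "c \<in> prefixes_upto N v'" 
        unfolding assms(2)[symmetric] using 2 t by (auto simp: prefixes_upto_def)
      ultimately show ?thesis using d 2 t by (auto simp: prefixes_upto_def)
    qed
  qed
qed

lemma suffixes_upto_rev: "suffixes_upto N w = rev ` prefixes_upto N (rev w)"
proof
  show "suffixes_upto N w \<subseteq> rev ` prefixes_upto N (rev w)"
    by (auto simp: suffixes_upto_def prefixes_upto_def intro!: image_eqI[of _ rev "rev _"])
  show "rev ` prefixes_upto N (rev w) \<subseteq> suffixes_upto N w"
    by (auto simp: suffixes_upto_def prefixes_upto_def rev_eq_append_conv)
qed

lemma suffixes_upto_append:
  assumes "suffixes_upto N u = suffixes_upto N u'" "suffixes_upto N v = suffixes_upto N v'"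
  shows "suffixes_upto N (u @ v) \<subseteq> suffixes_upto N (u' @ v')"
proof -
  have "prefixes_upto N (rev u) = prefixes_upto N (rev u')" 
    "prefixes_upto N (rev v) = prefixes_upto N (rev v')"
    using assms unfolding suffixes_upto_rev by (simp_all add: inj_image_eq_iff)
  then show ?thesis unfolding suffixes_upto_rev rev_append using prefixes_upto_append by blast
qed

text \<open>A factor across the cut is a suffix of \<open>u\<close> followed by a prefix of
  \<open>v\<close>; therefore the congruence below records suffixes and prefixes along with
  factors.\<close>

lemma factors_append:
  assumes "suffixes_upto N u = suffixes_upto N u'" "prefixes_upto N v = prefixes_upto N v'"
    "factors N u = factors N u'" "factors N v = factors N v'"
  shows "factors N (u @ v) \<subseteq> factors N (u' @ v')"
proof
  fix f assume "f \<in> factors N (u @ v)"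
  then obtain a b where f: "length f \<le> N" "u @ v = a @ f @ b" by (auto simp: factors_def)
  then consider c where "u = a @ f @ c" | c where "v = c @ f @ b"
    | s t where "u = a @ s" "f = s @ t" "v = t @ b"
    by (fastforce simp: append_eq_append_conv2)
  then show "f \<in> factors N (u' @ v')"
  proof cases
    case 1
    then have "f \<in> factors N u" using f by (auto simp: factors_def)
    then have "f \<in> factors N u'" unfolding assms .
    then show ?thesis using factors_mono[of N u' "[]" v'] by auto
  next
    case 2
    then have "f \<in> factors N v" using f by (auto simp: factors_def)
    then have "f \<in> factors N v'" unfolding assms .
    then show ?thesis using factors_mono[of N v' u' "[]"] by auto
  next
    case 3
    then have "s \<in> suffixes_upto N u" "t \<in> prefixes_upto N v"
      using f by (auto simp: suffixes_upto_def prefixes_upto_def)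
    then have "s \<in> suffixes_upto N u'" "t \<in> prefixes_upto N v'"
      unfolding assms by blast+
    then obtain a' b' where "u' = a' @ s" "v' = t @ b'"
      by (auto simp: suffixes_upto_def prefixes_upto_def)
    then show ?thesis using 3 f by (auto simp: factors_def)
  qed
qed

context pro_setting
begin

text \<open>The triple \<open>\<theta>\<close> defines a congruence whose idempotent classes contain
  only words \<open>w\<close> of length at least \<open>N\<close>. Then a product of
  \<open>w @ u @ w\<close> and \<open>w @ v @ w\<close> has the prefixes and suffixes of
  \<open>w\<close> and the union of the two factor sets; unions are idempotent and
  commutative.\<close>

lemma factors_recognised:
  "\<exists>k\<in>GM. \<forall>u\<in>words A. \<forall>v\<in>words A. ev k u = ev k v \<longrightarrow>
     factors N u = factors N v \<and> prefixes_upto N u = prefixes_upto N v"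
proof -
  define \<theta> where "\<theta> w = (suffixes_upto N w, factors N w, prefixes_upto N w)" for w :: "'a list"
  \<comment> \<open>A shorter \<open>w\<close> would have a square with a recorded prefix one letter
    longer than \<open>w\<close>.\<close>
  have long: "N \<le> length w" if "w \<in> words A" "\<theta> (w @ w) = \<theta> w" for w
  proof (rule ccontr)
    assume c: "\<not> N \<le> length w"
    have w0: "w \<noteq> []" using that(1) by (simp add: words_def)
    obtain x w' where w: "w = x # w'" using w0 by (cases w) (auto simp: words_def)
    have "w @ [x] \<in> prefixes_upto N (w @ w)" using w c by (auto simp: prefixes_upto_def)
    then have "w @ [x] \<in> prefixes_upto N w" using that by (simp add: \<theta>_def)
    then show False by (auto simp: prefixes_upto_def)
  qed
  have pre: "prefixes_upto N (w @ y) = prefixes_upto N w" if "N \<le> length w" for w y :: "'a list"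
  proof -
    have "us = []" if "length w + length us \<le> N" for us :: "'a list"
      using that \<open>N \<le> length w\<close> by (cases us) auto
    then show ?thesis by (auto simp: prefixes_upto_def append_eq_append_conv2)
  qed
  have suf: "suffixes_upto N (y @ w) = suffixes_upto N w" if "N \<le> length w" for w y :: "'a list"
    using pre[of "rev w" "rev y"] that by (simp add: suffixes_upto_rev)
  have fac: "factors N ((w @ u @ w) @ w @ v @ w) = factors N (w @ u @ w) \<union> factors N (w @ v @ w)"
    if "w \<in> words A" "\<theta> (w @ w) = \<theta> w" for w u v
  proof -
    have l: "N \<le> length w" and ww: "factors N (w @ w) = factors N w"
      using long that by (auto simp: \<theta>_def)
    have "f \<in> factors N (w @ u @ w) \<union> factors N (w @ v @ w)"
      if "f \<in> factors N ((w @ u @ w) @ w @ v @ w)" for f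
    proof -
      have "f \<in> factors N (w @ u @ w) \<or> f \<in> factors N (w @ w) \<or> f \<in> factors N (w @ v @ w)"
        using factors_cut[of f N "w @ u" w "w @ v @ w"] factors_cut[of f N w w "v @ w"] l that
        by auto
      then show ?thesis using ww factors_mono[of N w "[]" "u @ w"] by auto
    qed
    moreover have "factors N (w @ u @ w) \<subseteq> factors N ((w @ u @ w) @ w @ v @ w)"
      "factors N (w @ v @ w) \<subseteq> factors N ((w @ u @ w) @ w @ v @ w)"
      using factors_mono[of N "w @ u @ w" "[]" "w @ v @ w"]
        factors_mono[of N "w @ v @ w" "w @ u @ w" "[]"] by auto
    ultimately show ?thesis by blast
  qed
  have "\<exists>k\<in>GM. \<forall>u\<in>words A. \<forall>v\<in>words A. ev k u = ev k v \<longrightarrow> \<theta> u = \<theta> v"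
  proof (rule local_semilattice_quotient)
    define L where "L = {s. set s \<subseteq> A \<and> length s \<le> N}"
    have "finite L" unfolding L_def using finA by (rule finite_lists_length_le)
    moreover have "\<theta> ` words A \<subseteq> Pow L \<times> Pow L \<times> Pow L"
      by (auto simp: \<theta>_def L_def words_def suffixes_upto_def prefixes_upto_def factors_def)
    ultimately show "finite (\<theta> ` words A)" by (meson finite_Pow_iff finite_SigmaI finite_subset)
  next
    fix u u' v v' assume "\<theta> u = \<theta> u'" "\<theta> v = \<theta> v'"
    then show "\<theta> (u @ v) = \<theta> (u' @ v')"
      unfolding \<theta>_def
      using prefixes_upto_append[of N u u' v v'] prefixes_upto_append[of N u' u v' v]
        suffixes_upto_append[of N u u' v v'] suffixes_upto_append[of N u' u v' v]
        factors_append[of N u u' v v'] factors_append[of N u' u v' v]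
      by (simp add: subset_antisym)
  next
    fix w u assume w: "w \<in> words A" "\<theta> (w @ w) = \<theta> w"
    have l: "N \<le> length w" using long w by blast
    show "\<theta> ((w @ u @ w) @ w @ u @ w) = \<theta> (w @ u @ w)"
      unfolding \<theta>_def fac[OF w] using l pre[OF l] suf[OF l, of "w @ u @ w @ w @ u"] suf[OF l, of "w @ u"]
      by simp
    fix v
    show "\<theta> ((w @ u @ w) @ w @ v @ w) = \<theta> ((w @ v @ w) @ w @ u @ w)"
      unfolding \<theta>_def fac[OF w] using l pre[OF l] suf[OF l, of "w @ u @ w @ w @ v"]
        suf[OF l, of "w @ v @ w @ w @ u"]
      by auto
  qed
  then show ?thesis unfolding \<theta>_def prod.inject by blast
qed

end

section \<open>Compactness of the free pro-V semigroup\<close>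

text \<open>The families that are compatible below \<open>k\<close> form a closed subset
  \<open>C k\<close> of a compact product. Finitely many of these sets meet: push one element of an
  upper bound \<open>l\<close> of the indices down to everything below \<open>l\<close>.\<close>

lemma inverse_limit_nonempty:
  fixes D :: "'i \<Rightarrow> 'b set"
  assumes refl: "\<And>i. i \<in> I \<Longrightarrow> rel i i"
    and trans: "\<And>i j k. \<lbrakk>i \<in> I; j \<in> I; k \<in> I; rel i j; rel j k\<rbrakk> \<Longrightarrow> rel i k"
    and dir: "\<And>K. \<lbrakk>finite K; K \<subseteq> I; K \<noteq> {}\<rbrakk> \<Longrightarrow> \<exists>k\<in>I. \<forall>i\<in>K. rel i k"
    and fin: "\<And>i. i \<in> I \<Longrightarrow> finite (D i)" and ne: "\<And>i. i \<in> I \<Longrightarrow> D i \<noteq> {}"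
    and f: "\<And>i j x. \<lbrakk>i \<in> I; j \<in> I; rel i j; x \<in> D j\<rbrakk> \<Longrightarrow> f i j x \<in> D i"
    and comp: "\<And>i j k x. \<lbrakk>i \<in> I; j \<in> I; k \<in> I; rel i j; rel j k; x \<in> D k\<rbrakk> \<Longrightarrow> f i j (f j k x) = f i k x"
  shows "\<exists>x\<in>Pi\<^sub>E I D. \<forall>i\<in>I. \<forall>j\<in>I. rel i j \<longrightarrow> f i j (x j) = x i"
proof (cases "I = {}")
  case False
  define T where "T = product_topology (\<lambda>i. discrete_topology (D i)) I"
  define C where "C k = {x \<in> Pi\<^sub>E I D. \<forall>i\<in>I. rel i k \<longrightarrow> f i k (x k) = x i}" for k
  have ts: "topspace T = Pi\<^sub>E I D" by (simp add: T_def)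
  have "compact_space T"
    unfolding T_def compact_space_product_topology
    using fin by (auto simp: compact_space_def compactin_discrete_topology)
  have proj: "continuous_map T (discrete_topology (D i)) (\<lambda>x. x i)" if "i \<in> I" for i
    unfolding T_def using that by (rule continuous_map_product_projection)
  have closed: "closedin T (C k)" if k: "k \<in> I" for k
  proof -
    have "closedin T {x \<in> topspace T. f i k (x k) = x i}" if i: "i \<in> I" "rel i k" for i
    proof -
      have "continuous_map T (prod_topology (discrete_topology (D k)) (discrete_topology (D i)))
              (\<lambda>x. (x k, x i))"
        by (intro continuous_map_pairedI proj k i)
      moreover have "closedin (prod_topology (discrete_topology (D k)) (discrete_topology (D i)))
          {p \<in> D k \<times> D i. f i k (fst p) = snd p}"
        by (auto simp flip: prod_topology_discrete_topology)
      ultimately have "closedin T {x \<in> topspace T. (x k, x i) \<in> {p \<in> D k \<times> D i. f i k (fst p) = snd p}}"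
        by (rule closedin_continuous_map_preimage)
      also have "{x \<in> topspace T. (x k, x i) \<in> {p \<in> D k \<times> D i. f i k (fst p) = snd p}}
          = {x \<in> topspace T. f i k (x k) = x i}"
        using i k by (auto simp: ts PiE_iff)
      finally show ?thesis .
    qed
    then have "closedin T (topspace T \<inter> (\<Inter>i\<in>{i\<in>I. rel i k}. {x \<in> topspace T. f i k (x k) = x i}))"
      using refl[OF k] k by (intro closedin_Int closedin_topspace closedin_INT) auto
    also have "topspace T \<inter> (\<Inter>i\<in>{i\<in>I. rel i k}. {x \<in> topspace T. f i k (x k) = x i}) = C k"
      by (auto simp: C_def ts)
    finally show ?thesis .
  qed
  have "\<Inter>\<F> \<noteq> {}" if \<F>: "finite \<F>" "\<F> \<subseteq> C ` I" for \<F>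
  proof (cases "\<F> = {}")
    case False
    obtain K where K: "K \<subseteq> I" "finite K" "\<F> = C ` K"
      using finite_subset_image[OF \<F>] by blast
    obtain l where l: "l \<in> I" "\<And>i. i \<in> K \<Longrightarrow> rel i l" using dir[of K] K False by auto
    obtain d where d: "d \<in> D l" using ne[OF l(1)] by auto
    \<comment> \<open>Coordinates in \<open>I\<close> that are not below \<open>l\<close> are
      unconstrained and get an arbitrary element.\<close>
    define x where "x i = (if i \<in> I then if rel i l then f i l d else SOME y. y \<in> D i else undefined)" for i
    have "x i \<in> D i" if "i \<in> I" for i
      using that f[OF that l(1) _ d] ne[OF that] by (simp add: x_def some_in_eq)
    then have xP: "x \<in> Pi\<^sub>E I D" by (auto simp: x_def PiE_iff extensional_def)
    have "x \<in> C k" if "k \<in> K" for k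
    proof -
      have k: "k \<in> I" "rel k l" using that K l by auto
      have "f i k (x k) = x i" if "i \<in> I" "rel i k" for i
      proof -
        have "rel i l" using trans[OF that(1) k(1) l(1) that(2) k(2)] .
        then show ?thesis using comp[OF that(1) k(1) l(1) that(2) k(2) d] that k by (simp add: x_def)
      qed
      then show ?thesis using xP by (auto simp: C_def)
    qed
    then show ?thesis using K by blast
  qed simp
  moreover have "\<forall>C'\<in>C ` I. closedin T C'" using closed by auto
  ultimately have "\<Inter> (C ` I) \<noteq> {}"
    using \<open>compact_space T\<close>[unfolded compact_space_fip, rule_format, of "C ` I"] by simp
  then obtain x where x: "\<And>k. k \<in> I \<Longrightarrow> x \<in> C k" by blast
  have "x \<in> Pi\<^sub>E I D" using False x unfolding C_def by blast
  moreover have "f i j (x j) = x i" if "i \<in> I" "j \<in> I" "rel i j" for i j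
    using x[OF that(2)] that by (simp add: C_def)
  ultimately show ?thesis by blast
qed simp

context pro_setting
begin

abbreviation "F \<equiv> free_pro V A"
abbreviation "\<T> \<equiv> free_pro_top V A"

lemma F_iff: "x \<in> carrier F \<longleftrightarrow> x \<in> (\<Pi>\<^sub>E i\<in>GM. carrier (fst i)) \<and>
    (\<forall>i\<in>GM. \<forall>j\<in>GM. gen_le A i j \<longrightarrow> gen_trans A i j (x j) = x i)"
  by (simp add: free_pro_def inverse_limit_def restrict_sgrp_def direct_prod_def)

lemma F_mult: "sg_mult F x y = (\<lambda>i\<in>GM. sg_mult (fst i) (x i) (y i))"
  by (simp add: free_pro_def inverse_limit_def restrict_sgrp_def direct_prod_def)

lemma F_mult_at [simp]: "i \<in> GM \<Longrightarrow> sg_mult F x y i = sg_mult (fst i) (x i) (y i)"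
  by (simp add: F_mult)

lemma F_at [intro]: "x \<in> carrier F \<Longrightarrow> i \<in> GM \<Longrightarrow> x i \<in> carrier (fst i)"
  by (auto simp: F_iff PiE_iff)

lemma F_trans: "x \<in> carrier F \<Longrightarrow> i \<in> GM \<Longrightarrow> j \<in> GM \<Longrightarrow> gen_le A i j \<Longrightarrow> gen_trans A i j (x j) = x i"
  by (simp add: F_iff)

lemma F_eqI:
  assumes "x \<in> carrier F" "y \<in> carrier F" "\<And>i. i \<in> GM \<Longrightarrow> x i = y i"
  shows "x = y"
proof -
  have "x \<in> extensional GM" "y \<in> extensional GM" using assms by (auto simp: F_iff PiE_iff)
  then show ?thesis using assms(3) by (rule extensionalityI)
qed

lemma F_word: "x \<in> carrier F \<Longrightarrow> i \<in> GM \<Longrightarrow> \<exists>w\<in>words A. x i = ev i w"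
  using F_at ev_surj by blast

lemma F_lift:
  assumes "x \<in> carrier F" "i \<in> GM" "j \<in> GM" "gen_le A i j" "w \<in> words A" "x j = ev j w"
  shows "x i = ev i w"
  using F_trans[OF assms(1-4)] ev_trans[OF assms(3-5)] assms(6) by simp

lemma F_mult_closed [intro]:
  assumes x: "x \<in> carrier F" and y: "y \<in> carrier F"
  shows "sg_mult F x y \<in> carrier F"
proof -
  have "gen_trans A i j (sg_mult F x y j) = sg_mult F x y i" if "i \<in> GM" "j \<in> GM" "gen_le A i j" for i j
    using gen_trans_hom[OF that(3)] F_trans[OF x that] F_trans[OF y that] F_at[OF x that(2)] F_at[OF y that(2)] that
    by (simp add: sg_hom_def)
  moreover have "sg_mult F x y \<in> (\<Pi>\<^sub>E i\<in>GM. carrier (fst i))"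
    using is_semigroupD(2)[OF GM_D(2)] F_at x y unfolding F_mult by auto
  ultimately show ?thesis unfolding F_iff by blast
qed

lemma F_assoc:
  assumes "x \<in> carrier F" "y \<in> carrier F" "z \<in> carrier F"
  shows "sg_mult F (sg_mult F x y) z = sg_mult F x (sg_mult F y z)"
proof (rule F_eqI)
  fix i assume i: "i \<in> GM"
  show "sg_mult F (sg_mult F x y) z i = sg_mult F x (sg_mult F y z) i"
    using is_semigroupD(3)[OF GM_D(2)[OF i] F_at[OF assms(1) i] F_at[OF assms(2) i] F_at[OF assms(3) i]] i
    by simp
qed (use assms in auto)

lemma embed_at: "i \<in> GM \<Longrightarrow> word_embed V A w i = ev i w"
  by (auto simp: word_embed_def ev_def split_beta)

lemma embed_F [intro]:
  assumes w: "w \<in> words A" shows "word_embed V A w \<in> carrier F"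
proof -
  have "gen_trans A i j (word_embed V A w j) = word_embed V A w i" if "i \<in> GM" "j \<in> GM" "gen_le A i j" for i j
    using ev_trans[OF that(2,3) w] that by (simp add: embed_at)
  moreover have "word_embed V A w \<in> extensional GM" by (simp add: word_embed_def)
  ultimately show ?thesis
    unfolding F_iff PiE_iff using w ev_closed by (auto simp: embed_at)
qed

text \<open>For tuples rather than single elements, because the generators, and likewise the two
  factors in an ideal relation, have to be chosen jointly.\<close>

lemma compact_choice:
  assumes K: "finite K"
    and D: "\<And>i. i \<in> GM \<Longrightarrow> D i \<subseteq> (\<Pi>\<^sub>E k\<in>K. carrier (fst i))" "\<And>i. i \<in> GM \<Longrightarrow> D i \<noteq> {}"
    and tr: "\<And>i j t. \<lbrakk>i \<in> GM; j \<in> GM; gen_le A i j; t \<in> D j\<rbrakk> \<Longrightarrow> (\<lambda>k\<in>K. gen_trans A i j (t k)) \<in> D i"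
  shows "\<exists>x. (\<forall>k\<in>K. x k \<in> carrier F) \<and> (\<forall>i\<in>GM. (\<lambda>k\<in>K. x k i) \<in> D i)"
proof -
  define f where "f i j t = (\<lambda>k\<in>K. gen_trans A i j (t k))" for i j and t :: "'b \<Rightarrow> nat"
  have "\<exists>x\<in>Pi\<^sub>E GM D. \<forall>i\<in>GM. \<forall>j\<in>GM. gen_le A i j \<longrightarrow> f i j (x j) = x i"
  proof (rule inverse_limit_nonempty)
    show "gen_le A i i" if "i \<in> GM" for i using that by (rule gen_le_refl)
    show "gen_le A i k" if "i \<in> GM" "j \<in> GM" "k \<in> GM" "gen_le A i j" "gen_le A j k" for i j k
      using that by (rule gen_le_trans)
    show "\<exists>k\<in>GM. \<forall>i\<in>K. gen_le A i k" if "finite K" "K \<subseteq> GM" "K \<noteq> {}" for K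
      using that by (rule directed_finite)
    show "finite (D i)" if "i \<in> GM" for i
      using finite_PiE[OF K, of "\<lambda>_. carrier (fst i)"] GM_D(3)[OF that] D(1)[OF that]
      by (simp add: finite_subset)
    show "D i \<noteq> {}" if "i \<in> GM" for i using D(2) that .
    show "f i j x \<in> D i" if "i \<in> GM" "j \<in> GM" "gen_le A i j" "x \<in> D j" for i j x
      unfolding f_def using that by (rule tr)
    show "f i j (f j k x) = f i k x"
      if "i \<in> GM" "j \<in> GM" "k \<in> GM" "gen_le A i j" "gen_le A j k" "x \<in> D k" for i j k x
    proof -
      have "x l \<in> carrier (fst k)" if "l \<in> K" for l
        using D(1)[OF \<open>k \<in> GM\<close>] \<open>x \<in> D k\<close> that by auto
      then show ?thesis
        using gen_trans_comp[OF that(1-5)] by (auto simp: f_def)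
    qed
  qed
  then obtain z where z: "\<And>i. i \<in> GM \<Longrightarrow> z i \<in> D i"
    "\<And>i j. \<lbrakk>i \<in> GM; j \<in> GM; gen_le A i j\<rbrakk> \<Longrightarrow> f i j (z j) = z i"
    by blast
  define x where "x k = (\<lambda>i\<in>GM. z i k)" for k
  have zP: "z i \<in> (\<Pi>\<^sub>E k\<in>K. carrier (fst i))" if "i \<in> GM" for i using z(1) D(1) that by blast
  have "x k \<in> carrier F" if "k \<in> K" for k
    unfolding F_iff
  proof (intro conjI ballI impI)
    show "x k \<in> (\<Pi>\<^sub>E i\<in>GM. carrier (fst i))" using zP that by (auto simp: x_def)
    show "gen_trans A i j (x k j) = x k i" if ij: "i \<in> GM" "j \<in> GM" "gen_le A i j" for i j
      using fun_cong[OF z(2)[OF ij], of k] ij \<open>k \<in> K\<close> by (simp add: x_def f_def)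
  qed
  moreover have "(\<lambda>k\<in>K. x k i) = z i" if "i \<in> GM" for i
  proof
    show "(\<lambda>k\<in>K. x k i) k = z i k" for k
      using PiE_arb[OF zP[OF that], of k] that by (auto simp: x_def)
  qed
  ultimately show ?thesis using z(1) by (intro exI[of _ x]) auto
qed

lemma compact_choice1:
  assumes D: "\<And>i. i \<in> GM \<Longrightarrow> D i \<subseteq> carrier (fst i)" "\<And>i. i \<in> GM \<Longrightarrow> D i \<noteq> {}"
    and tr: "\<And>i j t. \<lbrakk>i \<in> GM; j \<in> GM; gen_le A i j; t \<in> D j\<rbrakk> \<Longrightarrow> gen_trans A i j t \<in> D i"
  shows "\<exists>x\<in>carrier F. \<forall>i\<in>GM. x i \<in> D i"
proof -
  have "\<exists>x. (\<forall>k\<in>{()}. x k \<in> carrier F) \<and> (\<forall>i\<in>GM. (\<lambda>k\<in>{()}. x k i) \<in> {t. t () \<in> D i})"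
  proof (rule compact_choice)
    show "{t. t () \<in> D i} \<subseteq> (\<Pi>\<^sub>E k\<in>{()}. carrier (fst i))" if "i \<in> GM" for i
      using D(1)[OF that] by (auto simp: PiE_iff extensional_def)
    show "{t. t () \<in> D i} \<noteq> {}" if "i \<in> GM" for i
    proof -
      obtain d where "d \<in> D i" using D(2)[OF \<open>i \<in> GM\<close>] by blast
      then have "(\<lambda>_. d) \<in> {t. t () \<in> D i}" by simp
      then show ?thesis by (metis empty_iff)
    qed
    show "(\<lambda>k\<in>{()}. gen_trans A i j (t k)) \<in> {t. t () \<in> D i}"
      if "i \<in> GM" "j \<in> GM" "gen_le A i j" "t \<in> {t. t () \<in> D j}" for i j t
      using tr[OF that(1-3)] that(4) by simp
  qed simp
  then obtain x where "x () \<in> carrier F" "\<And>i. i \<in> GM \<Longrightarrow> (\<lambda>k\<in>{()}. x k i) \<in> {t. t () \<in> D i}"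
    by (metis insertI1)
  then show ?thesis by (intro bexI[of _ "x ()"]) simp_all
qed

lemma GM_nonempty: "GM \<noteq> {}"
  using factors_recognised by blast

lemma topspace_F [simp]: "topspace \<T> = carrier F"
  by (auto simp: free_pro_top_def inverse_limit_top_def F_iff simp flip: free_pro_def)

lemma open_coordinate: 
  assumes "k \<in> GM" shows "openin \<T> {y \<in> carrier F. y k \<in> S}"
proof -
  define P where "P = product_topology (\<lambda>i. discrete_topology (carrier (fst i))) GM"
  have "continuous_map P (discrete_topology (carrier (fst k))) (\<lambda>x. x k)"
    unfolding P_def using assms by (rule continuous_map_product_projection)
  then have "openin P {x \<in> topspace P. x k \<in> S \<inter> carrier (fst k)}"
    by (rule openin_continuous_map_preimage) simp
  then have "openin \<T> ({x \<in> topspace P. x k \<in> S \<inter> carrier (fst k)} \<inter> carrier F)"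
    unfolding free_pro_top_def inverse_limit_top_def free_pro_def[symmetric]
    by (auto simp: openin_subtopology P_def)
  also have "{x \<in> topspace P. x k \<in> S \<inter> carrier (fst k)} \<inter> carrier F = {y \<in> carrier F. y k \<in> S}"
    using assms by (auto simp: P_def F_iff PiE_iff)
  finally show ?thesis .
qed

text \<open>A basic open set restricts finitely many coordinates, and all of them are determined by
  the coordinate at a common upper bound.\<close>

lemma open_neighbourhood:
  assumes U: "openin \<T> U" and h: "h \<in> U"
  shows "\<exists>k\<in>GM. \<forall>y\<in>carrier F. y k = h k \<longrightarrow> y \<in> U"
proof -
  define P where "P = product_topology (\<lambda>i. discrete_topology (carrier (fst i))) GM"
  obtain W where W: "openin P W" "U = W \<inter> carrier F"
    using U unfolding free_pro_top_def inverse_limit_top_def free_pro_def[symmetric]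
    by (auto simp: openin_subtopology P_def)
  have hF: "h \<in> carrier F" using h W by auto
  obtain B where B: "finite {i \<in> GM. B i \<noteq> carrier (fst i)}" "h \<in> Pi\<^sub>E GM B" "Pi\<^sub>E GM B \<subseteq> W"
    using W h unfolding P_def openin_product_topology_alt by force
  define K where "K = {i \<in> GM. B i \<noteq> carrier (fst i)}"
  \<comment> \<open>Keeps the set of indices nonempty when the basic open set restricts no
    coordinate.\<close>
  obtain k0 where k0: "k0 \<in> GM" using GM_nonempty by auto
  have "finite (insert k0 K)" "insert k0 K \<subseteq> GM" "insert k0 K \<noteq> {}"
    using B(1) k0 by (auto simp: K_def)
  from directed_finite[OF this] obtain k where k: "k \<in> GM" "\<And>i. i \<in> insert k0 K \<Longrightarrow> gen_le A i k"
    by blast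
  have "y \<in> U" if y: "y \<in> carrier F" "y k = h k" for y
  proof -
    have "y i \<in> B i" if i: "i \<in> GM" for i
    proof (cases "i \<in> K")
      case True
      then have "gen_le A i k" using k by auto
      then have "y i = h i" using F_trans[OF y(1) i k(1)] F_trans[OF hF i k(1)] y(2) by simp
      then show ?thesis using B(2) i by auto
    next
      case False
      then show ?thesis using F_at[OF y(1) i] i by (simp add: K_def)
    qed
    then have "y \<in> Pi\<^sub>E GM B" using y(1) by (auto simp: F_iff PiE_iff)
    then show ?thesis using B(3) W(2) y(1) by auto
  qed
  then show ?thesis using k(1) by blast
qed

text \<open>By \<open>open_neighbourhood\<close>, approximation in one coordinate at a time suffices
  for the closure; this is how density of the generated subsemigroup is checked in the end.\<close>

lemma closure_sub:
  assumes H: "H \<subseteq> carrier F" and Y: "Y \<subseteq> H"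
  shows "subtopology \<T> H closure_of Y = {x \<in> H. \<forall>i\<in>GM. \<exists>y\<in>Y. y i = x i}"
proof
  have H': "topspace (subtopology \<T> H) = H" using H by auto
  show "subtopology \<T> H closure_of Y \<subseteq> {x \<in> H. \<forall>i\<in>GM. \<exists>y\<in>Y. y i = x i}"
  proof clarify
    fix x assume x: "x \<in> subtopology \<T> H closure_of Y"
    then have xH: "x \<in> H" using H' by (metis closure_of_subset_topspace subsetD)
    have "\<exists>y\<in>Y. y i = x i" if i: "i \<in> GM" for i
    proof -
      have "openin (subtopology \<T> H) ({y \<in> carrier F. y i \<in> {x i}} \<inter> H)"
        using open_coordinate[OF i] by (auto simp: openin_subtopology)
      moreover have "x \<in> {y \<in> carrier F. y i \<in> {x i}} \<inter> H" using xH H by auto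
      ultimately obtain y where "y \<in> Y" "y \<in> {y \<in> carrier F. y i \<in> {x i}} \<inter> H"
        using x[unfolded in_closure_of] by meson
      then show ?thesis by (intro bexI[of _ y]) simp_all
    qed
    then show "x \<in> H \<and> (\<forall>i\<in>GM. \<exists>y\<in>Y. y i = x i)" using xH by blast
  qed
  show "{x \<in> H. \<forall>i\<in>GM. \<exists>y\<in>Y. y i = x i} \<subseteq> subtopology \<T> H closure_of Y"
  proof clarify
    fix x assume x: "x \<in> H" "\<forall>i\<in>GM. \<exists>y\<in>Y. y i = x i"
    show "x \<in> subtopology \<T> H closure_of Y"
      unfolding in_closure_of
    proof (intro conjI allI impI)
      show "x \<in> topspace (subtopology \<T> H)" using x H by auto
      fix U assume U: "x \<in> U \<and> openin (subtopology \<T> H) U"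
      then obtain W where W: "openin \<T> W" "U = W \<inter> H" by (auto simp: openin_subtopology)
      have "x \<in> W" using U W(2) by simp
      from open_neighbourhood[OF W(1) this]
      obtain k where k: "k \<in> GM" "\<And>y. y \<in> carrier F \<Longrightarrow> y k = x k \<Longrightarrow> y \<in> W"
        by blast
      then obtain y where y: "y \<in> Y" "y k = x k" using x(2) by meson
      then have "y \<in> H" "y \<in> carrier F" using Y H by blast+
      then have "y \<in> U" using k(2)[of y] y W(2) by simp
      then show "\<exists>y. y \<in> Y \<and> y \<in> U" using y(1) by blast
    qed
  qed
qed

lemma closure_F:
  assumes "Y \<subseteq> carrier F"
  shows "\<T> closure_of Y = {x \<in> carrier F. \<forall>i\<in>GM. \<exists>y\<in>Y. y i = x i}"
  using closure_sub[OF order_refl assms] subtopology_topspace[of \<T>] by simp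

end

section \<open>Shift spaces and return words\<close>

definition seg :: "(int \<Rightarrow> 'a) \<Rightarrow> int \<Rightarrow> nat \<Rightarrow> 'a list" where
  "seg x i l = map (\<lambda>k. x (i + int k)) [0..<l]"

definition sh :: "int \<Rightarrow> (int \<Rightarrow> 'a) \<Rightarrow> int \<Rightarrow> 'a" where
  "sh k x = (\<lambda>i. x (i + k))"

definition agree :: "nat \<Rightarrow> (int \<Rightarrow> 'a) \<Rightarrow> (int \<Rightarrow> 'a) \<Rightarrow> bool" where
  "agree r x y \<longleftrightarrow> (\<forall>i. \<bar>i\<bar> \<le> int r \<longrightarrow> x i = y i)"

definition returns :: "(int \<Rightarrow> 'a) set \<Rightarrow> 'a list set" where
  "returns B = {seg x 0 l | x l. x \<in> B \<and> 0 < l \<and> sh (int l) x \<in> B \<and>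
     (\<forall>k. 0 < k \<and> k < l \<longrightarrow> sh (int k) x \<notin> B)}"

lemma sh_0 [simp]: "sh 0 x = x"
  and sh_sh [simp]: "sh j (sh k x) = sh (j + k) x"
  and shift_sh: "shift x = sh 1 x"
  by (simp_all add: sh_def shift_def add.assoc)

lemma length_seg [simp]: "length (seg x i l) = l"
  by (simp add: seg_def)

lemma seg_nth: "k < l \<Longrightarrow> seg x i l ! k = x (i + int k)"
  by (simp add: seg_def)

lemma seg_sh: "seg (sh j x) i l = seg x (i + j) l"
  by (simp add: seg_def sh_def algebra_simps)

lemma seg_add: "seg x i (l + m) = seg x i l @ seg x (i + int l) m"
  by (rule nth_equalityI) (auto simp: seg_nth nth_append)

lemma seg_eq_iff: "seg x i l = seg y j l \<longleftrightarrow> (\<forall>k<l. x (i + int k) = y (j + int k))"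
  by (auto simp: list_eq_iff_nth_eq seg_nth)

lemma agree_sym: "agree r x y \<Longrightarrow> agree r y x"
  and agree_trans: "agree r x y \<Longrightarrow> agree r y z \<Longrightarrow> agree r x z"
  and agree_mono: "agree r x y \<Longrightarrow> q \<le> r \<Longrightarrow> agree q x y"
  by (auto simp: agree_def)

lemma agree_seg:
  assumes "agree r x y" "- int r \<le> i" "i + int l \<le> int r + 1"
  shows "seg x i l = seg y i l"
  using assms by (auto simp: seg_eq_iff agree_def)

lemma seg_agree:
  assumes "seg x (- int r) (2 * r + 1) = seg y (- int r) (2 * r + 1)"
  shows "agree r x y"
  unfolding agree_def
proof (intro allI impI)
  fix i :: int assume i: "\<bar>i\<bar> \<le> int r"
  have "nat (i + int r) < 2 * r + 1" using i by linarith
  then have "x (- int r + int (nat (i + int r))) = y (- int r + int (nat (i + int r)))"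
    using assms unfolding seg_eq_iff by blast
  moreover have "int (nat (i + int r)) = i + int r" using i by linarith
  ultimately show "x i = y i" by simp
qed

text \<open>The index type is left open since both bi-infinite words and infinite paths are
  treated.\<close>

lemma openin_cylinder:
  "openin (product_topology (\<lambda>i. discrete_topology (D i)) UNIV) S \<longleftrightarrow>
     S \<subseteq> Pi\<^sub>E UNIV D \<and>
     (\<forall>x\<in>S. \<exists>J. finite J \<and> (\<forall>y\<in>Pi\<^sub>E UNIV D. (\<forall>i\<in>J. y i = x i) \<longrightarrow> y \<in> S))" (is "?L \<longleftrightarrow> ?R")
proof
  assume L: ?L
  have "S \<subseteq> Pi\<^sub>E UNIV D" using openin_subset[OF L] by simp
  moreover have "\<exists>J. finite J \<and> (\<forall>y\<in>Pi\<^sub>E UNIV D. (\<forall>i\<in>J. y i = x i) \<longrightarrow> y \<in> S)" if x: "x \<in> S" for x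
  proof -
    obtain U where U: "finite {i. U i \<noteq> D i}" "x \<in> Pi\<^sub>E UNIV U" "Pi\<^sub>E UNIV U \<subseteq> S"
      using L x unfolding openin_product_topology_alt by force
    have "y \<in> S" if y: "y \<in> Pi\<^sub>E UNIV D" "\<forall>i\<in>{i. U i \<noteq> D i}. y i = x i" for y
    proof -
      have "y i \<in> U i" for i
        using y U(2) by (cases "U i = D i") (auto simp: PiE_iff)
      then show ?thesis using U(3) by auto
    qed
    then show ?thesis using U(1) by (intro exI[of _ "{i. U i \<noteq> D i}"]) simp
  qed
  ultimately show ?R by simp
next
  assume R: ?R
  show ?L
    unfolding openin_product_topology_alt
  proof
    fix x assume x: "x \<in> S"
    then obtain J where J: "finite J" "\<And>y. y \<in> Pi\<^sub>E UNIV D \<Longrightarrow> (\<forall>i\<in>J. y i = x i) \<Longrightarrow> y \<in> S"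
      using R by meson
    have xD: "x i \<in> D i" for i using R x by (auto simp: PiE_iff)
    define U where "U i = (if i \<in> J then {x i} else D i)" for i
    have "Pi\<^sub>E UNIV U \<subseteq> S"
    proof
      fix y assume y: "y \<in> Pi\<^sub>E UNIV U"
      then have "y i \<in> D i" "i \<in> J \<Longrightarrow> y i = x i" for i
        using xD[of i] PiE_mem[OF y, of i] by (auto simp: U_def split: if_splits)
      then show "y \<in> S" by (intro J(2)) auto
    qed
    moreover have "finite {i. U i \<noteq> D i}"
      by (rule finite_subset[OF _ J(1)]) (auto simp: U_def)
    moreover have "x \<in> Pi\<^sub>E UNIV U" "\<forall>i. U i \<subseteq> D i" using xD by (auto simp: U_def)
    ultimately show "\<exists>U. finite {i \<in> UNIV. U i \<noteq> topspace (discrete_topology (D i))} \<and>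
        (\<forall>i\<in>UNIV. openin (discrete_topology (D i)) (U i)) \<and> x \<in> Pi\<^sub>E UNIV U \<and> Pi\<^sub>E UNIV U \<subseteq> S"
      by (intro exI[of _ U]) simp
  qed
qed

text \<open>A finite subcover by cylinders leaves finitely many local bounds, and monotonicity
  allows passing to their maximum.\<close>

lemma compact_uniform:
  fixes Q :: "nat \<Rightarrow> ('i \<Rightarrow> 'b) \<Rightarrow> bool"
  assumes Z: "compactin (product_topology (\<lambda>i. discrete_topology (D i)) UNIV) Z"
    and mono: "\<And>m m' y. Q m y \<Longrightarrow> m \<le> m' \<Longrightarrow> Q m' y"
    and loc: "\<And>x. x \<in> Z \<Longrightarrow> \<exists>J m. finite J \<and> (\<forall>y\<in>Z. (\<forall>i\<in>J. y i = x i) \<longrightarrow> Q m y)"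
  shows "\<exists>m. \<forall>y\<in>Z. Q m y"
proof -
  let ?P = "product_topology (\<lambda>i. discrete_topology (D i)) UNIV"
  define R where "R x p \<longleftrightarrow> finite (fst p) \<and> (\<forall>y\<in>Z. (\<forall>i\<in>fst p. y i = x i) \<longrightarrow> Q (snd p) y)" for x p
  have "\<exists>p. R x p" if x: "x \<in> Z" for x
  proof -
    obtain J m where "finite J" "\<forall>y\<in>Z. (\<forall>i\<in>J. y i = x i) \<longrightarrow> Q m y" using loc[OF x] by meson
    then show ?thesis by (intro exI[of _ "(J, m)"]) (simp add: R_def)
  qed
  then have "\<forall>x\<in>Z. \<exists>p. R x p" ..
  then obtain p where p: "\<forall>x\<in>Z. R x (p x)" unfolding bchoice_iff ..
  define J M where "J x = fst (p x)" and "M x = snd (p x)" for x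
  have JM: "finite (J x)" "y \<in> Z \<Longrightarrow> (\<forall>i\<in>J x. y i = x i) \<Longrightarrow> Q (M x) y" if "x \<in> Z" for x y
    using p that by (simp_all add: J_def M_def R_def)
  define U where "U x = {y \<in> Pi\<^sub>E UNIV D. \<forall>i\<in>J x. y i = x i}" for x
  have ZD: "Z \<subseteq> Pi\<^sub>E UNIV D" using compactin_subset_topspace[OF Z] by simp
  have op: "openin ?P (U x)" if "x \<in> Z" for x
    unfolding openin_cylinder
  proof (intro conjI ballI)
    fix z assume "z \<in> U x"
    then show "\<exists>J. finite J \<and> (\<forall>y\<in>Pi\<^sub>E UNIV D. (\<forall>i\<in>J. y i = z i) \<longrightarrow> y \<in> U x)"
      using JM(1)[OF \<open>x \<in> Z\<close>] by (intro exI[of _ "J x"]) (simp add: U_def)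
  qed (auto simp: U_def)
  have cov: "Z \<subseteq> \<Union>(U ` Z)" using ZD by (auto simp: U_def)
  have "\<exists>\<F>. finite \<F> \<and> \<F> \<subseteq> U ` Z \<and> Z \<subseteq> \<Union>\<F>"
    by (rule compactinD[OF Z _ cov]) (use op in auto)
  then obtain \<F> where \<F>: "finite \<F>" "\<F> \<subseteq> U ` Z" "Z \<subseteq> \<Union>\<F>" by (elim exE conjE)
  then obtain Y where Y: "Y \<subseteq> Z" "finite Y" "\<F> = U ` Y"
    by (meson finite_subset_image)
  have "Q (Max (insert 0 (M ` Y))) y" if y: "y \<in> Z" for y
  proof -
    obtain x where x: "x \<in> Y" "y \<in> U x" using y \<F>(3) Y(3) by auto
    have "Q (M x) y" using x y Y(1) by (intro JM(2)) (auto simp: U_def)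
    moreover have "M x \<le> Max (insert 0 (M ` Y))" using x Y(2) by (intro Max_ge) auto
    ultimately show ?thesis by (rule mono)
  qed
  then show ?thesis by blast
qed

lemma continuous_coordinate:
  assumes f: "continuous_map (subtopology (product_topology (\<lambda>i. discrete_topology (D i)) UNIV) Z)
      (subtopology (product_topology (\<lambda>i. discrete_topology (E i)) UNIV) W) f"
    and Z: "Z \<subseteq> Pi\<^sub>E UNIV D" and x: "x \<in> Z"
  shows "\<exists>J. finite J \<and> (\<forall>y\<in>Z. (\<forall>i\<in>J. y i = x i) \<longrightarrow> f y j = f x j)"
proof -
  let ?P = "product_topology (\<lambda>i. discrete_topology (D i)) UNIV"
  have f': "continuous_map (subtopology ?P Z) (product_topology (\<lambda>i. discrete_topology (E i)) UNIV) f"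
    using f by (simp add: continuous_map_in_subtopology)
  have fj: "continuous_map (subtopology ?P Z) (discrete_topology (E j)) (\<lambda>y. f y j)"
    using continuous_map_componentwise_UNIV[THEN iffD1, OF f'] by blast
  have tZ: "topspace (subtopology ?P Z) = Z" using Z by auto
  have fE: "f x j \<in> E j" using continuous_map_image_subset_topspace[OF fj] x tZ by auto
  have "openin (subtopology ?P Z) {y \<in> topspace (subtopology ?P Z). f y j \<in> {f x j}}"
    using fE by (intro openin_continuous_map_preimage[OF fj]) simp
  then obtain S where S: "openin ?P S" "{y \<in> Z. f y j = f x j} = S \<inter> Z"
    unfolding tZ by (auto simp: openin_subtopology)
  have "x \<in> S" using S(2) x by blast
  then obtain J where J: "finite J" "\<And>y. y \<in> Pi\<^sub>E UNIV D \<Longrightarrow> (\<forall>i\<in>J. y i = x i) \<Longrightarrow> y \<in> S"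
    using S(1) unfolding openin_cylinder by meson
  have "f y j = f x j" if "y \<in> Z" "\<forall>i\<in>J. y i = x i" for y
    using J(2)[of y] that Z S(2) by blast
  then show ?thesis using J(1) by blast
qed

lemma continuous_coordinates:
  assumes f: "continuous_map (subtopology (product_topology (\<lambda>i. discrete_topology (D i)) UNIV) Z)
      (subtopology (product_topology (\<lambda>i. discrete_topology (E i)) UNIV) W) f"
    and Z: "Z \<subseteq> Pi\<^sub>E UNIV D" and x: "x \<in> Z" and K: "finite K"
  shows "\<exists>J. finite J \<and> (\<forall>y\<in>Z. (\<forall>i\<in>J. y i = x i) \<longrightarrow> (\<forall>j\<in>K. f y j = f x j))"
  using K
proof (induction K)
  case (insert k K)
  obtain J where J: "finite J" "\<forall>y\<in>Z. (\<forall>i\<in>J. y i = x i) \<longrightarrow> (\<forall>j\<in>K. f y j = f x j)"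
    using insert.IH by blast
  obtain J' where J': "finite J'" "\<forall>y\<in>Z. (\<forall>i\<in>J'. y i = x i) \<longrightarrow> f y k = f x k"
    using continuous_coordinate[OF f Z x, of k] by blast
  show ?case using J J' by (intro exI[of _ "J \<union> J'"]) simp
qed auto

lemma shift_space_sh:
  assumes "shift_space A X" "x \<in> X" shows "sh k x \<in> X"
proof -
  have S: "shift ` X = X" using assms(1) by (simp add: shift_space_def)
  have up: "sh (int m) y \<in> X" if "y \<in> X" for y m
  proof (induction m)
    case (Suc m)
    have "shift (sh (int m) y) \<in> X" using Suc S by blast
    then show ?case by (simp add: shift_sh add.commute)
  qed (use that in simp)
  have down: "sh (- int m) y \<in> X" if "y \<in> X" for y m
  proof (induction m)
    case (Suc m)
    then obtain z where z: "z \<in> X" "sh (- int m) y = shift z" using S by blast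
    have "z = sh (-1) (shift z)" by (simp add: shift_sh)
    also have "\<dots> = sh (- int (Suc m)) y" by (simp flip: z(2))
    finally show ?case using z(1) by simp
  qed (use that in simp)
  show ?thesis
    using up[OF assms(2), of "nat k"] down[OF assms(2), of "nat (- k)"] by (cases "k \<ge> 0") auto
qed

lemma shift_space_letters:
  assumes "shift_space A X" "x \<in> X" shows "x i \<in> A"
proof -
  have "X \<subseteq> topspace (full_shift_top A)"
    using assms(1) by (auto simp: shift_space_def dest: closedin_subset)
  then show ?thesis using assms(2) by (auto simp: full_shift_top_def)
qed

lemma shift_space_compact:
  assumes "finite A" "shift_space A X" shows "compactin (full_shift_top A) X"
proof -
  have "compact_space (full_shift_top A)"
    using assms(1) unfolding full_shift_top_def compact_space_product_topology
    by (auto simp: compact_space_def compactin_discrete_topology)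
  then show ?thesis using assms(2) by (intro closedin_compact_space) (auto simp: shift_space_def)
qed

text \<open>The points of \<open>X\<close> that avoid the given word form a closed shift-invariant
  set that misses \<open>y\<close>; by minimality it is empty. Compactness then bounds the position
  of an occurrence.\<close>

lemma uniform_recurrence:
  assumes fin: "finite A" and min: "minimal_shift_space A X" and y: "y \<in> X"
  shows "\<exists>M. \<forall>x\<in>X. \<exists>k\<le>M. seg x (int k) l = seg y 0 l"
proof -
  have X: "shift_space A X" using min by (simp add: minimal_shift_space_def)
  define Y where "Y = {x \<in> X. \<forall>k. seg x k l \<noteq> seg y 0 l}"
  have "Y = {}"
  proof (rule ccontr)
    assume ne: "Y \<noteq> {}"
    define O' where "O' = {x \<in> Pi\<^sub>E UNIV (\<lambda>_. A). \<exists>k. seg x k l = seg y 0 l}"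
    have "openin (full_shift_top A) O'"
      unfolding full_shift_top_def openin_cylinder
    proof (intro conjI ballI)
      fix x assume "x \<in> O'"
      then obtain k where k: "seg x k l = seg y 0 l" by (auto simp: O'_def)
      show "\<exists>J. finite J \<and> (\<forall>z\<in>UNIV \<rightarrow>\<^sub>E A. (\<forall>i\<in>J. z i = x i) \<longrightarrow> z \<in> O')"
      proof (intro exI[of _ "{k..k + int l}"] conjI ballI impI)
        fix z assume z: "z \<in> UNIV \<rightarrow>\<^sub>E A" "\<forall>i\<in>{k..k + int l}. z i = x i"
        then have "seg z k l = seg x k l" by (simp add: seg_eq_iff)
        then show "z \<in> O'" unfolding O'_def using k z(1) by auto
      qed simp
    qed (auto simp: O'_def)
    moreover have "closedin (full_shift_top A) X" using X by (simp add: shift_space_def)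
    ultimately have "closedin (full_shift_top A) (X - O')" by (rule closedin_diff[rotated])
    also have "X - O' = Y"
      using shift_space_letters[OF X] by (auto simp: Y_def O'_def)
    finally have "closedin (full_shift_top A) Y" .
    moreover have Ysh: "sh j x \<in> Y" if "x \<in> Y" for x j
      using that shift_space_sh[OF X] by (auto simp: Y_def seg_sh)
    have "shift ` Y = Y"
    proof
      show "shift ` Y \<subseteq> Y" using Ysh by (auto simp: shift_sh)
      show "Y \<subseteq> shift ` Y"
      proof
        fix x assume "x \<in> Y"
        then have "sh (-1) x \<in> Y" by (rule Ysh)
        moreover have "x = shift (sh (-1) x)" by (simp add: shift_sh)
        ultimately show "x \<in> shift ` Y" by blast
      qed
    qed
    ultimately have "shift_space A Y" using ne by (simp add: shift_space_def)
    moreover have "Y \<subseteq> X" by (auto simp: Y_def)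
    ultimately have "Y = X" using min by (simp add: minimal_shift_space_def)
    then show False using y by (auto simp: Y_def)
  qed
  have "\<exists>M. \<forall>x\<in>X. \<exists>k. \<bar>k\<bar> \<le> int M \<and> seg x k l = seg y 0 l"
  proof (rule compact_uniform)
    show "compactin (product_topology (\<lambda>i. discrete_topology A) UNIV) X"
      using shift_space_compact[OF fin X] by (simp add: full_shift_top_def)
    show "\<exists>k. \<bar>k\<bar> \<le> int m' \<and> seg x k l = seg y 0 l"
      if "\<exists>k. \<bar>k\<bar> \<le> int m \<and> seg x k l = seg y 0 l" "m \<le> m'" for m m' x
      using that by force
    show "\<exists>J m. finite J \<and> (\<forall>z\<in>X. (\<forall>i\<in>J. z i = x i) \<longrightarrow> (\<exists>k. \<bar>k\<bar> \<le> int m \<and> seg z k l = seg y 0 l))"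
      if x: "x \<in> X" for x
    proof -
      have "x \<notin> Y" using \<open>Y = {}\<close> by simp
      then obtain k where k: "seg x k l = seg y 0 l" using x by (auto simp: Y_def)
      show ?thesis
      proof (intro exI[of _ "{k..k + int l}"] exI[of _ "nat \<bar>k\<bar>"] conjI ballI impI exI[of _ k])
        fix z assume z: "z \<in> X" "\<forall>i\<in>{k..k + int l}. z i = x i"
        then have "seg z k l = seg x k l" by (simp add: seg_eq_iff)
        then show "seg z k l = seg y 0 l" using k by simp
      qed auto
    qed
  qed
  then obtain M where M: "\<And>x. x \<in> X \<Longrightarrow> \<exists>k. \<bar>k\<bar> \<le> int M \<and> seg x k l = seg y 0 l" by blast
  have "\<exists>k\<le>2 * M. seg x (int k) l = seg y 0 l" if "x \<in> X" for x
  proof -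
    \<comment> \<open>Looking at \<open>x\<close> shifted by \<open>M\<close> turns the two-sided
      bound into a position between \<open>0\<close> and \<open>2 * M\<close>.\<close>
    obtain k where k: "\<bar>k\<bar> \<le> int M" "seg (sh (int M) x) k l = seg y 0 l"
      using M[OF shift_space_sh[OF X \<open>x \<in> X\<close>]] by blast
    then show ?thesis by (intro exI[of _ "nat (k + int M)"]) (auto simp: seg_sh)
  qed
  then show ?thesis by blast
qed

section \<open>Return words from an ordered Bratteli diagram\<close>

text \<open>The order axioms are assumed on \<open>S\<close> alone, because \<open>bd_ord\<close> is
  an order only among edges with a common range.\<close>

lemma finite_linear_least:
  assumes "finite S" "S \<noteq> {}" "\<And>x. x \<in> S \<Longrightarrow> (x, x) \<in> r"
    and "\<And>x y. x \<in> S \<Longrightarrow> y \<in> S \<Longrightarrow> x \<noteq> y \<Longrightarrow> (x, y) \<in> r \<or> (y, x) \<in> r"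
    and "\<And>x y z. x \<in> S \<Longrightarrow> y \<in> S \<Longrightarrow> z \<in> S \<Longrightarrow> (x, y) \<in> r \<Longrightarrow> (y, z) \<in> r \<Longrightarrow> (x, z) \<in> r"
  shows "\<exists>m\<in>S. \<forall>y\<in>S. (m, y) \<in> r"
  using assms
proof (induction S rule: finite_ne_induct)
  case (singleton x)
  from singleton.prems(1)[of x] show ?case by simp
next
  case (insert x T)
  have "\<exists>m\<in>T. \<forall>y\<in>T. (m, y) \<in> r"
  proof (rule insert.IH)
    show "(a, c) \<in> r" if "a \<in> T" "b \<in> T" "c \<in> T" "(a, b) \<in> r" "(b, c) \<in> r" for a b c
      using insert.prems(3)[of a b c] that by simp
  qed (use insert.prems(1,2) in simp_all)
  then obtain m where m: "m \<in> T" "\<And>y. y \<in> T \<Longrightarrow> (m, y) \<in> r" by blast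
  have "x \<noteq> m" using m(1) insert.hyps by auto
  then consider "(m, x) \<in> r" | "(x, m) \<in> r" using insert.prems(2)[of m x] m(1) by auto
  then show ?case
  proof cases
    case 1
    then show ?thesis using m by (intro bexI[of _ m]) auto
  next
    case 2
    have "(x, y) \<in> r" if "y \<in> T" for y
      using insert.prems(3)[of x m y] m 2 that by simp
    then show ?thesis using insert.prems(1)[of x] by (intro bexI[of _ x]) auto
  qed
qed

definition min_edge :: "bratteli \<Rightarrow> nat \<Rightarrow> nat \<Rightarrow> bool" where
  "min_edge B i e \<longleftrightarrow> (\<forall>e' \<in> edges_into B i (bd_rng B i e). (e, e') \<in> bd_ord B i)"

definition max_edge :: "bratteli \<Rightarrow> nat \<Rightarrow> nat \<Rightarrow> bool" where
  "max_edge B i e \<longleftrightarrow> (\<forall>e' \<in> edges_into B i (bd_rng B i e). (e', e) \<in> bd_ord B i)"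

definition next_edge :: "bratteli \<Rightarrow> nat \<Rightarrow> nat \<Rightarrow> nat \<Rightarrow> bool" where
  "next_edge B i e e' \<longleftrightarrow> e' \<in> edges_into B i (bd_rng B i e) \<and> (e, e') \<in> bd_ord B i \<and> e \<noteq> e' \<and>
     (\<forall>e'' \<in> edges_into B i (bd_rng B i e). (e, e'') \<in> bd_ord B i \<and> e'' \<noteq> e \<longrightarrow> (e', e'') \<in> bd_ord B i)"

locale bratteli_diagram =
  fixes B :: bratteli
  assumes proper: "properly_ordered B"
begin

lemma obd: "ordered_bratteli_diagram B"
  using proper by (simp add: properly_ordered_def)

lemma finE: "finite (bd_E B i)"
  and finV: "finite (bd_V B i)"
  and src: "e \<in> bd_E B i \<Longrightarrow> bd_src B i e \<in> bd_V B i"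
  and rng: "e \<in> bd_E B i \<Longrightarrow> bd_rng B i e \<in> bd_V B (Suc i)"
  and into_ne: "v \<in> bd_V B (Suc i) \<Longrightarrow> edges_into B i v \<noteq> {}"
  and lin: "v \<in> bd_V B (Suc i) \<Longrightarrow>
      linear_order_on (edges_into B i v) (Restr (bd_ord B i) (edges_into B i v))"
  using obd unfolding ordered_bratteli_diagram_def by metis+

lemma into_iff: "e \<in> edges_into B i v \<longleftrightarrow> e \<in> bd_E B i \<and> bd_rng B i e = v"
  by (simp add: edges_into_def)

context
  fixes i v assumes v: "v \<in> bd_V B (Suc i)"
begin

lemma ord_refl: "e \<in> edges_into B i v \<Longrightarrow> (e, e) \<in> bd_ord B i"
  using lin[OF v] by (auto simp: linear_order_on_def partial_order_on_def preorder_on_def refl_on_def)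

lemma ord_antisym:
  "\<lbrakk>e \<in> edges_into B i v; e' \<in> edges_into B i v; (e, e') \<in> bd_ord B i; (e', e) \<in> bd_ord B i\<rbrakk> \<Longrightarrow> e = e'"
  using lin[OF v] by (auto simp: linear_order_on_def partial_order_on_def antisym_def)

lemma ord_trans:
  assumes "e \<in> edges_into B i v" "e' \<in> edges_into B i v" "e'' \<in> edges_into B i v"
    "(e, e') \<in> bd_ord B i" "(e', e'') \<in> bd_ord B i"
  shows "(e, e'') \<in> bd_ord B i"
proof -
  have "trans (Restr (bd_ord B i) (edges_into B i v))"
    using lin[OF v] by (simp add: linear_order_on_def partial_order_on_def preorder_on_def)
  from transD[OF this, of e e' e''] show ?thesis using assms by auto
qed

lemma ord_total:
  "\<lbrakk>e \<in> edges_into B i v; e' \<in> edges_into B i v; e \<noteq> e'\<rbrakk> \<Longrightarrow> (e, e') \<in> bd_ord B i \<or> (e', e) \<in> bd_ord B i"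
  using lin[OF v] by (auto simp: linear_order_on_def total_on_def)

lemma least_edge:
  assumes "S \<subseteq> edges_into B i v" "S \<noteq> {}"
  shows "\<exists>m\<in>S. \<forall>y\<in>S. (m, y) \<in> bd_ord B i"
proof (rule finite_linear_least)
  show "finite S" using finE[of i] by (rule rev_finite_subset) (use assms(1) in \<open>auto simp: into_iff\<close>)
  show "(x, x) \<in> bd_ord B i" if "x \<in> S" for x using that assms(1) ord_refl by blast
  show "(x, y) \<in> bd_ord B i \<or> (y, x) \<in> bd_ord B i" if "x \<in> S" "y \<in> S" "x \<noteq> y" for x y
    using that assms(1) ord_total by blast
  show "(x, z) \<in> bd_ord B i"
    if "x \<in> S" "y \<in> S" "z \<in> S" "(x, y) \<in> bd_ord B i" "(y, z) \<in> bd_ord B i" for x y z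
    using that(4,5) ord_trans[of x y z] subsetD[OF assms(1)] that(1-3) by blast
qed (rule assms(2))

end

lemma min_edge_unique:
  assumes "min_edge B i e" "min_edge B i e'" "e \<in> bd_E B i" "e' \<in> bd_E B i" "bd_rng B i e = bd_rng B i e'"
  shows "e = e'"
  using assms by (intro ord_antisym[OF rng[OF assms(3)]]) (auto simp: min_edge_def into_iff)

lemma next_edge_exists:
  assumes e: "e \<in> bd_E B i" and nm: "\<not> max_edge B i e"
  shows "\<exists>e'. next_edge B i e e'"
proof -
  define S where "S = {e'' \<in> edges_into B i (bd_rng B i e). (e, e'') \<in> bd_ord B i \<and> e'' \<noteq> e}"
  obtain e1 where e1: "e1 \<in> edges_into B i (bd_rng B i e)" "(e1, e) \<notin> bd_ord B i"
    using nm by (auto simp: max_edge_def)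
  have ee: "e \<in> edges_into B i (bd_rng B i e)" using e by (simp add: into_iff)
  have "e1 \<noteq> e" using ord_refl[OF rng[OF e] ee] e1 by auto
  then have "e1 \<in> S" using ord_total[OF rng[OF e] ee e1(1)] e1 by (auto simp: S_def)
  then have "S \<noteq> {}" by auto
  then obtain m where "m \<in> S" "\<And>y. y \<in> S \<Longrightarrow> (m, y) \<in> bd_ord B i"
    using least_edge[OF rng[OF e], of S] by (auto simp: S_def)
  then show ?thesis by (intro exI[of _ m]) (auto simp: next_edge_def S_def)
qed

lemma next_edge_unique:
  assumes "e \<in> bd_E B i" "next_edge B i e a" "next_edge B i e b"
  shows "a = b"
  using assms(2,3) by (intro ord_antisym[OF rng[OF assms(1)]]) (auto simp: next_edge_def)

lemma min_edge_exists:
  assumes "v \<in> bd_V B (Suc i)" shows "\<exists>e\<in>edges_into B i v. min_edge B i e"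
  using least_edge[OF assms order_refl into_ne[OF assms]] by (auto simp: min_edge_def into_iff)

text \<open>Built backwards from \<open>v\<close>: take the minimal edge into \<open>v\<close> and
  continue at its source.\<close>

lemma min_head_exists:
  "v \<in> bd_V B k \<Longrightarrow> \<exists>q. (\<forall>j<k. q j \<in> bd_E B j \<and> min_edge B j (q j)) \<and>
     (\<forall>j. Suc j < k \<longrightarrow> bd_rng B j (q j) = bd_src B (Suc j) (q (Suc j))) \<and>
     (0 < k \<longrightarrow> bd_rng B (k - 1) (q (k - 1)) = v)"
proof (induction k arbitrary: v)
  case (Suc k)
  obtain e where e: "e \<in> bd_E B k" "bd_rng B k e = v" "min_edge B k e"
    using min_edge_exists[OF Suc.prems] by (auto simp: into_iff)
  from Suc.IH[OF src[OF e(1)]] obtain q where q: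
    "(\<forall>j<k. q j \<in> bd_E B j \<and> min_edge B j (q j)) \<and>
     (\<forall>j. Suc j < k \<longrightarrow> bd_rng B j (q j) = bd_src B (Suc j) (q (Suc j))) \<and>
     (0 < k \<longrightarrow> bd_rng B (k - 1) (q (k - 1)) = bd_src B k e)" ..
  show ?case
  proof (intro exI[of _ "q(k := e)"] conjI allI impI)
    show "bd_rng B j ((q(k := e)) j) = bd_src B (Suc j) ((q(k := e)) (Suc j))" if "Suc j < Suc k" for j
      using q that by (cases "Suc j = k") auto
    show "(q(k := e)) j \<in> bd_E B j" "min_edge B j ((q(k := e)) j)" if "j < Suc k" for j
      using q e that by (cases "j = k"; simp)+
    show "bd_rng B (Suc k - 1) ((q(k := e)) (Suc k - 1)) = v" using e(2) by simp
  qed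
qed simp

lemma pathD:
  assumes "p \<in> bd_paths B"
  shows "p i \<in> bd_E B i" "bd_rng B i (p i) = bd_src B (Suc i) (p (Suc i))"
  using assms by (auto simp: bd_paths_def)

text \<open>Going back from level \<open>k\<close>, each minimal edge is forced by its range. This
  is why vertices can count return words.\<close>

lemma min_head_unique:
  assumes "p \<in> bd_paths B" "q \<in> bd_paths B" "p k = q k"
    "\<And>j. j < k \<Longrightarrow> min_edge B j (p j)" "\<And>j. j < k \<Longrightarrow> min_edge B j (q j)" "j \<le> k"
  shows "p j = q j"
  using assms(6)
proof (induction j rule: inc_induct)
  case base then show ?case by (rule assms(3))
next
  case (step j)
  show ?case
  proof (rule min_edge_unique)
    show "min_edge B j (p j)" "min_edge B j (q j)" using step.hyps assms(4,5)[of j] by simp_all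
    show "p j \<in> bd_E B j" "q j \<in> bd_E B j" using pathD(1) assms(1,2) by simp_all
    show "bd_rng B j (p j) = bd_rng B j (q j)"
      using pathD(2)[OF assms(1), of j] pathD(2)[OF assms(2), of j] step.IH by simp
  qed
qed

text \<open>
  The successor of a path increments its first non-maximal edge and replaces the edges
  before it by the minimal path to the new source.
\<close>

lemma successor:
  assumes p: "p \<in> bd_paths B" and k: "\<And>j. j < k \<Longrightarrow> max_edge B j (p j)" "\<not> max_edge B k (p k)"
  shows "\<exists>q. path_succ B p q \<and> next_edge B k (p k) (q k) \<and> (\<forall>j<k. min_edge B j (q j)) \<and> (\<forall>j>k. q j = p j)"
proof -
  obtain e where e: "next_edge B k (p k) e" using next_edge_exists[OF pathD(1)[OF p] k(2)] by blast
  then have eE: "e \<in> bd_E B k" "bd_rng B k e = bd_rng B k (p k)" by (auto simp: next_edge_def into_iff)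
  from min_head_exists[OF src[OF eE(1)]] obtain h where h':
    "(\<forall>j<k. h j \<in> bd_E B j \<and> min_edge B j (h j)) \<and>
     (\<forall>j. Suc j < k \<longrightarrow> bd_rng B j (h j) = bd_src B (Suc j) (h (Suc j))) \<and>
     (0 < k \<longrightarrow> bd_rng B (k - 1) (h (k - 1)) = bd_src B k e)" ..
  then have h: "\<And>j. j < k \<Longrightarrow> h j \<in> bd_E B j \<and> min_edge B j (h j)"
    "\<And>j. Suc j < k \<Longrightarrow> bd_rng B j (h j) = bd_src B (Suc j) (h (Suc j))"
    "0 < k \<Longrightarrow> bd_rng B (k - 1) (h (k - 1)) = bd_src B k e"
    by simp_all
  define q where "q j = (if j < k then h j else if j = k then e else p j)" for j
  have q: "q k = e" "\<And>j. j > k \<Longrightarrow> q j = p j" "\<And>j. j < k \<Longrightarrow> min_edge B j (q j)"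
    using h(1) by (auto simp: q_def)
  have qp: "q \<in> bd_paths B"
  proof -
    have "q j \<in> bd_E B j" for j using h(1) eE(1) pathD(1)[OF p] by (simp add: q_def)
    moreover have "bd_rng B j (q j) = bd_src B (Suc j) (q (Suc j))" for j
    proof -
      consider "Suc j < k" | "Suc j = k" | "j = k" | "j > k" by linarith
      then show ?thesis
        using h(2)[of j] h(3) eE(2) pathD(2)[OF p, of j] by cases (auto simp: q_def)
    qed
    ultimately show ?thesis by (simp add: bd_paths_def)
  qed
  have rngk: "p k \<in> edges_into B k (bd_rng B k (p k))" "e \<in> edges_into B k (bd_rng B k (p k))"
    using pathD(1)[OF p] eE by (auto simp: into_iff)
  have less: "path_less B p q"
    unfolding path_less_def using p qp e q by (intro conjI exI[of _ k]) (auto simp: next_edge_def)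
  \<comment> \<open>Let \<open>a\<close> and \<open>b\<close> be the last places where
    \<open>r\<close> differs from \<open>p\<close> and from \<open>q\<close>. Beyond
    \<open>k\<close> the paths \<open>p\<close> and \<open>q\<close> agree, so \<open>b > k\<close>
    forces \<open>a = b\<close> with contradictory comparisons; \<open>b < k\<close> contradicts
    minimality of \<open>q b\<close>, and for \<open>b = k\<close> either \<open>p a\<close> is
    maximal or \<open>r k\<close> lies between \<open>p k\<close> and the next edge.\<close>
  have "False" if pr: "path_less B p r" and rq: "path_less B r q" for r
  proof -
    have r: "r \<in> bd_paths B" using pr by (simp add: path_less_def)
    obtain a where a: "p a \<noteq> r a" "(p a, r a) \<in> bd_ord B a" "\<And>j. j > a \<Longrightarrow> p j = r j"
      using pr by (auto simp: path_less_def)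
    obtain b where b: "r b \<noteq> q b" "(r b, q b) \<in> bd_ord B b" "\<And>j. j > b \<Longrightarrow> r j = q j"
      using rq by (auto simp: path_less_def)
    have pa: "p a \<in> edges_into B a (bd_rng B a (p a))" "r a \<in> edges_into B a (bd_rng B a (p a))"
      using pathD[OF p, of a] pathD[OF r, of a] a(3)[of "Suc a"] by (auto simp: into_iff)
    have rb: "r b \<in> edges_into B b (bd_rng B b (q b))" "q b \<in> edges_into B b (bd_rng B b (q b))"
      using pathD[OF qp, of b] pathD[OF r, of b] b(3)[of "Suc b"] by (auto simp: into_iff)
    consider "b > k" | "b < k" | "b = k" by linarith
    then show False
    proof cases
      case 1
      have "p b \<noteq> r b" using b(1) q(2)[OF 1] by simp
      then have "b \<le> a" using a(3)[of b] by (cases "b \<le> a") auto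
      moreover have "a \<le> b" using a(1) b(3)[of a] q(2)[of a] 1 by (cases "a \<le> b") auto
      ultimately have "a = b" by simp
      then show False
        using ord_antisym[OF rng[OF pathD(1)[OF qp]] rb(1) rb(2) b(2)] a(2) b(1) q(2)[OF 1] by simp
    next
      case 2
      have "(q b, r b) \<in> bd_ord B b" using q(3)[OF 2] rb(1) by (auto simp: min_edge_def)
      then show False using ord_antisym[OF rng[OF pathD(1)[OF qp]] rb(1) rb(2) b(2)] b(1) by simp
    next
      case 3
      consider "a > k" | "a < k" | "a = k" by linarith
      then show False
      proof cases
        case 1
        then show False using a(1) b(3)[of a] q(2)[of a] 3 by simp
      next
        case 2
        have "(r a, p a) \<in> bd_ord B a" using k(1)[OF 2] pa(2) by (auto simp: max_edge_def)
        then show False using ord_antisym[OF rng[OF pathD(1)[OF p]] pa(1) pa(2) a(2)] a(1) by simp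
      next
        case ak: 3
        have "(e, r k) \<in> bd_ord B k" using e pa(2) a(1,2) ak by (auto simp: next_edge_def)
        then show False
          using ord_antisym[OF rng[OF pathD(1)[OF qp]] rb(1) rb(2) b(2)] b(1) 3 q(1) by simp
      qed
    qed
  qed
  then have "path_succ B p q" using less unfolding path_succ_def by blast
  then show ?thesis using e q by (intro exI[of _ q]) auto
qed

text \<open>Two successors of \<open>p\<close> are cofinal with \<open>p\<close>, hence comparable
  at the last edge where they differ, and the smaller one would lie between \<open>p\<close> and the
  larger. This justifies the \<open>THE\<close> in \<open>vershik\<close>.\<close>

lemma successor_unique:
  assumes q: "path_succ B p q" and q': "path_succ B p q'"
  shows "q = q'"
proof (rule ccontr)
  assume ne: "q \<noteq> q'"
  have P: "q \<in> bd_paths B" "q' \<in> bd_paths B" "path_less B p q" "path_less B p q'"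
    using q q' by (auto simp: path_succ_def path_less_def)
  obtain a where a: "\<And>j. j > a \<Longrightarrow> p j = q j" using P(3) by (auto simp: path_less_def)
  obtain b where b: "\<And>j. j > b \<Longrightarrow> p j = q' j" using P(4) by (auto simp: path_less_def)
  have bound: "j \<le> max a b" if "q j \<noteq> q' j" for j
    by (rule ccontr) (use a[of j] b[of j] that in \<open>simp add: le_max_iff_disj\<close>)
  obtain j0 where j0: "q j0 \<noteq> q' j0" using ne by auto
  define k where "k = (GREATEST j. q j \<noteq> q' j)"
  have k: "q k \<noteq> q' k" unfolding k_def using j0 bound by (rule GreatestI_nat)
  have k': "q j = q' j" if "j > k" for j
  proof (rule ccontr)
    assume "q j \<noteq> q' j"
    then have "j \<le> k" unfolding k_def using bound by (rule Greatest_le_nat)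
    then show False using that by simp
  qed
  have "q k \<in> edges_into B k (bd_rng B k (q k))" "q' k \<in> edges_into B k (bd_rng B k (q k))"
    using pathD[OF P(1), of k] pathD[OF P(2), of k] k'[of "Suc k"] by (auto simp: into_iff)
  then have "(q k, q' k) \<in> bd_ord B k \<or> (q' k, q k) \<in> bd_ord B k"
    using ord_total[OF rng[OF pathD(1)[OF P(1)]]] k by blast
  then have "path_less B q q' \<or> path_less B q' q"
    unfolding path_less_def using P(1,2) k k' by metis
  then show False using q q' P unfolding path_succ_def by blast
qed

lemma min_path_iff: "min_path B p \<longleftrightarrow> p \<in> bd_paths B \<and> (\<forall>i. min_edge B i (p i))"
  and max_path_iff: "max_path B p \<longleftrightarrow> p \<in> bd_paths B \<and> (\<forall>i. max_edge B i (p i))"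
  by (auto simp: min_path_def max_path_def min_edge_def max_edge_def)

lemma vershik_max:
  assumes "max_path B p" shows "min_path B (vershik B p)"
proof -
  have "\<exists>!q. min_path B q" using proper by (simp add: properly_ordered_def)
  then show ?thesis unfolding vershik_def using assms by (simp add: theI')
qed

lemma vershik_step:
  assumes p: "p \<in> bd_paths B" and k: "\<And>j. j < k \<Longrightarrow> max_edge B j (p j)" "\<not> max_edge B k (p k)"
  shows "vershik B p \<in> bd_paths B" "next_edge B k (p k) (vershik B p k)"
    "\<And>j. j < k \<Longrightarrow> min_edge B j (vershik B p j)" "\<And>j. j > k \<Longrightarrow> vershik B p j = p j"
proof -
  obtain q where q: "path_succ B p q" "next_edge B k (p k) (q k)" "\<And>j. j < k \<Longrightarrow> min_edge B j (q j)"
    "\<And>j. j > k \<Longrightarrow> q j = p j"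
    using successor[OF p k] by blast
  have "\<not> max_path B p" using k(2) by (auto simp: max_path_iff)
  then have "vershik B p = (THE q. path_succ B p q)" by (simp add: vershik_def)
  also have "\<dots> = q" using q(1) successor_unique by (intro the_equality) auto
  finally have "vershik B p = q" .
  then show "vershik B p \<in> bd_paths B" "next_edge B k (p k) (vershik B p k)"
    "\<And>j. j < k \<Longrightarrow> min_edge B j (vershik B p j)" "\<And>j. j > k \<Longrightarrow> vershik B p j = p j"
    using q by (auto simp: path_succ_def path_less_def)
qed

definition min_head :: "nat \<Rightarrow> (nat \<Rightarrow> nat) \<Rightarrow> bool" where
  "min_head m p \<longleftrightarrow> (\<forall>j<m. min_edge B j (p j))"

definition max_head :: "nat \<Rightarrow> (nat \<Rightarrow> nat) \<Rightarrow> bool" where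
  "max_head m p \<longleftrightarrow> (\<forall>j<m. max_edge B j (p j))"

lemma not_max_head:
  assumes "\<not> max_head m p"
  obtains k where "k < m" "\<And>j. j < k \<Longrightarrow> max_edge B j (p j)" "\<not> max_edge B k (p k)"
proof -
  define k where "k = (LEAST j. \<not> max_edge B j (p j))"
  obtain j where j: "j < m" "\<not> max_edge B j (p j)" using assms by (auto simp: max_head_def)
  have "\<not> max_edge B k (p k)" unfolding k_def using j(2) by (rule LeastI)
  moreover have "k \<le> j" unfolding k_def using j(2) by (rule Least_le)
  moreover have "max_edge B j (p j)" if "j < k" for j
    using not_less_Least[of j "\<lambda>j. \<not> max_edge B j (p j)"] that by (simp add: k_def)
  ultimately show ?thesis using that j(1) by (meson le_less_trans)
qed

text \<open>As in an adding machine, the carry runs past level \<open>m\<close> and leaves minimal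
  edges behind; the maximal path is sent to the minimal one.\<close>

lemma vershik_max_head:
  assumes p: "p \<in> bd_paths B" and m: "max_head m p"
  shows "min_head m (vershik B p)"
proof (cases "max_path B p")
  case True
  then show ?thesis using vershik_max by (simp add: min_path_iff min_head_def)
next
  case False
  then obtain i where "\<not> max_edge B i (p i)" using p by (auto simp: max_path_iff)
  then have "\<not> max_head (Suc i) p" by (auto simp: max_head_def)
  then obtain k where k: "\<And>j. j < k \<Longrightarrow> max_edge B j (p j)" "\<not> max_edge B k (p k)"
    using not_max_head by metis
  then have "m \<le> k" using m by (meson max_head_def not_le)
  then show ?thesis using vershik_step(3)[OF p k] by (auto simp: min_head_def)
qed

text \<open>The carry stops at some \<open>k < m\<close>. So the first \<open>m\<close> edges of the
  image depend only on the first \<open>m\<close> edges, and the edge at \<open>k\<close>, having a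
  predecessor, is not minimal.\<close>

lemma vershik_not_max_head:
  assumes p: "p \<in> bd_paths B" and q: "q \<in> bd_paths B" and pq: "\<And>j. j < m \<Longrightarrow> p j = q j"
    and m: "\<not> max_head m p"
  shows "\<not> min_head m (vershik B p)" "\<And>j. j < m \<Longrightarrow> vershik B p j = vershik B q j"
proof -
  obtain k where k: "k < m" "\<And>j. j < k \<Longrightarrow> max_edge B j (p j)" "\<not> max_edge B k (p k)"
    using not_max_head[OF m] by metis
  have kq: "\<And>j. j < k \<Longrightarrow> max_edge B j (q j)" "\<not> max_edge B k (q k)" using k pq by auto
  note vp = vershik_step[OF p k(2,3)] and vq = vershik_step[OF q kq]
  show "\<not> min_head m (vershik B p)"
  proof
    assume "min_head m (vershik B p)"
    then have "min_edge B k (vershik B p k)" using k(1) by (simp add: min_head_def)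
    moreover have n: "vershik B p k \<in> edges_into B k (bd_rng B k (p k))" "(p k, vershik B p k) \<in> bd_ord B k"
        "p k \<noteq> vershik B p k" using vp(2) by (auto simp: next_edge_def)
    moreover have pk: "p k \<in> edges_into B k (bd_rng B k (p k))" using pathD(1)[OF p] by (simp add: into_iff)
    ultimately have "(vershik B p k, p k) \<in> bd_ord B k" by (auto simp: min_edge_def into_iff)
    then show False using ord_antisym[OF rng[OF pathD(1)[OF p]] pk n(1,2)] n(3) by simp
  qed
  have "next_edge B k (p k) (vershik B q k)" using vq(2) pq[OF k(1)] by simp
  then have "vershik B p k = vershik B q k"
    by (intro next_edge_unique[of "p k" k]) (use pathD(1)[OF p, of k] vp(2) in simp_all)
  then have le: "vershik B p j = vershik B q j" if "j \<le> k" for j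
    using min_head_unique[OF vp(1) vq(1) _ vp(3) vq(3) that] by blast
  show "vershik B p j = vershik B q j" if "j < m" for j
    using le[of j] vp(4)[of j] vq(4)[of j] pq[OF that] by (cases "j \<le> k") auto
qed

end

text \<open>What the argument retains of the diagram. The clause with \<open>q\<close> says that
  membership in \<open>B\<close> can be read off a window of radius \<open>q\<close>, that is,
  \<open>B\<close> is clopen in \<open>X\<close>.\<close>

locale return_structure =
  fixes A :: "'a set" and X :: "(int \<Rightarrow> 'a) set" and xs :: "int \<Rightarrow> 'a" and n :: nat
  assumes finite_alphabet: "finite A"
    and letters: "x \<in> X \<Longrightarrow> x i \<in> A"
    and shX [intro]: "x \<in> X \<Longrightarrow> sh k x \<in> X"
    and xsX [intro]: "xs \<in> X"
    and recurrence: "y \<in> X \<Longrightarrow> \<exists>M. \<forall>x\<in>X. \<exists>k\<le>M. seg x (int k) l = seg y 0 l"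
    and bases: "\<exists>B. B \<subseteq> X \<and> xs \<in> B \<and> (\<forall>x\<in>B. agree r x xs) \<and>
      (\<exists>q. \<forall>x\<in>X. \<forall>y\<in>X. agree q x y \<longrightarrow> x \<in> B \<longrightarrow> y \<in> B) \<and> finite (returns B) \<and> card (returns B) \<le> n"

lemma finite_int_bound: "finite J \<Longrightarrow> \<exists>R::nat. \<forall>i\<in>J. \<bar>i\<bar> \<le> int R"
proof (induction J rule: finite_induct)
  case (insert j J)
  then obtain R where R: "\<forall>i\<in>J. \<bar>i\<bar> \<le> int R" by blast
  have "\<bar>i\<bar> \<le> int (max R (nat \<bar>j\<bar>))" if "i \<in> insert j J" for i
    using that R by fastforce
  then show ?case by blast
qed simp

text \<open>The orbit segments between consecutive visits to \<open>B\<close> are the towers of the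
  Kakutani-Rokhlin partition at level \<open>m\<close>, one for each vertex of that level, and a
  return word is what is read along a tower.\<close>

theorem representation_return_structure:
  assumes fin: "finite A" and min: "minimal_shift_space A X" and rep: "represented_by A X D"
    and card: "\<And>i. card (bd_V D i) \<le> n"
  shows "\<exists>xs. return_structure A X xs n"
proof -
  obtain \<phi> where D: "properly_ordered D"
    and hom: "homeomorphic_map (subtopology (full_shift_top A) X) (bd_path_top D) \<phi>"
    and \<phi>_shift: "\<And>x. x \<in> X \<Longrightarrow> \<phi> (shift x) = vershik D (\<phi> x)"
    using rep by (auto simp: represented_by_def)
  interpret bratteli_diagram D using D by unfold_locales
  have X: "shift_space A X" using min by (simp add: minimal_shift_space_def)
  note shX = shift_space_sh[OF X]
  let ?FS = "product_topology (\<lambda>i::int. discrete_topology A) UNIV"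
  let ?FP = "product_topology (\<lambda>i::nat. discrete_topology (bd_E D i)) UNIV"
  obtain \<psi> where "homeomorphic_maps (subtopology (full_shift_top A) X) (bd_path_top D) \<phi> \<psi>"
    using hom by (auto simp: homeomorphic_map_maps)
  then have maps: "homeomorphic_maps (subtopology ?FS X) (subtopology ?FP (bd_paths D)) \<phi> \<psi>"
    by (simp add: full_shift_top_def bd_path_top_def)
  have XS: "X \<subseteq> Pi\<^sub>E UNIV (\<lambda>_. A)" using shift_space_letters[OF X] by auto
  have PS: "bd_paths D \<subseteq> Pi\<^sub>E UNIV (bd_E D)" by (auto simp: bd_paths_def)
  have tops: "topspace (subtopology ?FS X) = X" "topspace (subtopology ?FP (bd_paths D)) = bd_paths D"
    using XS PS by auto
  have c\<phi>: "continuous_map (subtopology ?FS X) (subtopology ?FP (bd_paths D)) \<phi>"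
    and c\<psi>: "continuous_map (subtopology ?FP (bd_paths D)) (subtopology ?FS X) \<psi>"
    and \<psi>\<phi>: "\<And>x. x \<in> X \<Longrightarrow> \<psi> (\<phi> x) = x" and \<phi>\<psi>: "\<And>p. p \<in> bd_paths D \<Longrightarrow> \<phi> (\<psi> p) = p"
    using maps unfolding homeomorphic_maps_def tops by auto
  have \<phi>P: "\<phi> x \<in> bd_paths D" if "x \<in> X" for x
    using continuous_map_image_subset_topspace[OF c\<phi>] that unfolding tops by auto
  have \<psi>X: "\<psi> p \<in> X" if "p \<in> bd_paths D" for p
    using continuous_map_image_subset_topspace[OF c\<psi>] that unfolding tops by auto
  have compX: "compactin ?FS X"
    using shift_space_compact[OF fin X] by (simp add: full_shift_top_def)
  have "compactin (subtopology ?FP (bd_paths D)) (\<phi> ` X)"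
    by (rule image_compactin[OF _ c\<phi>]) (use compX in \<open>simp add: compactin_subtopology\<close>)
  moreover have "\<phi> ` X = bd_paths D"
  proof
    show "bd_paths D \<subseteq> \<phi> ` X" using \<phi>\<psi> \<psi>X by (metis imageI subsetI)
  qed (use \<phi>P in auto)
  ultimately have compP: "compactin ?FP (bd_paths D)" by (simp add: compactin_subtopology)
  obtain pm where pm: "min_path D pm" and pm_unique: "\<And>p. min_path D p \<Longrightarrow> p = pm"
    using D unfolding properly_ordered_def by (elim conjE ex1E) blast
  have pmP: "pm \<in> bd_paths D" using pm by (simp add: min_path_def)
  define xs where "xs = \<psi> pm"
  have xsX: "xs \<in> X" unfolding xs_def using \<psi>X[OF pmP] .
  \<comment> \<open>Uniform continuity of \<open>\<phi>\<close>; it will show that \<open>B\<close>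
    is clopen.\<close>
  have heads: "\<exists>q. \<forall>x\<in>X. \<forall>y\<in>X. agree q x y \<longrightarrow> (\<forall>j<m. \<phi> x j = \<phi> y j)" for m
  proof -
    have "\<exists>q. \<forall>x\<in>X. (\<forall>y\<in>X. agree q x y \<longrightarrow> (\<forall>j<m. \<phi> x j = \<phi> y j))"
    proof (rule compact_uniform[OF compX])
      show "\<forall>y\<in>X. agree q' x y \<longrightarrow> (\<forall>j<m. \<phi> x j = \<phi> y j)"
        if "\<forall>y\<in>X. agree q x y \<longrightarrow> (\<forall>j<m. \<phi> x j = \<phi> y j)" "q \<le> q'" for q q' x
        using that agree_mono by blast
      show "\<exists>J q. finite J \<and> (\<forall>y\<in>X. (\<forall>i\<in>J. y i = x i) \<longrightarrow>
              (\<forall>z\<in>X. agree q y z \<longrightarrow> (\<forall>j<m. \<phi> y j = \<phi> z j)))" if x: "x \<in> X" for x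
      proof -
        obtain J where J: "finite J" "\<And>y. y \<in> X \<Longrightarrow> (\<forall>i\<in>J. y i = x i) \<Longrightarrow> (\<forall>j\<in>{..<m}. \<phi> y j = \<phi> x j)"
          using continuous_coordinates[OF c\<phi> XS x, of "{..<m}"] by blast
        obtain q where q: "\<forall>i\<in>J. \<bar>i\<bar> \<le> int q" using finite_int_bound[OF J(1)] by blast
        have "\<phi> y j = \<phi> z j" if "y \<in> X" "\<forall>i\<in>J. y i = x i" "z \<in> X" "agree q y z" "j < m" for y z j
        proof -
          have "\<forall>i\<in>J. z i = x i" using that(2,4) q unfolding agree_def by metis
          then show ?thesis using J(2)[OF that(1,2)] J(2)[OF that(3)] that(5) by simp
        qed
        then show ?thesis using J(1) by (intro exI[of _ J] exI[of _ q]) simp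
      qed
    qed
    then show ?thesis .
  qed
  \<comment> \<open>Uniform continuity of the zeroth letter of \<open>\<psi>\<close>; letters at
    other times are zeroth letters of shifted points.\<close>
  have letter: "\<exists>m. \<forall>p\<in>bd_paths D. \<forall>q\<in>bd_paths D. (\<forall>j<m. p j = q j) \<longrightarrow> \<psi> p 0 = \<psi> q 0"
  proof (rule compact_uniform[OF compP])
    show "\<forall>q\<in>bd_paths D. (\<forall>j<m'. p j = q j) \<longrightarrow> \<psi> p 0 = \<psi> q 0"
      if "\<forall>q\<in>bd_paths D. (\<forall>j<m. p j = q j) \<longrightarrow> \<psi> p 0 = \<psi> q 0" "m \<le> m'" for m m' p
      using that by simp
    show "\<exists>J m. finite J \<and> (\<forall>q\<in>bd_paths D. (\<forall>i\<in>J. q i = p i) \<longrightarrow>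
        (\<forall>r\<in>bd_paths D. (\<forall>j<m. q j = r j) \<longrightarrow> \<psi> q 0 = \<psi> r 0))" if p: "p \<in> bd_paths D" for p
    proof -
      obtain J where J: "finite J" "\<And>q. q \<in> bd_paths D \<Longrightarrow> (\<forall>i\<in>J. q i = p i) \<Longrightarrow> \<psi> q 0 = \<psi> p 0"
        using continuous_coordinate[OF c\<psi> PS p, of 0] by blast
      obtain m where m: "J \<subseteq> {..<m}" using J(1) finite_nat_bounded by blast
      have "\<psi> q 0 = \<psi> r 0"
        if "q \<in> bd_paths D" "\<forall>i\<in>J. q i = p i" "r \<in> bd_paths D" "\<forall>j<m. q j = r j" for q r
      proof -
        have "\<forall>i\<in>J. r i = p i" using that(2,4) m by (metis lessThan_iff subsetD)
        then show ?thesis using J(2)[OF that(1,2)] J(2)[OF that(3)] by simp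
      qed
      then show ?thesis using J(1) by (intro exI[of _ J] exI[of _ m]) simp
    qed
  qed
  \<comment> \<open>Near \<open>pm\<close> this is continuity of \<open>\<psi>\<close>. Any other
    path has a non-minimal edge, which a cylinder fixes, so the premise fails there for large
    \<open>m\<close>.\<close>
  have near: "\<exists>m. \<forall>p\<in>bd_paths D. min_head m p \<longrightarrow> agree r (\<psi> p) xs" for r
  proof (rule compact_uniform[OF compP])
    show "min_head m' p \<longrightarrow> agree r (\<psi> p) xs" if "min_head m p \<longrightarrow> agree r (\<psi> p) xs" "m \<le> m'" for m m' p
      using that by (auto simp: min_head_def)
    show "\<exists>J m. finite J \<and> (\<forall>q\<in>bd_paths D. (\<forall>i\<in>J. q i = p i) \<longrightarrow> min_head m q \<longrightarrow> agree r (\<psi> q) xs)"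
      if p: "p \<in> bd_paths D" for p
    proof (cases "p = pm")
      case True
      obtain J where J: "finite J"
        "\<And>q. q \<in> bd_paths D \<Longrightarrow> (\<forall>i\<in>J. q i = p i) \<Longrightarrow> (\<forall>j\<in>{- int r..int r}. \<psi> q j = \<psi> p j)"
        using continuous_coordinates[OF c\<psi> PS p, of "{- int r..int r}"] by blast
      have "agree r (\<psi> q) xs" if "q \<in> bd_paths D" "\<forall>i\<in>J. q i = p i" for q
        unfolding agree_def xs_def using J(2)[OF that] True by (auto simp: abs_le_iff minus_le_iff)
      then show ?thesis using J(1) by (intro exI[of _ J]) simp
    next
      case False
      then have "\<not> min_path D p" using pm_unique by blast
      then obtain i where i: "\<not> min_edge D i (p i)" using p by (auto simp: min_path_iff)
      have "\<not> min_head (Suc i) q" if "q i = p i" for q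
        using i that by (auto simp: min_head_def)
      then show ?thesis by (intro exI[of _ "{i}"] exI[of _ "Suc i"]) simp
    qed
  qed
  have base: "\<exists>B. B \<subseteq> X \<and> xs \<in> B \<and> (\<forall>x\<in>B. agree r x xs) \<and>
      (\<exists>q. \<forall>x\<in>X. \<forall>y\<in>X. agree q x y \<longrightarrow> x \<in> B \<longrightarrow> y \<in> B) \<and>
      finite (returns B) \<and> card (returns B) \<le> n" for r
  proof -
    obtain m1 where m1: "\<And>p q. \<lbrakk>p \<in> bd_paths D; q \<in> bd_paths D; \<forall>j<m1. p j = q j\<rbrakk> \<Longrightarrow> \<psi> p 0 = \<psi> q 0"
      using letter by blast
    obtain m2 where m2: "\<And>p. p \<in> bd_paths D \<Longrightarrow> min_head m2 p \<Longrightarrow> agree r (\<psi> p) xs"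
      using near by blast
    \<comment> \<open>The successor makes \<open>m\<close> positive, so that the edge with index
      \<open>m - 1\<close> exists.\<close>
    define m where "m = Suc (max m1 m2)"
    define B where "B = {x \<in> X. min_head m (\<phi> x)}"
    have BX: "B \<subseteq> X" by (auto simp: B_def)
    have xsB: "xs \<in> B"
      using xsX pm \<phi>\<psi>[OF pmP] by (simp add: B_def xs_def min_path_iff min_head_def)
    have agr: "agree r x xs" if "x \<in> B" for x
    proof -
      have "x \<in> X" "min_head m2 (\<phi> x)" using that by (auto simp: B_def min_head_def m_def)
      then show ?thesis using m2[OF \<phi>P] \<psi>\<phi> by simp
    qed
    obtain q where q: "\<And>x y. \<lbrakk>x \<in> X; y \<in> X; agree q x y\<rbrakk> \<Longrightarrow> \<forall>j<m. \<phi> x j = \<phi> y j"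
      using heads[of m] by blast
    have clopen: "y \<in> B" if "x \<in> X" "y \<in> X" "agree q x y" "x \<in> B" for x y
      using q[OF that(1-3)] that(2,4) by (simp add: B_def min_head_def)
    have \<phi>_sh: "\<phi> (sh (int (Suc k)) x) = vershik D (\<phi> (sh (int k) x))" if "x \<in> X" for k x
      using \<phi>_shift[OF shX[OF that, of "int k"]] by (simp add: shift_sh add.commute)
    have B_iff: "sh k x \<in> B \<longleftrightarrow> min_head m (\<phi> (sh k x))" if "x \<in> X" for k x
      using shX[OF that] by (simp add: B_def)
    \<comment> \<open>Until the next visit to \<open>B\<close>, the first \<open>m\<close> edges are
      never all maximal before a step, so their evolution depends only on their initial
      values.\<close>
    have tower: "\<forall>j<m. \<phi> (sh (int k) x) j = \<phi> (sh (int k) y) j"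
      if x: "x \<in> X" and y: "y \<in> X" and xy: "\<forall>j<m. \<phi> x j = \<phi> y j"
        and nr: "\<And>k. 0 < k \<Longrightarrow> k < l \<Longrightarrow> sh (int k) x \<notin> B" and k: "k < l" for x y k l
      using k
    proof (induction k)
      case (Suc k)
      have "sh (int (Suc k)) x \<notin> B" using nr[of "Suc k"] Suc.prems by simp
      then have "\<not> min_head m (vershik D (\<phi> (sh (int k) x)))"
        using B_iff[OF x] \<phi>_sh[OF x] by metis
      then have nm: "\<not> max_head m (\<phi> (sh (int k) x))"
        using vershik_max_head[OF \<phi>P[OF shX[OF x]]] by blast
      have IH: "\<phi> (sh (int k) x) j = \<phi> (sh (int k) y) j" if "j < m" for j
        using Suc that by simp
      show ?case
        unfolding \<phi>_sh[OF x] \<phi>_sh[OF y]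
        using vershik_not_max_head(2)[OF \<phi>P[OF shX[OF x]] \<phi>P[OF shX[OF y]] IH nm] by simp
    qed (use xy in simp)
    define R where "R u x l \<longleftrightarrow> u = seg x 0 l \<and> x \<in> B \<and> 0 < l \<and> sh (int l) x \<in> B \<and>
      (\<forall>k. 0 < k \<and> k < l \<longrightarrow> sh (int k) x \<notin> B)" for u :: "'a list" and x l
    have same: "u = w" if u: "R u x l" and w: "R w y l'" and v: "\<forall>j<m. \<phi> x j = \<phi> y j" for u w x y l l'
    proof -
      have xy: "x \<in> X" "y \<in> X" using u w BX by (auto simp: R_def)
      have nr: "sh (int k) x \<notin> B" if "0 < k" "k < l" for k using u that by (simp add: R_def)
      have tw: "\<forall>j<m. \<phi> (sh (int k) x) j = \<phi> (sh (int k) y) j" if "k < l" for k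
        using tower[OF xy v nr that] .
      have nry: "sh (int k) y \<notin> B" if "0 < k" "k < l" for k
        using nr[OF that] tw[OF that(2)] B_iff[OF xy(1)] B_iff[OF xy(2)] by (simp add: min_head_def)
      \<comment> \<open>A visit at time \<open>l\<close> means that the first \<open>m\<close> edges
        are maximal at time \<open>l - 1\<close>. Since \<open>x\<close> and \<open>y\<close> share
        these edges, they return at the same time.\<close>
      obtain l0 where l0: "l = Suc l0" using u by (cases l) (auto simp: R_def)
      have "sh (int (Suc l0)) x \<in> B" using u l0 by (simp add: R_def)
      then have "min_head m (vershik D (\<phi> (sh (int l0) x)))"
        using B_iff[OF xy(1)] \<phi>_sh[OF xy(1)] by metis
      moreover have "\<phi> (sh (int l0) x) j = \<phi> (sh (int l0) y) j" if "j < m" for j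
        using tw[of l0] l0 that by simp
      ultimately have "max_head m (\<phi> (sh (int l0) x))"
        using vershik_not_max_head(1)[OF \<phi>P[OF shX[OF xy(1)]] \<phi>P[OF shX[OF xy(2)]]] by blast
      then have "max_head m (\<phi> (sh (int l0) y))" using tw[of l0] l0 by (simp add: max_head_def)
      then have "min_head m (\<phi> (sh (int (Suc l0)) y))"
        unfolding \<phi>_sh[OF xy(2)] by (rule vershik_max_head[OF \<phi>P[OF shX[OF xy(2)]]])
      then have "sh (int l) y \<in> B" using B_iff[OF xy(2)] l0 by blast
      then have "\<not> l < l'" using w u by (auto simp: R_def)
      moreover have "\<not> l' < l" using w nry by (auto simp: R_def)
      ultimately have ll: "l' = l" by simp
      have "x (int k) = y (int k)" if "k < l" for k
      proof -
        have "\<psi> (\<phi> (sh (int k) x)) 0 = \<psi> (\<phi> (sh (int k) y)) 0"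
          using tw[OF that] by (intro m1 \<phi>P shX xy) (simp add: m_def)
        then show ?thesis using \<psi>\<phi>[OF shX[OF xy(1)]] \<psi>\<phi>[OF shX[OF xy(2)]] by (simp add: sh_def)
      qed
      then have "seg x 0 l = seg y 0 l" by (simp add: seg_eq_iff)
      then show ?thesis using u w ll by (simp add: R_def)
    qed
    define c where "c u = (SOME x. \<exists>l. R u x l)" for u
    have c: "\<exists>l. R u (c u) l" if "u \<in> returns B" for u
    proof -
      have "\<exists>x. \<exists>l. R u x l" using that unfolding returns_def R_def by blast
      then show ?thesis unfolding c_def by (rule someI_ex)
    qed
    \<comment> \<open>Edges with index \<open>m - 1\<close> end at level \<open>m\<close>. For a
      path with minimal first \<open>m\<close> edges, this vertex determines all of them.\<close>
    define v where "v u = bd_rng D (m - 1) (\<phi> (c u) (m - 1))" for u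
    have inj: "inj_on v (returns B)"
    proof (rule inj_onI)
      fix u w assume uw: "u \<in> returns B" "w \<in> returns B" "v u = v w"
      obtain l l' where l: "R u (c u) l" "R w (c w) l'" using c[OF uw(1)] c[OF uw(2)] by blast
      have B: "c u \<in> B" "c w \<in> B" using l by (auto simp: R_def)
      then have mh: "min_head m (\<phi> (c u))" "min_head m (\<phi> (c w))"
        and P: "\<phi> (c u) \<in> bd_paths D" "\<phi> (c w) \<in> bd_paths D" using \<phi>P by (auto simp: B_def)
      have "\<phi> (c u) (m - 1) = \<phi> (c w) (m - 1)"
        by (rule min_edge_unique[of "m - 1"])
          (use mh uw(3) pathD(1)[OF P(1)] pathD(1)[OF P(2)] in \<open>auto simp: v_def min_head_def m_def\<close>)
      then have "\<phi> (c u) j = \<phi> (c w) j" if "j < m" for j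
        using min_head_unique[OF P, of "m - 1" j] mh that by (simp add: min_head_def)
      then show "u = w" using same[OF l] by blast
    qed
    have "v ` returns B \<subseteq> bd_V D m"
    proof
      fix z assume "z \<in> v ` returns B"
      then obtain u l where u: "z = v u" "R u (c u) l" using c by blast
      then have "\<phi> (c u) \<in> bd_paths D" using \<phi>P by (auto simp: R_def B_def)
      then show "z \<in> bd_V D m" using rng[OF pathD(1)] u(1) by (simp add: v_def m_def)
    qed
    then have "finite (returns B)" "card (returns B) \<le> card (bd_V D m)"
      using inj finV[of m] by (auto intro: inj_on_finite card_inj_on_le)
    then show ?thesis
      using BX xsB agr clopen card[of m] by (intro exI[of _ B] conjI exI[of _ q]) auto
  qed
  show ?thesis
  proof (intro exI[of _ xs], unfold_locales)
    show "\<exists>M. \<forall>x\<in>X. \<exists>k\<le>M. seg x (int k) l = seg y 0 l" if "y \<in> X" for y l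
      using uniform_recurrence[OF fin min that] .
  qed (use fin shift_space_letters[OF X] shX xsX base in auto)
qed

section \<open>The group of units at an idempotent of the J-class\<close>

text \<open>Pigeonhole in place of extracting a constant subsequence: otherwise every value fails
  from some \<open>N\<close> on, and at the largest of these none is left.\<close>

lemma finite_limit:
  assumes C: "finite C" and ex: "\<And>N. \<exists>t\<in>C. P N t"
    and anti: "\<And>N N' t. P N' t \<Longrightarrow> N \<le> N' \<Longrightarrow> P (N::nat) t"
  shows "\<exists>t\<in>C. \<forall>N. P N t"
proof (rule ccontr)
  assume "\<not> ?thesis"
  then have "\<forall>t\<in>C. \<exists>N. \<not> P N t" by blast
  then obtain f where f: "\<forall>t\<in>C. \<not> P (f t) t" unfolding bchoice_iff ..
  obtain t where t: "t \<in> C" "P (Max (insert 0 (f ` C))) t" using ex by blast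
  have "f t \<le> Max (insert 0 (f ` C))" using t(1) C by (intro Max_ge) auto
  then show False using anti[OF t(2)] f t(1) by blast
qed

lemma take_seg: "take m (seg x i l) = seg x i (min m l)"
  by (rule nth_equalityI) (auto simp: seg_nth)

lemma drop_seg: "drop m (seg x i l) = seg x (i + int m) (l - m)"
  by (rule nth_equalityI) (auto simp: seg_nth algebra_simps)

section \<open>Cutting words with short factors in the language into return words\<close>

context return_structure
begin

text \<open>Unlike \<open>language X\<close> it contains the empty word, which
  \<open>factors N\<close> always produces.\<close>

definition lang :: "'a list set" where
  "lang = {seg x i l | x i l. x \<in> X}"

lemma lang_shift:
  assumes "w \<in> lang" shows "\<exists>x\<in>X. w = seg x i (length w)"
proof -
  obtain x j l where x: "x \<in> X" "w = seg x j l" using assms by (auto simp: lang_def)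
  then have "w = seg (sh (j - i) x) i (length w)" by (simp add: seg_sh)
  then show ?thesis using x(1) by blast
qed

lemma lang_factors:
  assumes w: "w \<in> lang" shows "factors N w \<subseteq> lang"
proof
  fix f assume "f \<in> factors N w"
  then obtain a b where ab: "w = a @ f @ b" by (auto simp: factors_def)
  obtain x where x: "x \<in> X" "w = seg x 0 (length w)" using lang_shift[OF w] by blast
  have "f = take (length f) (drop (length a) w)" using ab by simp
  also have "\<dots> = seg x (int (length a)) (min (length f) (length w - length a))"
    by (subst x(2)) (simp add: take_seg drop_seg)
  finally show "f \<in> lang" using x(1) by (auto simp: lang_def)
qed

lemma recurrence_at:
  assumes "y \<in> X"
  shows "\<exists>M. \<forall>x\<in>X. \<forall>i. \<exists>k\<le>M. seg x (i + int k) l = seg y j l"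
proof -
  obtain M where M: "\<And>x. x \<in> X \<Longrightarrow> \<exists>k\<le>M. seg x (int k) l = seg (sh j y) 0 l"
    using recurrence[OF shX[OF assms]] by meson
  have "\<exists>k\<le>M. seg x (i + int k) l = seg y j l" if "x \<in> X" for x i
    using M[OF shX[OF that, of i]] by (simp add: seg_sh add.commute)
  then show ?thesis by blast
qed

lemma return_times: "\<exists>M. \<forall>x\<in>X. \<forall>i. \<exists>k\<le>M. agree r (sh (i + int k) x) xs"
proof -
  obtain M where M: "\<And>x i. x \<in> X \<Longrightarrow>
      \<exists>k\<le>M. seg x (i + int k) (2 * r + 1) = seg xs (- int r) (2 * r + 1)"
    using recurrence_at[OF xsX] by meson
  have "\<exists>k\<le>M. agree r (sh (i + int k) x) xs" if x: "x \<in> X" for x i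
  proof -
    obtain k where k: "k \<le> M" "seg x (i - int r + int k) (2 * r + 1) = seg xs (- int r) (2 * r + 1)"
      using M[OF x] by meson
    have "agree r (sh (i + int k) x) xs"
      by (rule seg_agree) (use k(2) in \<open>simp add: seg_sh algebra_simps\<close>)
    then show ?thesis using k(1) by blast
  qed
  then show ?thesis by blast
qed

lemma prefix_returns: "\<exists>l\<ge>N. 0 < l \<and> agree N (sh (int l) xs) xs"
proof -
  obtain M where "\<And>x i. x \<in> X \<Longrightarrow> \<exists>k\<le>M. agree N (sh (i + int k) x) xs" using return_times by meson
  then obtain k where "agree N (sh (int (Suc N) + int k) xs) xs" using xsX by meson
  then show ?thesis by (intro exI[of _ "Suc N + k"]) (simp add: add.assoc)
qed

text \<open>The word \<open>z\<close> begins and ends with a window that marks a visit to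
  \<open>B\<close>, and the part between the two centres is to be cut. From a visit, the next one
  and its mark lie within the first \<open>N\<close> letters, so only factors of that length must be
  in \<open>lang\<close>; \<open>z\<close> itself need not be.\<close>

lemma parse_returns:
  assumes BX: "B \<subseteq> X" and xsB: "xs \<in> B"
    and open_B: "\<forall>x\<in>X. \<forall>y\<in>X. agree q x y \<longrightarrow> x \<in> B \<longrightarrow> y \<in> B"
  shows "\<exists>N. \<forall>z x y. 2 * q + 1 < length z \<longrightarrow> factors N z \<subseteq> lang \<longrightarrow> x \<in> B \<longrightarrow> y \<in> B \<longrightarrow>
      take (2 * q + 1) z = seg x (- int q) (2 * q + 1) \<longrightarrow>
      drop (length z - (2 * q + 1)) z = seg y (- int q) (2 * q + 1) \<longrightarrow>
      (\<exists>us. us \<noteq> [] \<and> set us \<subseteq> returns B \<and> concat us = take (length z - (2 * q + 1)) (drop q z))"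
proof -
  have clopen: "y \<in> B" if "x \<in> X" "y \<in> X" "agree q x y" "x \<in> B" for x y
    using open_B that by blast
  obtain M where M: "\<And>x i. x \<in> X \<Longrightarrow> \<exists>k\<le>M. agree q (sh (i + int k) x) xs"
    using return_times by meson
  have mark: "sh k x \<in> B" if "x \<in> X" "x1 \<in> B" "seg x (k - int q) (2 * q + 1) = seg x1 (- int q) (2 * q + 1)"
    for x x1 k
  proof (rule clopen)
    have "agree q (sh k x) x1" by (rule seg_agree) (use that(3) in \<open>simp add: seg_sh algebra_simps\<close>)
    then show "agree q x1 (sh k x)" by (rule agree_sym)
  qed (use that BX in auto)
  \<comment> \<open>A window of length \<open>2 * q + 1\<close> plus the largest possible first
    return time \<open>M + 1\<close>.\<close>
  define N where "N = 2 * q + 2 + M"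
  have main: "\<exists>us. us \<noteq> [] \<and> set us \<subseteq> returns B \<and> concat us = take (length z - (2 * q + 1)) (drop q z)"
    if "2 * q + 1 < length z" "factors N z \<subseteq> lang" "x \<in> B" "y \<in> B"
      "take (2 * q + 1) z = seg x (- int q) (2 * q + 1)"
      "drop (length z - (2 * q + 1)) z = seg y (- int q) (2 * q + 1)" for z x y
    using that
  proof (induction "length z" arbitrary: z x rule: less_induct)
    case less
    define m where "m = length z - (2 * q + 1)"
    have m: "0 < m" "length z = 2 * q + 1 + m" using less.prems(1) by (auto simp: m_def)
    have "take N z \<in> factors N z"
      unfolding factors_def mem_Collect_eq
      by (rule conjI, simp, rule exI[of _ "[]"], rule exI[of _ "drop N z"], simp)
    then have "take N z \<in> lang" using less.prems(2) by blast
    \<comment> \<open>The point \<open>x1\<close> represents only the first \<open>N\<close> letters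
      of \<open>z\<close>; the induction takes a fresh point after each return word.\<close>
    then obtain x1 where x1: "x1 \<in> X" "take N z = seg x1 (- int q) (length (take N z))"
      using lang_shift by blast
    define p where "p = min (length z) N"
    have tz: "take N z = seg x1 (- int q) p" using x1(2) by (simp add: p_def)
    have tk: "take k z = seg x1 (- int q) k" if "k \<le> p" for k
    proof -
      have "k \<le> N" using that by (simp add: p_def)
      then have "take k z = take k (take N z)" by (simp add: min_absorb1)
      then show ?thesis using that by (simp add: tz take_seg min_def)
    qed
    have "sh 0 x1 \<in> B"
      by (rule mark[OF x1(1) less.prems(3)])
        (use tk[of "2 * q + 1"] less.prems(1,5) in \<open>simp add: p_def N_def\<close>)
    then have x1B: "x1 \<in> B" by simp
    define l where "l = (LEAST l. 0 < l \<and> sh (int l) x1 \<in> B)"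
    obtain k where k: "k \<le> M" "agree q (sh (1 + int k) x1) xs" using M[OF x1(1)] by blast
    have "sh (int (Suc k)) x1 \<in> B"
      using clopen[OF xsX shX[OF x1(1)] agree_sym[OF k(2)] xsB] by simp
    then have kB: "0 < Suc k \<and> sh (int (Suc k)) x1 \<in> B" by simp
    have l: "0 < l" "sh (int l) x1 \<in> B"
      using LeastI[of "\<lambda>l. 0 < l \<and> sh (int l) x1 \<in> B", OF kB] by (simp_all add: l_def)
    have lM: "l \<le> Suc M"
      using Least_le[of "\<lambda>l. 0 < l \<and> sh (int l) x1 \<in> B", OF kB] k(1) by (simp add: l_def)
    have least: "sh (int j) x1 \<notin> B" if "0 < j" "j < l" for j
      using not_less_Least[of j "\<lambda>l. 0 < l \<and> sh (int l) x1 \<in> B"] that by (simp add: l_def)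
    have ret: "seg x1 0 l \<in> returns B" unfolding returns_def using x1B l least by blast
    have mid: "take j (drop q z) = seg x1 0 j" if "q + j \<le> p" for j
      using tk[of "j + q"] that by (simp add: take_drop drop_seg add.commute)
    consider "m < l" | "m = l" | "l < m" by linarith
    then show ?case
    proof cases
      case 1
      \<comment> \<open>Here all of \<open>z\<close> is visible in \<open>x1\<close>, and its final
        mark would be a visit before the first return time.\<close>
      then have "p = length z" using lM m by (simp add: p_def N_def)
      then have z: "z = seg x1 (- int q) (length z)" using tk[of "length z"] by simp
      have "drop m z = seg x1 (- int q + int m) (2 * q + 1)"
        using arg_cong[OF z, of "drop m"] m by (simp add: drop_seg)
      moreover have "drop m z = seg y (- int q) (2 * q + 1)" using less.prems(6) by (simp add: m_def)
      ultimately have "sh (int m) x1 \<in> B"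
        by (intro mark[OF x1(1) less.prems(4)]) (simp add: algebra_simps)
      then show ?thesis using least[of m] m 1 by simp
    next
      case 2
      have "q + m \<le> p" using m lM 2 by (simp add: p_def N_def)
      then have "take m (drop q z) = seg x1 0 l" using mid 2 by simp
      then show ?thesis using ret by (intro exI[of _ "[seg x1 0 l]"]) (simp add: m_def)
    next
      case 3
      have lp: "2 * q + 1 + l \<le> p" using m lM 3 by (simp add: p_def N_def)
      define z2 where "z2 = drop l z"
      have lz2: "length z2 = 2 * q + 1 + (m - l)" using 3 m by (simp add: z2_def)
      have "\<exists>us. us \<noteq> [] \<and> set us \<subseteq> returns B \<and> concat us = take (length z2 - (2 * q + 1)) (drop q z2)"
      proof (rule less.hyps)
        show "length z2 < length z" using l(1) m by (simp add: z2_def)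
        show "2 * q + 1 < length z2" using 3 lz2 by simp
        have "z = take l z @ z2 @ []" by (simp add: z2_def)
        then show "factors N z2 \<subseteq> lang" using factors_mono[of N z2 "take l z" "[]"] less.prems(2) by simp
        show "sh (int l) x1 \<in> B" by (rule l(2))
        show "y \<in> B" by (rule less.prems(4))
        have "take (2 * q + 1) z2 = drop l (take (2 * q + 1 + l) z)"
          by (simp add: z2_def take_drop add.commute)
        also have "\<dots> = seg (sh (int l) x1) (- int q) (2 * q + 1)"
          unfolding tk[OF lp] by (simp add: drop_seg seg_sh)
        finally show "take (2 * q + 1) z2 = seg (sh (int l) x1) (- int q) (2 * q + 1)" .
        have "drop (length z2 - (2 * q + 1)) z2 = drop m z"
          using 3 lz2 by (simp add: z2_def)
        then show "drop (length z2 - (2 * q + 1)) z2 = seg y (- int q) (2 * q + 1)"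
          using less.prems(6) by (simp add: m_def)
      qed
      then obtain us where us: "us \<noteq> []" "set us \<subseteq> returns B" "concat us = take (m - l) (drop q z2)"
        using lz2 by auto
      have "take m (drop q z) = take l (drop q z) @ take (m - l) (drop l (drop q z))"
        using take_add[of l "m - l" "drop q z"] 3 by simp
      also have "drop l (drop q z) = drop q z2" by (simp add: z2_def add.commute)
      also have "take l (drop q z) = seg x1 0 l" using mid[of l] lp by simp
      finally show ?thesis
        using us ret by (intro exI[of _ "seg x1 0 l # us"]) (simp add: m_def)
    qed
  qed
  show ?thesis by (rule exI[of _ N]) (use main in blast)
qed

end

section \<open>The idempotent e and its interaction with return words\<close>

locale schutzenberger = pro_setting V A + return_structure A X xs n
  for V :: "nat sgrp set" and A :: "'a set" and X xs n
begin

lemma seg_words [intro]: "x \<in> X \<Longrightarrow> 0 < l \<Longrightarrow> seg x i l \<in> words A"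
  using letters by (auto simp: words_def seg_def)

lemma ev_seg_add:
  assumes "i \<in> GM" "x \<in> X" "0 < l" "0 < m"
  shows "ev i (seg x k (l + m)) = sg_mult (fst i) (ev i (seg x k l)) (ev i (seg x (k + int l) m))"
  unfolding seg_add using assms by (intro ev_append) auto

text \<open>
  The bound \<open>N \<le> l\<close> matters only for periodic \<open>X\<close>: without it, the period of \<open>xs\<close> would
  qualify for every \<open>N\<close>, and a limit could be a finite word.
\<close>

definition prefix_limit :: "'a gen_sgrp \<Rightarrow> nat set" where
  "prefix_limit i = {t. \<forall>N. \<exists>l\<ge>N. 0 < l \<and> ev i (seg xs 0 l) = t \<and> agree N (sh (int l) xs) xs}"

lemma prefix_limit_sub: "i \<in> GM \<Longrightarrow> prefix_limit i \<subseteq> carrier (fst i)"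
  using xsX by (force simp: prefix_limit_def)

lemma prefix_limit_nonempty:
  assumes i: "i \<in> GM" shows "prefix_limit i \<noteq> {}"
proof -
  have "\<exists>t\<in>carrier (fst i). \<forall>N. \<exists>l\<ge>N. 0 < l \<and> ev i (seg xs 0 l) = t \<and> agree N (sh (int l) xs) xs"
  proof (rule finite_limit)
    show "\<exists>t\<in>carrier (fst i). \<exists>l\<ge>N. 0 < l \<and> ev i (seg xs 0 l) = t \<and> agree N (sh (int l) xs) xs" for N
    proof -
      obtain l where "N \<le> l" "0 < l" "agree N (sh (int l) xs) xs" using prefix_returns by blast
      then show ?thesis using i xsX by (intro bexI[of _ "ev i (seg xs 0 l)"] exI[of _ l]) auto
    qed
    show "\<exists>l\<ge>N. 0 < l \<and> ev i (seg xs 0 l) = t \<and> agree N (sh (int l) xs) xs"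
      if "\<exists>l\<ge>N'. 0 < l \<and> ev i (seg xs 0 l) = t \<and> agree N' (sh (int l) xs) xs" "N \<le> N'" for N N' t
    proof -
      from that(1)
      obtain l where l: "N' \<le> l" "0 < l" "ev i (seg xs 0 l) = t" "agree N' (sh (int l) xs) xs"
        by (elim exE conjE)
      have "agree N (sh (int l) xs) xs" using l(4) that(2) by (rule agree_mono)
      then show ?thesis using l that(2) by (intro exI[of _ l]) auto
    qed
  qed (use GM_D(3)[OF i] in simp)
  then show ?thesis unfolding prefix_limit_def by blast
qed

lemma prefix_limit_mult:
  assumes i: "i \<in> GM" and st: "s \<in> prefix_limit i" "t \<in> prefix_limit i"
  shows "sg_mult (fst i) s t \<in> prefix_limit i"
  unfolding prefix_limit_def mem_Collect_eq
proof
  fix N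
  obtain l where l: "N \<le> l" "0 < l" "ev i (seg xs 0 l) = t" "agree N (sh (int l) xs) xs"
    using st(2) unfolding prefix_limit_def by blast
  \<comment> \<open>Radius \<open>N + l\<close> guarantees that the prefix of length
    \<open>k\<close> is followed by the prefix of length \<open>l\<close>, and that a window of
    radius \<open>N\<close> around the end of the product still agrees with
    \<open>xs\<close>.\<close>
  obtain k where k: "N + l \<le> k" "0 < k" "ev i (seg xs 0 k) = s" "agree (N + l) (sh (int k) xs) xs"
    using st(1) unfolding prefix_limit_def by blast
  have "seg xs (int k) l = seg (sh (int k) xs) 0 l" by (simp add: seg_sh)
  also have "\<dots> = seg xs 0 l" by (rule agree_seg[OF k(4)]) auto
  finally have "ev i (seg xs 0 (k + l)) = sg_mult (fst i) s t"
    using ev_seg_add[OF i xsX k(2) l(2), of 0] k(3) l(3) by simp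
  moreover have "agree N (sh (int (k + l)) xs) xs"
  proof -
    have "agree N (sh (int l) (sh (int k) xs)) (sh (int l) xs)"
      using k(4) unfolding agree_def sh_def by auto
    then show ?thesis using agree_trans[OF _ l(4)] by (simp add: add.commute)
  qed
  ultimately show "\<exists>la\<ge>N. 0 < la \<and> ev i (seg xs 0 la) = sg_mult (fst i) s t \<and> agree N (sh (int la) xs) xs"
    using k(1,2) by (intro exI[of _ "k + l"]) auto
qed

text \<open>At each coordinate \<open>prefix_limit\<close> is a nonempty finite semigroup, hence has
  an idempotent, and transition maps preserve these idempotents; compactness assembles them.\<close>

lemma idempotent_prefix_limit:
  "\<exists>e\<in>carrier F. \<forall>i\<in>GM. e i \<in> prefix_limit i \<and> sg_mult (fst i) (e i) (e i) = e i"
proof -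
  have "\<exists>e\<in>carrier F. \<forall>i\<in>GM. e i \<in> {t \<in> prefix_limit i. sg_mult (fst i) t t = t}"
  proof (rule compact_choice1)
    fix i assume i: "i \<in> GM"
    interpret finite_sgrp "fst i" using i by (rule GM_finite_sgrp)
    show "{t \<in> prefix_limit i. sg_mult (fst i) t t = t} \<subseteq> carrier (fst i)"
      using prefix_limit_sub[OF i] by blast
    show "{t \<in> prefix_limit i. sg_mult (fst i) t t = t} \<noteq> {}"
      using idempotent_exists[OF prefix_limit_nonempty[OF i] prefix_limit_sub[OF i] prefix_limit_mult[OF i]]
      by blast
  next
    fix i j t assume ij: "i \<in> GM" "j \<in> GM" "gen_le A i j"
      and t: "t \<in> {t \<in> prefix_limit j. sg_mult (fst j) t t = t}"
    have tc: "t \<in> carrier (fst j)" using t prefix_limit_sub[OF ij(2)] by blast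
    have "sg_mult (fst i) (gen_trans A i j t) (gen_trans A i j t) = gen_trans A i j (sg_mult (fst j) t t)"
      using gen_trans_hom[OF ij(3)] tc by (simp add: sg_hom_def)
    also have "sg_mult (fst j) t t = t" using t by blast
    finally have "sg_mult (fst i) (gen_trans A i j t) (gen_trans A i j t) = gen_trans A i j t" .
    moreover have "gen_trans A i j t \<in> prefix_limit i"
      unfolding prefix_limit_def mem_Collect_eq
    proof
      fix N
      obtain l where "N \<le> l" "0 < l" "ev j (seg xs 0 l) = t" "agree N (sh (int l) xs) xs"
        using t unfolding prefix_limit_def by blast
      then show "\<exists>l\<ge>N. 0 < l \<and> ev i (seg xs 0 l) = gen_trans A i j t \<and> agree N (sh (int l) xs) xs"
        using ev_trans[OF ij(2,3) seg_words[OF xsX]] by (intro exI[of _ l]) auto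
    qed
    ultimately show "gen_trans A i j t \<in> {t \<in> prefix_limit i. sg_mult (fst i) t t = t}" by blast
  qed
  then show ?thesis by blast
qed

end

locale schutzenberger_idempotent = schutzenberger +
  fixes e
  assumes eF: "e \<in> carrier F"
    and e_lim: "i \<in> GM \<Longrightarrow> e i \<in> prefix_limit i"
    and e_idem: "i \<in> GM \<Longrightarrow> sg_mult (fst i) (e i) (e i) = e i"
begin

lemma e_prefix:
  assumes "i \<in> GM"
  obtains l where "N \<le> l" "0 < l" "ev i (seg xs 0 l) = e i" "agree N (sh (int l) xs) xs"
  using e_lim[OF assms] unfolding prefix_limit_def by blast

lemma e_ideal:
  assumes i: "i \<in> GM" and x: "x \<in> X" and l: "0 < l"
  shows "\<exists>c\<in>carrier (fst i). \<exists>d\<in>carrier (fst i).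
    e i = sg_mult (fst i) (sg_mult (fst i) c (ev i (seg x k l))) d"
proof -
  interpret S: finite_sgrp "fst i" using i by (rule GM_finite_sgrp)
  obtain M where M: "\<And>y j. y \<in> X \<Longrightarrow> \<exists>m\<le>M. seg y (j + int m) l = seg x k l"
    using recurrence_at[OF x] by meson
  \<comment> \<open>The summand 2 leaves a nonempty word on each side of the occurrence; the empty
    word has no value in a semigroup.\<close>
  obtain L where L: "M + l + 2 \<le> L" "ev i (seg xs 0 L) = e i" using e_prefix[OF i] by metis
  obtain m where m: "m \<le> M" "seg xs (1 + int m) l = seg x k l" using M[OF xsX] by blast
  define r where "r = L - (1 + m + l)"
  have r: "L = (Suc m + l) + r" "0 < r" using L(1) m(1) by (auto simp: r_def)
  have "e i = sg_mult (fst i) (ev i (seg xs 0 (Suc m + l))) (ev i (seg xs (int (Suc m + l)) r))"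
    using ev_seg_add[OF i xsX, of "Suc m + l" r 0] r l L(2) by simp
  also have "ev i (seg xs 0 (Suc m + l)) = sg_mult (fst i) (ev i (seg xs 0 (Suc m))) (ev i (seg x k l))"
    using ev_seg_add[OF i xsX, of "Suc m" l 0] l m(2) by simp
  finally show ?thesis using i xsX r(2) by (metis ev_closed seg_words zero_less_Suc)
qed

text \<open>
  A return word \<open>u\<close> to a small neighbourhood of \<open>xs\<close> is followed by a long prefix and preceded
  by a long suffix of the two halves of \<open>xs\<close>. Hence \<open>u e \<in> e S\<close>, and \<open>t u \<in> S t\<close> for a limit
  \<open>t\<close> of suffixes, which is L-equivalent to \<open>e\<close>.
\<close>

lemma e_commute:
  assumes i: "i \<in> GM"
  shows "\<exists>r. \<forall>x\<in>X. \<forall>l>0. agree r x xs \<longrightarrow> agree r (sh (int l) x) xs \<longrightarrow>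
    sg_mult (fst i) (ev i (seg x 0 l)) (e i) = sg_mult (fst i) (sg_mult (fst i) (e i) (ev i (seg x 0 l))) (e i) \<and>
    sg_mult (fst i) (e i) (ev i (seg x 0 l)) = sg_mult (fst i) (sg_mult (fst i) (e i) (ev i (seg x 0 l))) (e i) \<and>
    (\<exists>c\<in>carrier (fst i). \<exists>d\<in>carrier (fst i). e i =
      sg_mult (fst i) (sg_mult (fst i) c (sg_mult (fst i) (sg_mult (fst i) (e i) (ev i (seg x 0 l))) (e i))) d)"
proof -
  interpret S: finite_sgrp "fst i" using i by (rule GM_finite_sgrp)
  have ec: "e i \<in> carrier (fst i)" using F_at[OF eF i] .
  obtain L where L: "0 < L" "ev i (seg xs 0 L) = e i" using e_prefix[OF i] by metis
  have "\<exists>t\<in>carrier (fst i). \<forall>N. \<exists>j\<ge>N. 0 < j \<and> ev i (seg xs (- int j) j) = t"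
  proof (rule finite_limit)
    show "\<exists>t\<in>carrier (fst i). \<exists>j\<ge>N. 0 < j \<and> ev i (seg xs (- int j) j) = t" for N
      using i xsX by (intro bexI[of _ "ev i (seg xs (- int (Suc N)) (Suc N))"] exI[of _ "Suc N"]) auto
    show "\<exists>j\<ge>N. 0 < j \<and> ev i (seg xs (- int j) j) = t"
      if "\<exists>j\<ge>N'. 0 < j \<and> ev i (seg xs (- int j) j) = t" "N \<le> N'" for N N' t
    proof -
      from that(1) obtain j where "N' \<le> j" "0 < j" "ev i (seg xs (- int j) j) = t"
        by (elim exE conjE)
      then show ?thesis using that(2) by (intro exI[of _ j]) auto
    qed
  qed (rule S.fin)
  then obtain t where tc: "t \<in> carrier (fst i)"
    and t: "\<forall>N. \<exists>j\<ge>N. 0 < j \<and> ev i (seg xs (- int j) j) = t" ..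
  from t[THEN spec, of 0] obtain j where j: "0 < j" "ev i (seg xs (- int j) j) = t"
    by (elim exE conjE)
  \<comment> \<open>A long prefix in \<open>prefix_limit\<close> ends at a near-return to
    \<open>xs\<close>, hence with the suffix of length \<open>j\<close> that represents
    \<open>t\<close>.\<close>
  obtain a where a: "a \<in> carrier (fst i)" "e i = S.mult a t"
  proof -
    obtain l where l: "Suc j \<le> l" "ev i (seg xs 0 l) = e i" "agree (Suc j) (sh (int l) xs) xs"
      using e_prefix[OF i] by metis
    have "seg xs (int (l - j)) j = seg (sh (int l) xs) (- int j) j" using l(1) by (simp add: seg_sh)
    also have "\<dots> = seg xs (- int j) j" by (rule agree_seg[OF l(3)]) auto
    finally have "e i = S.mult (ev i (seg xs 0 (l - j))) t"
      using ev_seg_add[OF i xsX, of "l - j" j 0] l j by simp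
    then show thesis using that i xsX l(1) by (metis Suc_le_lessD ev_closed seg_words zero_less_diff)
  qed
  \<comment> \<open>By recurrence, a long suffix that represents \<open>t\<close> contains the
    prefix that represents \<open>e i\<close>.\<close>
  obtain c d where cd: "c \<in> carrier (fst i)" "d \<in> carrier (fst i)" "t = S.mult (S.mult c (e i)) d"
  proof -
    obtain M where M: "\<And>y k. y \<in> X \<Longrightarrow> \<exists>m\<le>M. seg y (k + int m) L = seg xs 0 L"
      using recurrence_at[OF xsX] by meson
    from t[THEN spec, of "M + L + 2"]
    obtain p where p: "M + L + 2 \<le> p" "ev i (seg xs (- int p) p) = t"
      by (elim exE conjE)
    obtain m where m: "m \<le> M" "seg xs (1 - int p + int m) L = seg xs 0 L" using M[OF xsX] by meson
    define r where "r = p - (1 + m + L)"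
    have r: "p = (Suc m + L) + r" "0 < r" using p(1) m(1) by (auto simp: r_def)
    have "t = S.mult (ev i (seg xs (- int p) (Suc m + L))) (ev i (seg xs (- int p + int (Suc m + L)) r))"
      using ev_seg_add[OF i xsX, of "Suc m + L" r "- int p"] r p(2) by simp
    also have "ev i (seg xs (- int p) (Suc m + L)) = S.mult (ev i (seg xs (- int p) (Suc m))) (e i)"
      using ev_seg_add[OF i xsX, of "Suc m" L "- int p"] L m(2) by (simp add: algebra_simps)
    finally show thesis using that i xsX r(2) by (metis ev_closed seg_words zero_less_Suc)
  qed
  \<comment> \<open>With \<open>e i = a t\<close> and \<open>t\<close> in the ideal of
    \<open>e i\<close>, stability puts \<open>t\<close> into the left ideal of
    \<open>e i\<close>.\<close>
  have te: "S.mult t (e i) = t"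
  proof -
    have "\<exists>y\<in>carrier (fst i). t = S.mult y (S.mult a t)"
      by (rule S.stable_left[OF cd(1) tc cd(2) a(1) cd(3)[unfolded a(2)]])
    then obtain y where yc: "y \<in> carrier (fst i)" and "t = S.mult y (S.mult a t)" by (elim bexE)
    then have ty: "t = S.mult y (e i)" unfolding a(2) by simp
    have "S.mult t (e i) = S.mult (S.mult y (e i)) (e i)"
      using arg_cong[OF ty, of "\<lambda>s. S.mult s (e i)"] .
    also have "\<dots> = S.mult y (e i)" unfolding S.assoc[OF yc ec ec] e_idem[OF i] ..
    finally show ?thesis unfolding ty[symmetric] .
  qed
  \<comment> \<open>At both ends of the return word, this radius shows \<open>L\<close> letters to
    the right and \<open>j\<close> letters to the left.\<close>
  define r where "r = max L j"
  show ?thesis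
  proof (intro exI[of _ r] ballI allI impI)
    fix x l assume x: "x \<in> X" and l: "0 < l" and ag: "agree r x xs" "agree r (sh (int l) x) xs"
    define u where "u = ev i (seg x 0 l)"
    have uc: "u \<in> carrier (fst i)" unfolding u_def using i x l by blast
    have "seg x (int l) L = seg (sh (int l) x) 0 L" by (simp add: seg_sh)
    also have "\<dots> = seg xs 0 L" by (rule agree_seg[OF ag(2)]) (auto simp: r_def)
    finally have ue: "ev i (seg x 0 (l + L)) = S.mult u (e i)"
      using ev_seg_add[OF i x l L(1), of 0] L(2) by (simp add: u_def)
    have "seg x 0 L = seg xs 0 L" by (rule agree_seg[OF ag(1)]) (auto simp: r_def)
    then have "ev i (seg x 0 (L + l)) = S.mult (e i) (ev i (seg x (int L) l))"
      using ev_seg_add[OF i x L(1) l, of 0] L(2) by simp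
    then have ub: "S.mult u (e i) = S.mult (e i) (ev i (seg x (int L) l))" using ue by (simp add: add.commute)
    have bc: "ev i (seg x (int L) l) \<in> carrier (fst i)" using i x l by blast
    have 1: "S.mult (S.mult (e i) u) (e i) = S.mult u (e i)"
      using ub e_idem[OF i] ec uc bc by (metis S.assoc)
    have "seg x (- int j) j = seg xs (- int j) j" by (rule agree_seg[OF ag(1)]) (auto simp: r_def)
    then have tu: "ev i (seg x (- int j) (j + l)) = S.mult t u"
      using ev_seg_add[OF i x j(1) l, of "- int j"] j(2) by (simp add: u_def)
    have "seg x (- int j + int l) j = seg (sh (int l) x) (- int j) j" by (simp add: seg_sh)
    also have "\<dots> = seg xs (- int j) j" by (rule agree_seg[OF ag(2)]) (auto simp: r_def)
    finally have "ev i (seg x (- int j) (l + j)) = S.mult (ev i (seg x (- int j) l)) t"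
      using ev_seg_add[OF i x l j(1), of "- int j"] j(2) by simp
    then have tb: "S.mult t u = S.mult (ev i (seg x (- int j) l)) t" using tu by (simp add: add.commute)
    have b'c: "ev i (seg x (- int j) l) \<in> carrier (fst i)" using i x l by blast
    have tue: "S.mult (S.mult t u) (e i) = S.mult t u"
      using tb te tc ec b'c by (metis S.assoc)
    have 2: "S.mult (S.mult (e i) u) (e i) = S.mult (e i) u"
      using a tue tc ec uc by (metis S.assoc S.closed)
    obtain c' d' where "c' \<in> carrier (fst i)" "d' \<in> carrier (fst i)"
      "e i = S.mult (S.mult c' (ev i (seg x 0 (l + L)))) d'"
      using e_ideal[OF i x, of "l + L" 0] l by auto
    then have 3: "\<exists>c\<in>carrier (fst i). \<exists>d\<in>carrier (fst i). e i = S.mult (S.mult c (S.mult (S.mult (e i) u) (e i))) d"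
      unfolding 1 ue by blast
    show "S.mult (ev i (seg x 0 l)) (e i) = S.mult (S.mult (e i) (ev i (seg x 0 l))) (e i) \<and>
       S.mult (e i) (ev i (seg x 0 l)) = S.mult (S.mult (e i) (ev i (seg x 0 l))) (e i) \<and>
       (\<exists>c\<in>carrier (fst i). \<exists>d\<in>carrier (fst i).
          e i = S.mult (S.mult c (S.mult (S.mult (e i) (ev i (seg x 0 l))) (e i))) d)"
      using 1 2 3 unfolding u_def by simp
  qed
qed

end

section \<open>Local units and J-equivalent idempotents in the free pro-V semigroup\<close>

context pro_setting
begin

abbreviation fmult (infixl "\<cdot>" 70) where "x \<cdot> y \<equiv> sg_mult F x y"

lemma F_mult_rewrite:
  "x \<in> carrier F \<Longrightarrow> y \<in> carrier F \<Longrightarrow> z \<in> carrier F \<Longrightarrow> x \<cdot> y = w \<Longrightarrow> x \<cdot> (y \<cdot> z) = w \<cdot> z"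
  by (simp flip: F_assoc)

text \<open>For idempotent \<open>f\<close>, the group of units of the local monoid at
  \<open>f\<close>, that is, the maximal subgroup with identity \<open>f\<close>.\<close>

definition units :: "('a gen_sgrp \<Rightarrow> nat) \<Rightarrow> ('a gen_sgrp \<Rightarrow> nat) set" where
  "units f = {x \<in> carrier F. f \<cdot> x = x \<and> x \<cdot> f = x \<and>
     (\<exists>y\<in>carrier F. f \<cdot> y = y \<and> y \<cdot> f = y \<and> x \<cdot> y = f \<and> y \<cdot> x = f)}"

lemma unitsD:
  assumes "x \<in> units f"
  shows "x \<in> carrier F" "f \<cdot> x = x" "x \<cdot> f = x"
    "\<exists>y\<in>carrier F. f \<cdot> y = y \<and> y \<cdot> f = y \<and> x \<cdot> y = f \<and> y \<cdot> x = f"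
  using assms unfolding units_def by blast+

lemma units_mult:
  assumes f: "f \<in> carrier F" and x: "x \<in> units f" and z: "z \<in> units f"
  shows "x \<cdot> z \<in> units f"
proof -
  note xu = unitsD[OF x] and zu = unitsD[OF z]
  obtain y where y: "y \<in> carrier F" "f \<cdot> y = y" "y \<cdot> f = y" "x \<cdot> y = f" "y \<cdot> x = f" using xu(4) by blast
  obtain w where w: "w \<in> carrier F" "f \<cdot> w = w" "w \<cdot> f = w" "z \<cdot> w = f" "w \<cdot> z = f" using zu(4) by blast
  have 1: "x \<cdot> z \<cdot> (w \<cdot> y) = f"
  proof -
    have "x \<cdot> z \<cdot> (w \<cdot> y) = x \<cdot> (z \<cdot> w \<cdot> y)"
      using xu(1) zu(1) y(1) w(1) F_mult_closed by (simp add: F_assoc)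
    then show ?thesis using y w by simp
  qed
  have 2: "w \<cdot> y \<cdot> (x \<cdot> z) = f"
  proof -
    have "w \<cdot> y \<cdot> (x \<cdot> z) = w \<cdot> (y \<cdot> x \<cdot> z)"
      using xu(1) zu(1) y(1) w(1) F_mult_closed by (simp add: F_assoc)
    then show ?thesis using y w zu by simp
  qed
  have 3: "f \<cdot> (x \<cdot> z) = x \<cdot> z" "f \<cdot> (w \<cdot> y) = w \<cdot> y"
    using F_assoc[OF f xu(1) zu(1)] F_assoc[OF f w(1) y(1)] xu(2) w(2) by simp_all
  have 4: "x \<cdot> z \<cdot> f = x \<cdot> z" "w \<cdot> y \<cdot> f = w \<cdot> y"
    using F_assoc[OF xu(1) zu(1) f] F_assoc[OF w(1) y(1) f] zu(3) y(3) by simp_all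
  have 5: "x \<cdot> z \<in> carrier F" "w \<cdot> y \<in> carrier F"
    using F_mult_closed[OF xu(1) zu(1)] F_mult_closed[OF w(1) y(1)] .
  show ?thesis
    unfolding units_def mem_Collect_eq
    by (intro conjI bexI[of _ "w \<cdot> y"]) (use 1 2 3 4 5 in simp_all)
qed

lemma units_group:
  assumes f: "f \<in> carrier F" "f \<cdot> f = f"
  shows "group \<lparr>carrier = units f, monoid.mult = sg_mult F, one = f\<rparr>"
proof (rule groupI)
  have fu: "f \<in> units f" unfolding units_def using f by auto
  show "\<one>\<^bsub>\<lparr>carrier = units f, monoid.mult = sg_mult F, one = f\<rparr>\<^esub> \<in>
      carrier \<lparr>carrier = units f, monoid.mult = sg_mult F, one = f\<rparr>" using fu by simp
next
  fix x assume "x \<in> carrier \<lparr>carrier = units f, monoid.mult = sg_mult F, one = f\<rparr>"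
  then have x: "x \<in> units f" by simp
  obtain y where y: "y \<in> carrier F" "f \<cdot> y = y" "y \<cdot> f = y" "x \<cdot> y = f" "y \<cdot> x = f"
    using unitsD(4)[OF x] by blast
  have "y \<in> units f" unfolding units_def mem_Collect_eq
    by (intro conjI bexI[of _ x]) (use y unitsD[OF x] in simp_all)
  then show "\<exists>y\<in>carrier \<lparr>carrier = units f, monoid.mult = sg_mult F, one = f\<rparr>.
      y \<otimes>\<^bsub>\<lparr>carrier = units f, monoid.mult = sg_mult F, one = f\<rparr>\<^esub> x =
      \<one>\<^bsub>\<lparr>carrier = units f, monoid.mult = sg_mult F, one = f\<rparr>\<^esub>" using y by auto
qed (use units_mult[OF f(1)] unitsD F_assoc in simp_all)

lemma subgroup_units:
  assumes H: "H \<subseteq> carrier F" and G: "is_group (restrict_sgrp F H)"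
  shows "\<exists>f\<in>H. f \<cdot> f = f \<and> H \<subseteq> units f"
proof -
  obtain f where g: "group \<lparr>carrier = H, monoid.mult = sg_mult F, one = f\<rparr>"
    using G by (auto simp: is_group_def restrict_sgrp_def)
  interpret group "\<lparr>carrier = H, monoid.mult = sg_mult F, one = f\<rparr>" by (rule g)
  have f: "f \<in> H" using one_closed by simp
  have l: "f \<cdot> x = x" "x \<cdot> f = x" if "x \<in> H" for x using that l_one[of x] r_one[of x] by simp_all
  have "x \<in> units f" if x: "x \<in> H" for x
  proof -
    obtain y where "y \<in> H" "y \<cdot> x = f" "x \<cdot> y = f"
      using x inv_closed[of x] l_inv[of x] r_inv[of x] by auto
    then show ?thesis
      unfolding units_def mem_Collect_eq
      by (intro conjI bexI[of _ y]) (use l x H in auto)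
  qed
  then show ?thesis using f l by blast
qed

lemma maximal_subgroup_units:
  assumes "H \<in> maximal_subgroups F"
  shows "\<exists>f\<in>carrier F. f \<cdot> f = f \<and> f \<in> H \<and> H = units f"
proof -
  have H: "H \<subseteq> carrier F" "is_group (restrict_sgrp F H)"
    and max: "\<And>K. K \<subseteq> carrier F \<Longrightarrow> is_group (restrict_sgrp F K) \<Longrightarrow> H \<subseteq> K \<Longrightarrow> K = H"
    using assms unfolding maximal_subgroups_def by blast+
  obtain f where f: "f \<in> H" "f \<cdot> f = f" "H \<subseteq> units f" using subgroup_units[OF H] by blast
  have "f \<in> carrier F" using f(1) H(1) by blast
  from units_group[OF this f(2)] have "is_group (restrict_sgrp F (units f))"
    by (auto simp: is_group_def restrict_sgrp_def)
  then have "units f = H" using max[of "units f"] f(3) unitsD(1) by blast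
  then show ?thesis using f H by blast
qed

text \<open>Each coordinate has a local inverse by \<open>local_unit\<close>. Inverses are unique,
  so they are automatically compatible with the transition maps.\<close>

lemma unit_from_coordinates:
  assumes f: "f \<in> carrier F" "f \<cdot> f = f" and x: "x \<in> carrier F" "f \<cdot> x = x" "x \<cdot> f = x"
    and j: "\<And>i. i \<in> GM \<Longrightarrow> \<exists>c\<in>carrier (fst i). \<exists>d\<in>carrier (fst i).
      f i = sg_mult (fst i) (sg_mult (fst i) c (x i)) d"
  shows "x \<in> units f"
proof -
  define R where "R i y \<longleftrightarrow> y \<in> carrier (fst i) \<and> sg_mult (fst i) (f i) y = y \<and> sg_mult (fst i) y (f i) = y \<and>
     sg_mult (fst i) y (x i) = f i \<and> sg_mult (fst i) (x i) y = f i" for i y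
  have fi: "sg_mult (fst i) (f i) (f i) = f i" "sg_mult (fst i) (f i) (x i) = x i" "sg_mult (fst i) (x i) (f i) = x i"
    if "i \<in> GM" for i
    using fun_cong[OF f(2), of i] fun_cong[OF x(2), of i] fun_cong[OF x(3), of i] that by simp_all
  have ex: "\<exists>y. R i y" if i: "i \<in> GM" for i
  proof -
    interpret S: finite_sgrp "fst i" using i by (rule GM_finite_sgrp)
    obtain c d where "c \<in> carrier (fst i)" "d \<in> carrier (fst i)" "f i = S.mult (S.mult c (x i)) d"
      using j[OF i] by blast
    from S.local_unit[OF this(1,2) F_at[OF f(1) i] F_at[OF x(1) i] fi(2,3,1)[OF i] this(3)]
    show ?thesis unfolding R_def by blast
  qed
  have unique: "y = z" if i: "i \<in> GM" and "R i y" "R i z" for i y z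
  proof -
    interpret S: finite_sgrp "fst i" using i by (rule GM_finite_sgrp)
    have "y = S.mult y (S.mult (x i) z)" using that by (simp add: R_def)
    also have "\<dots> = S.mult (S.mult y (x i)) z"       by (rule S.assoc[symmetric]) (use that F_at[OF x(1) i] in \<open>simp_all add: R_def\<close>)
    also have "\<dots> = z" using that by (simp add: R_def)
    finally show ?thesis .
  qed
  define y where "y = (\<lambda>i\<in>GM. SOME y. R i y)"
  have y: "R i (y i)" if "i \<in> GM" for i
    using someI_ex[OF ex[OF that]] that by (simp add: y_def)
  have yF: "y \<in> carrier F"
    unfolding F_iff
  proof (intro conjI ballI impI)
    show "y \<in> (\<Pi>\<^sub>E i\<in>GM. carrier (fst i))"
      using y by (simp add: PiE_iff R_def) (simp add: y_def)
    fix i j assume ij: "i \<in> GM" "j \<in> GM" "gen_le A i j"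
    have h: "gen_trans A i j \<in> carrier (fst j) \<rightarrow> carrier (fst i)"
      "\<And>a b. a \<in> carrier (fst j) \<Longrightarrow> b \<in> carrier (fst j) \<Longrightarrow>
        sg_mult (fst i) (gen_trans A i j a) (gen_trans A i j b) = gen_trans A i j (sg_mult (fst j) a b)"
      using gen_trans_hom[OF ij(3)] by (auto simp: sg_hom_def)
    have yj: "R j (y j)" using y ij by blast
    have yc: "y j \<in> carrier (fst j)" using yj by (simp add: R_def)
    have "R i (gen_trans A i j (y j))"
      unfolding R_def F_trans[OF f(1) ij, symmetric] F_trans[OF x(1) ij, symmetric]
      using h(1) h(2)[OF yc F_at[OF f(1) ij(2)]] h(2)[OF F_at[OF f(1) ij(2)] yc]
        h(2)[OF yc F_at[OF x(1) ij(2)]] h(2)[OF F_at[OF x(1) ij(2)] yc] yj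
      by (auto simp: R_def)
    then show "gen_trans A i j (y j) = y i" using unique[OF ij(1)] y[OF ij(1)] by blast
  qed
  have "f \<cdot> y = y" "y \<cdot> f = y" "x \<cdot> y = f" "y \<cdot> x = f"
    using y by (auto intro!: F_eqI F_mult_closed yF f x simp: R_def)
  then show ?thesis using yF x unfolding units_def by blast
qed

text \<open>The factors \<open>c\<close> and \<open>d\<close> are not unique, so compatible pairs
  are found by compactness.\<close>

lemma ideal_from_coordinates:
  assumes x: "x \<in> carrier F" and y: "y \<in> carrier F"
    and j: "\<And>i. i \<in> GM \<Longrightarrow> \<exists>c\<in>carrier (fst i). \<exists>d\<in>carrier (fst i).
      y i = sg_mult (fst i) (sg_mult (fst i) c (x i)) d"
  shows "\<exists>c\<in>carrier F. \<exists>d\<in>carrier F. y = c \<cdot> x \<cdot> d"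
proof -
  define D where "D i = {t \<in> (\<Pi>\<^sub>E k\<in>{0::nat, 1}. carrier (fst i)).
    y i = sg_mult (fst i) (sg_mult (fst i) (t 0) (x i)) (t 1)}" for i :: "'a gen_sgrp"
  have "\<exists>z. (\<forall>k\<in>{0, 1}. z k \<in> carrier F) \<and> (\<forall>i\<in>GM. (\<lambda>k\<in>{0, 1}. z k i) \<in> D i)"
  proof (rule compact_choice)
    fix i assume i: "i \<in> GM"
    show "D i \<subseteq> (\<Pi>\<^sub>E k\<in>{0::nat, 1}. carrier (fst i))" by (auto simp: D_def)
    obtain c d where "c \<in> carrier (fst i)" "d \<in> carrier (fst i)"
      "y i = sg_mult (fst i) (sg_mult (fst i) c (x i)) d" using j[OF i] by blast
    then have "(\<lambda>k\<in>{0, 1}. if k = 0 then c else d) \<in> D i" by (auto simp: D_def)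
    then show "D i \<noteq> {}" by (metis empty_iff)
  next
    fix i j t assume ij: "i \<in> GM" "j \<in> GM" "gen_le A i j" and t: "t \<in> D j"
    have tP: "t \<in> (\<Pi>\<^sub>E k\<in>{0::nat, 1}. carrier (fst j))"
      and yt: "y j = sg_mult (fst j) (sg_mult (fst j) (t 0) (x j)) (t 1)"
      using t by (simp_all only: D_def mem_Collect_eq)
    have tc: "t 0 \<in> carrier (fst j)" "t 1 \<in> carrier (fst j)"
      using PiE_mem[OF tP, of 0] PiE_mem[OF tP, of 1] by simp_all
    have h: "gen_trans A i j \<in> carrier (fst j) \<rightarrow> carrier (fst i)"
      "\<And>a b. a \<in> carrier (fst j) \<Longrightarrow> b \<in> carrier (fst j) \<Longrightarrow>
        gen_trans A i j (sg_mult (fst j) a b) = sg_mult (fst i) (gen_trans A i j a) (gen_trans A i j b)"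
      using gen_trans_hom[OF ij(3)] by (auto simp: sg_hom_def)
    have xc: "x j \<in> carrier (fst j)" using F_at[OF x ij(2)] .
    have "sg_mult (fst j) (t 0) (x j) \<in> carrier (fst j)"
      using is_semigroupD(2)[OF GM_D(2)[OF ij(2)] tc(1) xc] .
    then have "y i = sg_mult (fst i) (sg_mult (fst i) (gen_trans A i j (t 0)) (x i)) (gen_trans A i j (t 1))"
      using arg_cong[OF yt, of "gen_trans A i j"] F_trans[OF y ij] F_trans[OF x ij] h(2) tc xc by simp
    then show "(\<lambda>k\<in>{0, 1}. gen_trans A i j (t k)) \<in> D i" using h(1) tc by (auto simp: D_def)
  qed simp
  then obtain z where z: "z 0 \<in> carrier F" "z 1 \<in> carrier F"
    "\<And>i. i \<in> GM \<Longrightarrow> (\<lambda>k\<in>{0::nat, 1}. z k i) \<in> D i" by auto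
  have "y = z 0 \<cdot> x \<cdot> z 1"
  proof (rule F_eqI)
    show "y i = (z 0 \<cdot> x \<cdot> z 1) i" if "i \<in> GM" for i using z(3)[OF that] that by (simp add: D_def)
  qed (use z x y in auto)
  then show ?thesis using z(1,2) by blast
qed

lemma principal_ideal_subset:
  assumes x: "x \<in> carrier F" and c: "c \<in> carrier F" and d: "d \<in> carrier F"
  shows "principal_ideal F (c \<cdot> x \<cdot> d) \<subseteq> principal_ideal F x"
proof
  fix y assume "y \<in> principal_ideal F (c \<cdot> x \<cdot> d)"
  then consider "y = c \<cdot> x \<cdot> d" | s where "s \<in> carrier F" "y = s \<cdot> (c \<cdot> x \<cdot> d)"
    | t where "t \<in> carrier F" "y = c \<cdot> x \<cdot> d \<cdot> t"
    | s t where "s \<in> carrier F" "t \<in> carrier F" "y = s \<cdot> (c \<cdot> x \<cdot> d) \<cdot> t"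
    unfolding principal_ideal_def by blast
  then have "\<exists>s\<in>carrier F. \<exists>t\<in>carrier F. y = s \<cdot> x \<cdot> t"
  proof cases
    case 1 then show ?thesis using c d by blast
  next
    case (2 s)
    then have "y = (s \<cdot> c) \<cdot> x \<cdot> d" using x c d F_mult_closed by (simp add: F_assoc)
    then show ?thesis using 2 c d F_mult_closed by blast
  next
    case (3 t)
    then have "y = c \<cdot> x \<cdot> (d \<cdot> t)" using x c d F_mult_closed by (simp add: F_assoc)
    then show ?thesis using 3 c d F_mult_closed by blast
  next
    case (4 s t)
    then have "y = (s \<cdot> c) \<cdot> x \<cdot> (d \<cdot> t)" using x c d F_mult_closed by (simp add: F_assoc)
    then show ?thesis using 4 c d F_mult_closed by blast
  qed
  then show "y \<in> principal_ideal F x" unfolding principal_ideal_def by blast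
qed

text \<open>A principal ideal also allows absent multipliers; \<open>e\<close>, being idempotent,
  can stand in for them.\<close>

lemma idempotent_in_ideal:
  assumes e: "e \<in> carrier F" "e \<cdot> e = e" and x: "x \<in> carrier F" and m: "e \<in> principal_ideal F x"
  shows "\<exists>c\<in>carrier F. \<exists>d\<in>carrier F. e = c \<cdot> x \<cdot> d"
proof -
  consider "e = x" | s where "s \<in> carrier F" "e = s \<cdot> x" | t where "t \<in> carrier F" "e = x \<cdot> t"
    | s t where "s \<in> carrier F" "t \<in> carrier F" "e = s \<cdot> x \<cdot> t"
    using m unfolding principal_ideal_def by blast
  then show ?thesis
  proof cases
    case 1 then show ?thesis using e by metis
  next
    case (2 s) then show ?thesis using e by metis
  next
    case (3 t)
    then have "e = e \<cdot> x \<cdot> t" using e F_assoc[OF e(1) x 3(1)] by simp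
    then show ?thesis using e 3 by blast
  next
    case 4 then show ?thesis by blast
  qed
qed

text \<open>From \<open>e = a f b\<close>, the elements \<open>p = f b e\<close> and
  \<open>q = e a f\<close> satisfy \<open>q p = e\<close>. Then \<open>p q\<close> is an idempotent
  below \<open>f\<close> and J-equivalent to it, so it equals \<open>f\<close> in every finite
  coordinate.\<close>

lemma J_conjugate:
  assumes e: "e \<in> carrier F" "e \<cdot> e = e" and f: "f \<in> carrier F" "f \<cdot> f = f"
    and J: "principal_ideal F e = principal_ideal F f"
  shows "\<exists>p\<in>carrier F. \<exists>q\<in>carrier F. p \<cdot> q = f \<and> q \<cdot> p = e \<and> f \<cdot> p = p \<and> p \<cdot> e = p \<and> e \<cdot> q = q \<and> q \<cdot> f = q"
proof -
  have "e \<in> principal_ideal F f" unfolding J[symmetric] by (simp add: principal_ideal_def)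
  from idempotent_in_ideal[OF e f(1) this]
  obtain a b where ab: "a \<in> carrier F" "b \<in> carrier F" "e = a \<cdot> f \<cdot> b" by blast
  have "f \<in> principal_ideal F e" unfolding J by (simp add: principal_ideal_def)
  from idempotent_in_ideal[OF f e(1) this]
  obtain c d where cd: "c \<in> carrier F" "d \<in> carrier F" "f = c \<cdot> e \<cdot> d" by blast
  define p where "p = f \<cdot> (b \<cdot> e)"
  define q where "q = e \<cdot> (a \<cdot> f)"
  have be: "b \<cdot> e \<in> carrier F" and af: "a \<cdot> f \<in> carrier F"
    using ab e f F_mult_closed by simp_all
  have pF: "p \<in> carrier F" "q \<in> carrier F" using be af e f F_mult_closed by (simp_all add: p_def q_def)
  have "f \<cdot> p = p" "e \<cdot> q = q"
    unfolding p_def q_def using F_mult_rewrite[OF f(1) f(1) be f(2)] F_mult_rewrite[OF e(1) e(1) af e(2)] by simp_all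
  moreover have "p \<cdot> e = p" "q \<cdot> f = q"
    unfolding p_def q_def F_assoc[OF f(1) be e(1)] F_assoc[OF ab(2) e(1) e(1)]
      F_assoc[OF e(1) af f(1)] F_assoc[OF ab(1) f(1) f(1)] e(2) f(2) by simp_all
  ultimately have fp: "f \<cdot> p = p" "p \<cdot> e = p" "e \<cdot> q = q" "q \<cdot> f = q" by simp_all
  have "q \<cdot> p = e \<cdot> (a \<cdot> (f \<cdot> (f \<cdot> (b \<cdot> e))))"
    unfolding p_def q_def using e f ab F_mult_closed by (simp add: F_assoc)
  also have "f \<cdot> (f \<cdot> (b \<cdot> e)) = f \<cdot> (b \<cdot> e)" using F_mult_rewrite[OF f(1) f(1) be f(2)] .
  also have "a \<cdot> (f \<cdot> (b \<cdot> e)) = (a \<cdot> f \<cdot> b) \<cdot> e" using e f ab F_mult_closed by (simp add: F_assoc)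
  also have "\<dots> = e" unfolding ab(3)[symmetric] by (rule e(2))
  also have "e \<cdot> e = e" by (rule e(2))
  finally have qp: "q \<cdot> p = e" .
  define k where "k = p \<cdot> q"
  have kF: "k \<in> carrier F" using pF F_mult_closed by (simp add: k_def)
  have fk: "f \<cdot> k = k" "k \<cdot> f = k"
    unfolding k_def using F_assoc[OF f(1) pF] F_assoc[OF pF f(1)] fp by simp_all
  have qpq: "q \<cdot> (p \<cdot> q) = q" using F_assoc[OF pF(2,1,2)] qp fp by simp
  have kk: "k \<cdot> k = k"
    unfolding k_def using F_assoc[OF pF F_mult_closed[OF pF]] qpq by simp
  have "f = (c \<cdot> q) \<cdot> k \<cdot> (p \<cdot> d)"
  proof -
    have "q \<cdot> (p \<cdot> (q \<cdot> (p \<cdot> d))) = e \<cdot> d"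
      using F_mult_rewrite[OF pF(2,1) _ qp] pF cd e F_mult_closed F_mult_rewrite[OF e(1) e(1) cd(2) e(2)] by simp
    then show ?thesis using cd pF e F_mult_closed by (simp add: k_def F_assoc)
  qed
  note fck = this
  have "k = f"
  proof (rule F_eqI[OF kF f(1)])
    fix i assume i: "i \<in> GM"
    interpret S: finite_sgrp "fst i" using i by (rule GM_finite_sgrp)
    have at: "(c \<cdot> q) i \<in> carrier (fst i)" "(p \<cdot> d) i \<in> carrier (fst i)" "f i \<in> carrier (fst i)" "k i \<in> carrier (fst i)"
      using F_at[OF F_mult_closed[OF cd(1) pF(2)] i] F_at[OF F_mult_closed[OF pF(1) cd(2)] i]
        F_at[OF f(1) i] F_at[OF kF i] .
    show "k i = f i"
      by (rule S.idempotent_below_eq[OF at])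
        (use fun_cong[OF fk(1), of i] fun_cong[OF fk(2), of i] fun_cong[OF f(2), of i] fun_cong[OF kk, of i]
          fun_cong[OF fck, of i] i in simp_all)
  qed
  then have "p \<cdot> q = f" by (simp add: k_def)
  then show ?thesis using pF qp fp by blast
qed

end

lemma language_seg: "language X = {seg x i l | x i l. x \<in> X \<and> 0 < l}"
proof -
  have map_upto: "map x [i..j] = seg x i (nat (j - i + 1))" for x :: "int \<Rightarrow> 'a" and i j
    by (rule nth_equalityI) (auto simp: seg_nth)
  show ?thesis
  proof
    show "language X \<subseteq> {seg x i l | x i l. x \<in> X \<and> 0 < l}"
    proof
      fix w assume "w \<in> language X"
      then obtain x i j where x: "x \<in> X" "i \<le> j" "w = map x [i..j]" unfolding language_def by blast
      then have "w = seg x i (nat (j - i + 1))" "0 < nat (j - i + 1)" by (simp_all add: map_upto)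
      then show "w \<in> {seg x i l | x i l. x \<in> X \<and> 0 < l}" using x(1) by blast
    qed
    show "{seg x i l | x i l. x \<in> X \<and> 0 < l} \<subseteq> language X"
    proof
      fix w assume "w \<in> {seg x i l | x i l. x \<in> X \<and> 0 < l}"
      then obtain x i l where x: "x \<in> X" "0 < l" "w = seg x i l" by blast
      then have "w = map x [i..i + int l - 1]" "i \<le> i + int l - 1" by (simp_all add: map_upto)
      then show "w \<in> language X" using x(1) unfolding language_def by blast
    qed
  qed
qed

text \<open>Repetitions are allowed, so that the return words of all neighbourhoods become tuples of
  the same length, of which limits can be taken.\<close>

lemma finite_enumeration:
  assumes "finite R" "R \<noteq> {}" "card R \<le> n"
  shows "\<exists>w. w ` {..<n::nat} = R"
proof -
  obtain g where g: "bij_betw g {0..<card R} R" using ex_bij_betw_nat_finite[OF assms(1)] by blast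
  have pos: "0 < card R" using assms(1,2) by (simp add: card_gt_0_iff)
  define w where "w k = g (if k < card R then k else 0)" for k
  have gi: "g ` {0..<card R} = R" using g by (simp add: bij_betw_def)
  have "w ` {..<n} = R"
  proof
    show "w ` {..<n} \<subseteq> R" using gi pos by (auto simp: w_def)
    show "R \<subseteq> w ` {..<n}"
    proof
      fix x assume "x \<in> R"
      then have "x \<in> g ` {0..<card R}" using gi by simp
      then obtain k where "k < card R" "x = g k" by auto
      then show "x \<in> w ` {..<n}" using assms(3) by (intro image_eqI[of _ _ k]) (auto simp: w_def)
    qed
  qed
  then show ?thesis by blast
qed

section \<open>Generators of the unit group at e, and its J-class\<close>

context schutzenberger_idempotent
begin

lemma ee: "e \<cdot> e = e"
  by (rule F_eqI) (use eF e_idem F_mult_closed in auto)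

definition is_base :: "nat \<Rightarrow> (int \<Rightarrow> 'a) set \<Rightarrow> bool" where
  "is_base r B \<longleftrightarrow> B \<subseteq> X \<and> xs \<in> B \<and> (\<forall>x\<in>B. agree r x xs) \<and>
     (\<exists>q. \<forall>x\<in>X. \<forall>y\<in>X. agree q x y \<longrightarrow> x \<in> B \<longrightarrow> y \<in> B) \<and> finite (returns B) \<and> card (returns B) \<le> n"

lemma base_exists: "\<exists>B. is_base r B"
  unfolding is_base_def by (rule bases)

lemma returns_nonempty:
  assumes "is_base r B" shows "returns B \<noteq> {}"
proof -
  obtain q where q: "\<And>x y. x \<in> X \<Longrightarrow> y \<in> X \<Longrightarrow> agree q x y \<Longrightarrow> x \<in> B \<Longrightarrow> y \<in> B"
    and xsB: "xs \<in> B" using assms unfolding is_base_def by blast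
  obtain k where k: "0 < k" "agree q (sh (int k) xs) xs" using prefix_returns by blast
  then have "sh (int k) xs \<in> B" using q[OF xsX shX[OF xsX] agree_sym] xsB by blast
  then have kB: "0 < k \<and> sh (int k) xs \<in> B" using k(1) by simp
  define l where "l = (LEAST l. 0 < l \<and> sh (int l) xs \<in> B)"
  have "0 < l \<and> sh (int l) xs \<in> B" unfolding l_def using kB by (rule LeastI)
  moreover have "sh (int j) xs \<notin> B" if "0 < j" "j < l" for j
    using not_less_Least[of j "\<lambda>l. 0 < l \<and> sh (int l) xs \<in> B"] that by (simp add: l_def)
  ultimately have "seg xs 0 l \<in> returns B" unfolding returns_def using xsB by blast
  then show ?thesis by blast
qed

lemma returnsE:
  assumes "u \<in> returns B" "is_base r B"
  obtains x l where "x \<in> X" "0 < l" "u = seg x 0 l" "agree r x xs" "agree r (sh (int l) x) xs"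
proof -
  obtain x l where "u = seg x 0 l" "x \<in> B" "0 < l" "sh (int l) x \<in> B"
    using assms(1) unfolding returns_def by blast
  moreover have "B \<subseteq> X" "\<forall>x\<in>B. agree r x xs" using assms(2) by (simp_all add: is_base_def)
  ultimately show thesis using that[of x l] by auto
qed

text \<open>Invertibility of \<open>x\<close> brings in the language: multiplied by an inverse, a
  word for \<open>x\<close> gets the value of \<open>e\<close>, which is also the value of a prefix
  \<open>E\<close> of \<open>xs\<close>. A coordinate fine enough to recognise factors then places
  all its short factors in the language, and \<open>parse_returns\<close> applies.\<close>

lemma unit_word:
  assumes x: "x \<in> units e" and i: "i \<in> GM" and B: "is_base r B"
  shows "\<exists>us. us \<noteq> [] \<and> set us \<subseteq> returns B \<and> x i = ev i (concat us)"
proof -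
  note xu = unitsD[OF x]
  obtain q where q: "\<forall>x\<in>X. \<forall>y\<in>X. agree q x y \<longrightarrow> x \<in> B \<longrightarrow> y \<in> B"
    and BX: "B \<subseteq> X" and xsB: "xs \<in> B" using B unfolding is_base_def by blast
  obtain N where N: "\<And>z x y. \<lbrakk>2 * q + 1 < length z; factors N z \<subseteq> lang; x \<in> B; y \<in> B;
      take (2 * q + 1) z = seg x (- int q) (2 * q + 1);
      drop (length z - (2 * q + 1)) z = seg y (- int q) (2 * q + 1)\<rbrakk> \<Longrightarrow>
      \<exists>us. us \<noteq> [] \<and> set us \<subseteq> returns B \<and> concat us = take (length z - (2 * q + 1)) (drop q z)"
    using parse_returns[OF BX xsB q] by meson
  obtain k where k: "k \<in> GM" "\<And>u v. u \<in> words A \<Longrightarrow> v \<in> words A \<Longrightarrow> ev k u = ev k v \<Longrightarrow> factors N u = factors N v"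
    using factors_recognised[of N] by meson
  obtain j where j: "j \<in> GM" "gen_le A i j" "gen_le A k j" using directed[OF i k(1)] by blast
  obtain x' where x': "x' \<in> carrier F" "x \<cdot> x' = e" "e \<cdot> x' = x'" using xu(4) by blast
  obtain y where y: "y \<in> words A" "x j = ev j y" using F_word[OF xu(1) j(1)] by blast
  obtain y' where y': "y' \<in> words A" "x' j = ev j y'" using F_word[OF x'(1) j(1)] by blast
  \<comment> \<open>These bounds make \<open>E\<close> begin with \<open>q + 1\<close> letters of
    \<open>xs\<close> right of the origin and end with the \<open>q\<close> letters left of
    it.\<close>
  obtain L where L: "q + 1 \<le> L" "0 < L" "ev j (seg xs 0 L) = e j" "agree (q + 1) (sh (int L) xs) xs"
    using e_prefix[OF j(1)] by metis
  define E where "E = seg xs 0 L"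
  have Ew: "E \<in> words A" unfolding E_def using xsX L(2) by blast
  have Ej: "ev j E = e j" using L(3) by (simp add: E_def)
  interpret S: finite_sgrp "fst j" using j(1) by (rule GM_finite_sgrp)
  have at: "S.mult (e j) (x j) = x j" "S.mult (x j) (e j) = x j" "S.mult (x j) (x' j) = e j" "S.mult (e j) (e j) = e j"
    "S.mult (e j) (x' j) = x' j"
    using fun_cong[OF x'(3), of j] fun_cong[OF xu(2), of j] fun_cong[OF xu(3), of j] fun_cong[OF x'(2), of j] e_idem[OF j(1)] j(1)
    by simp_all
  \<comment> \<open>Surrounding \<open>y\<close> by \<open>E\<close> keeps the value, since
    \<open>e\<close> fixes \<open>x\<close> on both sides, and puts copies of \<open>xs\<close> at
    both ends.\<close>
  define w where "w = E @ y @ E"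
  have ww: "w \<in> words A" unfolding w_def using Ew y(1) by blast
  have wj: "ev j w = x j"
    unfolding w_def using Ew y at j(1) by (simp add: ev_append words_append Ej flip: y(2))
  have xi: "x i = ev i w" by (rule F_lift[OF xu(1) i j(1,2) ww wj[symmetric]])
  have "ev j (E @ w @ E @ y') = e j"
    using Ew ww y' at j(1) wj by (simp add: ev_append words_append Ej flip: y'(2))
  then have "ev j (E @ w @ E @ y') = ev j E" by (simp add: Ej)
  then have "ev k (E @ w @ E @ y') = ev k E"
    using ev_trans[OF j(1,3)] Ew ww y'(1) words_append by metis
  then have "factors N (E @ w @ E @ y') = factors N E"
    using k(2)[of "E @ w @ E @ y'" E] Ew ww y'(1) by (simp add: words_append)
  moreover have "factors N E \<subseteq> lang"
  proof (rule lang_factors)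
    show "E \<in> lang" unfolding lang_def E_def using xsX by blast
  qed
  moreover have "factors N (E @ w @ E) \<subseteq> factors N (E @ w @ E @ y')"
    using factors_mono[of N "E @ w @ E" "[]" y'] by simp
  ultimately have fac: "factors N (E @ w @ E) \<subseteq> lang" by blast
  have "seg xs (int (L - q)) q = seg (sh (int L) xs) (- int q) q" using L(1) by (simp add: seg_sh)
  also have "\<dots> = seg xs (- int q) q" by (rule agree_seg[OF L(4)]) auto
  finally have E1: "E = seg xs 0 (L - q) @ seg xs (- int q) q"
    unfolding E_def using seg_add[of xs 0 "L - q" q] L(1) by simp
  have E2: "E = seg xs 0 (q + 1) @ seg xs (int q + 1) (L - q - 1)"
    unfolding E_def using seg_add[of xs 0 "q + 1" "L - q - 1"] L(1) by (simp add: add.commute)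
  \<comment> \<open>Margins \<open>q\<close> and \<open>q + 1\<close> complete both ends to the
    central window of \<open>xs\<close>; what \<open>parse_returns\<close> cuts is then exactly
    \<open>w\<close>.\<close>
  define z where "z = seg xs (- int q) q @ w @ seg xs 0 (q + 1)"
  have lz: "length z = 2 * q + 1 + length w" by (simp add: z_def)
  have "E @ w @ E = seg xs 0 (L - q) @ z @ seg xs (int q + 1) (L - q - 1)"
    by (subst E1, subst E2) (simp add: z_def)
  then have "factors N z \<subseteq> factors N (E @ w @ E)" by (simp add: factors_mono)
  then have facz: "factors N z \<subseteq> lang" using fac by (rule subset_trans)
  have half: "seg xs (- int q) q @ seg xs 0 (q + 1) = seg xs (- int q) (2 * q + 1)"
    using seg_add[of xs "- int q" q "q + 1"] by (simp add: mult_2)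
  have "take (2 * q + 1) z = seg xs (- int q) (2 * q + 1)"
  proof -
    have "z = (seg xs (- int q) q @ seg xs 0 (q + 1)) @ seg xs (int q + 1) (L - q - 1) @ y @ E @ seg xs 0 (q + 1)"
      unfolding z_def w_def by (subst E2) simp
    then show ?thesis unfolding half by simp
  qed
  moreover have "drop (length z - (2 * q + 1)) z = seg xs (- int q) (2 * q + 1)"
  proof -
    have "z = (seg xs (- int q) q @ E @ y @ seg xs 0 (L - q)) @ seg xs (- int q) q @ seg xs 0 (q + 1)"
      unfolding z_def w_def by (subst (2) E1) simp
    moreover have "length (seg xs (- int q) q @ E @ y @ seg xs 0 (L - q)) = length z - (2 * q + 1)"
      using lz L(1) by (simp add: w_def E_def)
    ultimately show ?thesis unfolding half by (metis append_eq_conv_conj)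
  qed
  moreover have "2 * q + 1 < length z" using ww lz by (simp add: words_def)
  ultimately obtain us where us: "us \<noteq> []" "set us \<subseteq> returns B"
    "concat us = take (length z - (2 * q + 1)) (drop q z)"
    using N[OF _ facz xsB xsB] by blast
  have "take (length z - (2 * q + 1)) (drop q z) = w" using lz by (simp add: z_def)
  then show ?thesis using us xi by auto
qed

text \<open>The limit tuple \<open>g\<close> is fixed once. At any coordinate it coincides with the
  tuple of return words of a neighbourhood small enough for \<open>e_commute\<close> there, and
  \<open>unit_word\<close> writes every unit with these very words.\<close>

lemma units_generators:
  "\<exists>h. (\<forall>k<n. h k \<in> units e) \<and> (\<forall>x\<in>units e. \<forall>i\<in>GM. \<exists>y\<in>sg_generate F (h ` {..<n}). y i = x i)"
proof -
  have "\<forall>r. \<exists>B. is_base r B" using base_exists by blast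
  then obtain B where B: "\<And>r. is_base r (B r)" by metis
  have "\<exists>w. w ` {..<n} = returns (B r)" for r
    using B[of r] by (intro finite_enumeration returns_nonempty[OF B]) (simp_all add: is_base_def)
  then have "\<forall>r. \<exists>w. w ` {..<n} = returns (B r)" ..
  then obtain w where w: "\<And>r. w r ` {..<n} = returns (B r)" by metis
  have ww: "u \<in> words A" if "u \<in> returns (B r)" for r u
    using returnsE[OF that B] seg_words by metis
  have wk: "w r k \<in> words A" if "k < n" for r k using ww w that by blast
  \<comment> \<open>Tuples of values that recur for arbitrarily large \<open>r\<close>; pigeonhole
    makes this set nonempty.\<close>
  define D where "D i = {t \<in> (\<Pi>\<^sub>E k\<in>{..<n}. carrier (fst i)). \<forall>N. \<exists>r\<ge>N. \<forall>k<n. t k = ev i (w r k)}"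
    for i :: "'a gen_sgrp"
  have "\<exists>g. (\<forall>k\<in>{..<n}. g k \<in> carrier F) \<and> (\<forall>i\<in>GM. (\<lambda>k\<in>{..<n}. g k i) \<in> D i)"
  proof (rule compact_choice)
    fix i assume i: "i \<in> GM"
    show "D i \<subseteq> (\<Pi>\<^sub>E k\<in>{..<n}. carrier (fst i))" by (auto simp: D_def)
    have "\<exists>t\<in>(\<Pi>\<^sub>E k\<in>{..<n}. carrier (fst i)). \<forall>N. \<exists>r\<ge>N. \<forall>k<n. t k = ev i (w r k)"
    proof (rule finite_limit)
      show "finite (\<Pi>\<^sub>E k\<in>{..<n}. carrier (fst i))" using GM_D(3)[OF i] by (intro finite_PiE) auto
      show "\<exists>t\<in>(\<Pi>\<^sub>E k\<in>{..<n}. carrier (fst i)). \<exists>r\<ge>N. \<forall>k<n. t k = ev i (w r k)" for N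
        by (rule bexI[of _ "\<lambda>k\<in>{..<n}. ev i (w N k)"], rule exI[of _ N])
          (use wk i in auto)
      show "\<exists>r\<ge>N. \<forall>k<n. t k = ev i (w r k)"
        if "\<exists>r\<ge>N'. \<forall>k<n. t k = ev i (w r k)" "N \<le> N'" for N N' t
        using that le_trans by metis
    qed
    then show "D i \<noteq> {}" unfolding D_def by blast
  next
    fix i j t assume ij: "i \<in> GM" "j \<in> GM" "gen_le A i j" and t: "t \<in> D j"
    have tP: "t \<in> (\<Pi>\<^sub>E k\<in>{..<n}. carrier (fst j))" and tN: "\<And>N. \<exists>r\<ge>N. \<forall>k<n. t k = ev j (w r k)"
      using t unfolding D_def by blast+
    have "gen_trans A i j \<in> carrier (fst j) \<rightarrow> carrier (fst i)"
      using gen_trans_hom[OF ij(3)] by (simp add: sg_hom_def)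
    then have "(\<lambda>k\<in>{..<n}. gen_trans A i j (t k)) \<in> (\<Pi>\<^sub>E k\<in>{..<n}. carrier (fst i))"
      using tP by (auto simp: PiE_iff Pi_iff)
    moreover have "\<exists>r\<ge>N. \<forall>k<n. (\<lambda>k\<in>{..<n}. gen_trans A i j (t k)) k = ev i (w r k)" for N
    proof -
      obtain r where r: "N \<le> r" "\<forall>k<n. t k = ev j (w r k)" using tN by blast
      have "(\<lambda>k\<in>{..<n}. gen_trans A i j (t k)) k = ev i (w r k)" if "k < n" for k
        using r(2) ev_trans[OF ij(2,3) wk[OF that]] that by simp
      then show ?thesis using r(1) by blast
    qed
    ultimately show "(\<lambda>k\<in>{..<n}. gen_trans A i j (t k)) \<in> D i" unfolding D_def by blast
  qed simp
  then obtain g where g: "\<And>k. k < n \<Longrightarrow> g k \<in> carrier F" "\<And>i. i \<in> GM \<Longrightarrow> (\<lambda>k\<in>{..<n}. g k i) \<in> D i"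
    by (metis lessThan_iff)
  have gr: "\<exists>r\<ge>N. \<forall>k<n. g k i = ev i (w r k)" if i: "i \<in> GM" for i N
  proof -
    have "\<forall>N. \<exists>r\<ge>N. \<forall>k<n. (\<lambda>k\<in>{..<n}. g k i) k = ev i (w r k)" using g(2)[OF i] unfolding D_def by blast
    then obtain r where "N \<le> r" "\<forall>k<n. (\<lambda>k\<in>{..<n}. g k i) k = ev i (w r k)" by blast
    then show ?thesis by (intro exI[of _ r]) simp
  qed
  \<comment> \<open>The limits \<open>g k\<close> lie outside the local monoid in general;
    sandwiching by \<open>e\<close> moves them into it.\<close>
  define h where "h k = e \<cdot> g k \<cdot> e" for k
  have hF: "h k \<in> carrier F" if "k < n" for k unfolding h_def using g(1)[OF that] eF F_mult_closed by simp
  have local: "\<exists>r. (\<forall>k<n. g k i = ev i (w r k)) \<and> (\<forall>k<n.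
      sg_mult (fst i) (g k i) (e i) = h k i \<and>
      (\<exists>c\<in>carrier (fst i). \<exists>d\<in>carrier (fst i). e i = sg_mult (fst i) (sg_mult (fst i) c (h k i)) d))"
    if i: "i \<in> GM" for i
  proof -
    from e_commute[OF i] obtain r0 where r0: "\<And>x l. \<lbrakk>x \<in> X; 0 < l; agree r0 x xs; agree r0 (sh (int l) x) xs\<rbrakk> \<Longrightarrow>
      sg_mult (fst i) (ev i (seg x 0 l)) (e i) = sg_mult (fst i) (sg_mult (fst i) (e i) (ev i (seg x 0 l))) (e i) \<and>
      (\<exists>c\<in>carrier (fst i). \<exists>d\<in>carrier (fst i). e i =
        sg_mult (fst i) (sg_mult (fst i) c (sg_mult (fst i) (sg_mult (fst i) (e i) (ev i (seg x 0 l))) (e i))) d)"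
      by meson
    obtain r where r: "r0 \<le> r" "\<forall>k<n. g k i = ev i (w r k)" using gr[OF i] by blast
    have "sg_mult (fst i) (g k i) (e i) = h k i \<and>
      (\<exists>c\<in>carrier (fst i). \<exists>d\<in>carrier (fst i). e i = sg_mult (fst i) (sg_mult (fst i) c (h k i)) d)"
      if k: "k < n" for k
    proof -
      have "w r k \<in> returns (B r)" using w k by blast
      then obtain x l where x: "x \<in> X" "0 < l" "w r k = seg x 0 l" "agree r x xs" "agree r (sh (int l) x) xs"
        using returnsE[OF _ B] by metis
      have hk: "h k i = sg_mult (fst i) (sg_mult (fst i) (e i) (ev i (seg x 0 l))) (e i)"
        using i r(2) k x(3) by (simp add: h_def)
      show ?thesis
        using r0[OF x(1,2) agree_mono[OF x(4) r(1)] agree_mono[OF x(5) r(1)]] r(2) k x(3) unfolding hk by simp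
    qed
    then show ?thesis using r(2) by blast
  qed
  have hu: "h k \<in> units e" if k: "k < n" for k
  proof (rule unit_from_coordinates[OF eF ee hF[OF k]])
    have gk: "e \<cdot> g k \<in> carrier F" using F_mult_closed[OF eF g(1)[OF k]] .
    show "e \<cdot> h k = h k"
      unfolding h_def using F_mult_rewrite[OF eF eF g(1)[OF k] ee] F_assoc[OF eF gk eF] by simp
    show "h k \<cdot> e = h k"
      unfolding h_def using F_assoc[OF gk eF eF] ee by simp
    show "\<exists>c\<in>carrier (fst i). \<exists>d\<in>carrier (fst i). e i = sg_mult (fst i) (sg_mult (fst i) c (h k i)) d"
      if "i \<in> GM" for i using local[OF that] k by blast
  qed
  have "\<exists>y\<in>sg_generate F (h ` {..<n}). y i = x i" if x: "x \<in> units e" and i: "i \<in> GM" for x i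
  proof -
    interpret S: finite_sgrp "fst i" using i by (rule GM_finite_sgrp)
    have ec: "e i \<in> carrier (fst i)" using F_at[OF eF i] .
    obtain r where r: "\<And>k. k < n \<Longrightarrow> g k i = ev i (w r k)"
      "\<And>k. k < n \<Longrightarrow> S.mult (g k i) (e i) = h k i" using local[OF i] by blast
    obtain us where us: "us \<noteq> []" "set us \<subseteq> returns (B r)" "x i = ev i (concat us)"
      using unit_word[OF x i B] by blast
    \<comment> \<open>Since \<open>g k e = h k\<close> at \<open>i\<close>, and \<open>e\<close>
      fixes the product built so far, \<open>e\<close> can be inserted between return words:
      \<open>u v e = (u e) (v e)\<close>. The second conjunct carries this through the
      induction.\<close>
    have gen: "\<exists>y\<in>sg_generate F (h ` {..<n}). y i = S.mult (ev i (concat us)) (e i) \<and> S.mult (e i) (y i) = y i"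
      if "us \<noteq> []" "set us \<subseteq> returns (B r)" for us
      using that
    proof (induction us rule: list_nonempty_induct)
      case (single u)
      then obtain k where k: "k < n" "u = w r k" using w[of r] by auto
      have "h k i = S.mult (ev i u) (e i)" using r k by simp
      moreover have "S.mult (e i) (h k i) = h k i"
        using fun_cong[OF unitsD(2)[OF hu[OF k(1)]], of i] i by simp
      ultimately show ?case using k(1) by (intro bexI[of _ "h k"]) (auto intro: sg_generate.base)
    next
      case (cons u us)
      then obtain y where y: "y \<in> sg_generate F (h ` {..<n})" "y i = S.mult (ev i (concat us)) (e i)"
        "S.mult (e i) (y i) = y i" by auto
      obtain k where k: "k < n" "u = w r k" using w[of r] cons.prems by auto
      have uw: "u \<in> words A" "ev i u \<in> carrier (fst i)" using wk[OF k(1)] k(2) i by auto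
      have "concat us \<in> words A"
      proof -
        have "set us \<subseteq> returns (B r)" using cons.prems by simp
        then have "v \<noteq> [] \<and> set v \<subseteq> A" if "v \<in> set us" for v using ww that by (auto simp: words_def)
        then show ?thesis using cons.hyps by (auto simp: words_def)
      qed
      note cw = this
      have cc: "ev i (concat us) \<in> carrier (fst i)" using cw i by blast
      have yc: "y i \<in> carrier (fst i)" using y(2) cc ec by simp
      have hk: "h k i = S.mult (ev i u) (e i)" using r k by simp
      have hc: "h k i \<in> carrier (fst i)" using hk uw ec by simp
      have eh: "S.mult (e i) (h k i) = h k i"
        using fun_cong[OF unitsD(2)[OF hu[OF k(1)]], of i] i by simp
      have "S.mult (h k i) (y i) = S.mult (ev i u) (S.mult (e i) (y i))"
        unfolding hk by (rule S.assoc[OF uw(2) ec yc])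
      also have "\<dots> = S.mult (ev i u) (S.mult (ev i (concat us)) (e i))" unfolding y(3) by (simp only: y(2))
      also have "\<dots> = S.mult (S.mult (ev i u) (ev i (concat us))) (e i)" by (rule S.assoc[OF uw(2) cc ec, symmetric])
      also have "\<dots> = S.mult (ev i (concat (u # us))) (e i)" using ev_append[OF i uw(1) cw] by simp
      finally have 1: "(h k \<cdot> y) i = S.mult (ev i (concat (u # us))) (e i)" using i by simp
      have 2: "S.mult (e i) ((h k \<cdot> y) i) = (h k \<cdot> y) i"
        using S.assoc[OF ec hc yc] eh i by simp
      have "h k \<cdot> y \<in> sg_generate F (h ` {..<n})"
        using k(1) by (intro sg_generate.mult[OF sg_generate.base y(1)]) simp
      then show ?case using 1 2 by blast
    qed
    then obtain y where y: "y \<in> sg_generate F (h ` {..<n})" "y i = S.mult (x i) (e i)"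
      using us by (metis us(3))
    moreover have "S.mult (x i) (e i) = x i" using fun_cong[OF unitsD(3)[OF x], of i] i by simp
    ultimately show ?thesis by auto
  qed
  then show ?thesis using hu by blast
qed

text \<open>\<open>profinite_rank\<close> ranges over positive numbers only.\<close>

lemma n_pos: "0 < n"
proof -
  obtain B where B: "is_base 0 B" using base_exists by blast
  then have "0 < card (returns B)" using returns_nonempty[OF B] unfolding is_base_def by (simp add: card_gt_0_iff)
  then show ?thesis using B unfolding is_base_def by linarith
qed

abbreviation "L \<equiv> word_embed V A ` language X"

lemma L_F: "L \<subseteq> carrier F"
  using seg_words unfolding language_seg by auto

text \<open>Each of the finitely many words of length at most \<open>N\<close> differs from
  \<open>s\<close> in some coordinate. A word that matches \<open>s\<close> at an upper bound of all
  these coordinates must be longer.\<close>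

lemma limit_long:
  assumes s: "s \<in> \<T> closure_of L" "s \<notin> L" and i: "i \<in> GM"
  shows "\<exists>x\<in>X. \<exists>k. \<exists>l\<ge>N. 0 < l \<and> s i = ev i (seg x k l)"
proof (rule ccontr)
  assume no: "\<not> ?thesis"
  have sF: "s \<in> carrier F" and cl: "\<And>i. i \<in> GM \<Longrightarrow> \<exists>y\<in>L. y i = s i"
    using s(1) unfolding closure_F[OF L_F] by blast+
  define W where "W = {w \<in> language X. length w \<le> N}"
  have WA: "W \<subseteq> {w. set w \<subseteq> A \<and> length w \<le> N}"
    unfolding W_def language_seg using seg_words by (auto simp: words_def)
  have finW: "finite W" by (rule finite_subset[OF WA finite_lists_length_le[OF finite_alphabet]])
  have lw: "w \<in> words A" if "w \<in> language X" for w using that seg_words unfolding language_seg by blast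
  have "\<exists>j\<in>GM. ev j w \<noteq> s j" if w: "w \<in> W" for w
  proof (rule ccontr)
    assume "\<not> ?thesis"
    then have "word_embed V A w = s"
      using w lw sF by (intro F_eqI) (auto simp: W_def embed_at)
    then show False using s(2) w by (auto simp: W_def)
  qed
  then have "\<forall>w\<in>W. \<exists>j. j \<in> GM \<and> ev j w \<noteq> s j" by blast
  then obtain J where J: "\<forall>w\<in>W. J w \<in> GM \<and> ev (J w) w \<noteq> s (J w)" unfolding bchoice_iff ..
  have "finite (insert i (J ` W))" "insert i (J ` W) \<subseteq> GM" "insert i (J ` W) \<noteq> {}"
    using finW J i by auto
  from directed_finite[OF this] obtain k where k: "k \<in> GM" "\<And>j. j \<in> insert i (J ` W) \<Longrightarrow> gen_le A j k"
    by blast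
  obtain w where w: "w \<in> language X" "ev k w = s k" using cl[OF k(1)] k(1) by (auto simp: embed_at)
  have le: "ev j w = s j" if "j \<in> GM" "gen_le A j k" for j
    using F_lift[OF sF that(1) k(1) that(2) lw[OF w(1)]] w(2) by simp
  obtain x m l where x: "x \<in> X" "0 < l" "w = seg x m l" using w(1) unfolding language_seg by blast
  have "s i = ev i (seg x m l)" using le[OF i] k(2)[of i] x(3) by simp
  then have "l < N" using no x(1,2) by (meson not_le)
  then have "w \<in> W" using w(1) x(3) by (simp add: W_def)
  then show False using J le[of "J w"] k(2)[of "J w"] by blast
qed

lemma e_limit: "e \<in> (\<T> closure_of L) - L"
proof
  have "\<exists>y\<in>L. y i = e i" if i: "i \<in> GM" for i
  proof -
    obtain l where "0 < l" "ev i (seg xs 0 l) = e i" using e_prefix[OF i] by metis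
    moreover from this have "seg xs 0 l \<in> language X" unfolding language_seg using xsX by blast
    ultimately show ?thesis using i by (intro bexI[of _ "word_embed V A (seg xs 0 l)"]) (auto simp: embed_at)
  qed
  then show "e \<in> \<T> closure_of L" unfolding closure_F[OF L_F] using eF by blast
  show "e \<notin> L"
  proof
    assume "e \<in> L"
    then obtain w where w: "w \<in> words A" "e = word_embed V A w"
      unfolding language_seg using seg_words by blast
    \<comment> \<open>An idempotent word \<open>w\<close> would have the same recorded prefixes as
      its square; the bound \<open>2 * length w\<close> includes the square itself.\<close>
    obtain k where k: "k \<in> GM" "\<And>u v. u \<in> words A \<Longrightarrow> v \<in> words A \<Longrightarrow> ev k u = ev k v \<Longrightarrow>
        prefixes_upto (2 * length w) u = prefixes_upto (2 * length w) v"
      using factors_recognised[of "2 * length w"] by meson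
    have ek: "e k = ev k w" using w(2) embed_at[OF k(1)] by simp
    have "ev k (w @ w) = ev k w" using ev_append[OF k(1) w(1) w(1)] e_idem[OF k(1)] unfolding ek by simp
    then have "prefixes_upto (2 * length w) (w @ w) = prefixes_upto (2 * length w) w"
      using k(2) w(1) words_append by blast
    moreover have "w @ w \<in> prefixes_upto (2 * length w) (w @ w)" by (simp add: prefixes_upto_def)
    ultimately have "w @ w \<in> prefixes_upto (2 * length w) w" by simp
    then show False using w(1) by (auto simp: prefixes_upto_def words_def)
  qed
qed

text \<open>Words that approximate \<open>s\<close> occur inside long prefixes that represent
  \<open>e\<close>; conversely they can be taken so long that they contain such a prefix.\<close>

lemma limit_J:
  assumes s: "s \<in> (\<T> closure_of L) - L"
  shows "principal_ideal F s = principal_ideal F e"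
proof -
  have s': "s \<in> \<T> closure_of L" "s \<notin> L" using s by auto
  have sF: "s \<in> carrier F" using s'(1) unfolding closure_F[OF L_F] by blast
  have "\<exists>c\<in>carrier (fst i). \<exists>d\<in>carrier (fst i). e i = sg_mult (fst i) (sg_mult (fst i) c (s i)) d"
    if i: "i \<in> GM" for i
  proof -
    obtain x k l where "x \<in> X" "0 < l" "s i = ev i (seg x k l)" using limit_long[OF s' i] by blast
    then show ?thesis using e_ideal[OF i] by simp
  qed
  from ideal_from_coordinates[OF sF eF this] obtain c d where
    cd: "c \<in> carrier F" "d \<in> carrier F" "e = c \<cdot> s \<cdot> d" by blast
  have "\<exists>c\<in>carrier (fst i). \<exists>d\<in>carrier (fst i). s i = sg_mult (fst i) (sg_mult (fst i) c (e i)) d"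
    if i: "i \<in> GM" for i
  proof -
    obtain m where m: "0 < m" "ev i (seg xs 0 m) = e i" using e_prefix[OF i] by metis
    obtain M where M: "\<And>y j. y \<in> X \<Longrightarrow> \<exists>k\<le>M. seg y (j + int k) m = seg xs 0 m"
      using recurrence_at[OF xsX] by meson
    obtain x k l where x: "x \<in> X" "M + m + 2 \<le> l" "s i = ev i (seg x k l)"
      using limit_long[OF s' i] by blast
    obtain a where a: "a \<le> M" "seg x (k + 1 + int a) m = seg xs 0 m" using M[OF x(1)] by meson
    define r where "r = l - (1 + a + m)"
    have r: "l = (Suc a + m) + r" "0 < r" using x(2) a(1) by (auto simp: r_def)
    have "s i = sg_mult (fst i) (ev i (seg x k (Suc a + m))) (ev i (seg x (k + int (Suc a + m)) r))"
      using ev_seg_add[OF i x(1), of "Suc a + m" r k] r x(3) by simp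
    also have "ev i (seg x k (Suc a + m)) = sg_mult (fst i) (ev i (seg x k (Suc a))) (e i)"
      using ev_seg_add[OF i x(1), of "Suc a" m k] m a(2) by (simp add: algebra_simps)
    finally show ?thesis using i x(1) r(2) by (metis ev_closed seg_words zero_less_Suc)
  qed
  from ideal_from_coordinates[OF eF sF this] obtain a b where
    ab: "a \<in> carrier F" "b \<in> carrier F" "s = a \<cdot> e \<cdot> b" by blast
  show ?thesis
    using principal_ideal_subset[OF sF cd(1,2), folded cd(3)]
      principal_ideal_subset[OF eF ab(1,2), folded ab(3)] by (rule subset_antisym[rotated])
qed

text \<open>Uniqueness of the class uses that the limit set is nonempty: it contains
  \<open>e\<close> by \<open>e_limit\<close>.\<close>

lemma J_class: "J_class_of V A X = {y \<in> carrier F. principal_ideal F y = principal_ideal F e}"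
  unfolding J_class_of_def
proof (rule the_equality)
  have "(\<T> closure_of L) - L \<subseteq> {y \<in> carrier F. principal_ideal F y = principal_ideal F e}"
    using limit_J unfolding closure_F[OF L_F] by blast
  moreover have "{y \<in> carrier F. principal_ideal F y = principal_ideal F e} \<in> J_classes F"
    unfolding J_classes_def using eF by blast
  ultimately show "{y \<in> carrier F. principal_ideal F y = principal_ideal F e} \<in> J_classes F \<and>
      (\<T> closure_of L) - L \<subseteq> {y \<in> carrier F. principal_ideal F y = principal_ideal F e}" by blast
next
  fix J assume J: "J \<in> J_classes F \<and> (\<T> closure_of L) - L \<subseteq> J"
  then obtain x where x: "J = {y \<in> carrier F. principal_ideal F y = principal_ideal F x}"
    unfolding J_classes_def by blast
  have "e \<in> J" using J e_limit by blast
  then show "J = {y \<in> carrier F. principal_ideal F y = principal_ideal F e}" using x by simp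
qed

text \<open>The map \<open>c\<close> with \<open>c x = p x q\<close> carries \<open>units e\<close>
  onto \<open>units f\<close>, with inverse \<open>d\<close>; it is multiplicative because
  \<open>q p = e\<close> can be absorbed.\<close>

lemma schutzenberger_generators:
  assumes "H \<in> schutzenberger_groups V A X"
  shows "\<exists>f h. f \<in> carrier F \<and> f \<cdot> f = f \<and> H = units f \<and> (\<forall>k<n. h k \<in> H) \<and>
    (\<forall>x\<in>H. \<forall>i\<in>GM. \<exists>y\<in>sg_generate F (h ` {..<n}). y i = x i)"
proof -
  have H: "H \<in> maximal_subgroups F" "H \<subseteq> {y \<in> carrier F. principal_ideal F y = principal_ideal F e}"
    using assms unfolding schutzenberger_groups_def J_class by auto
  obtain f where f: "f \<in> carrier F" "f \<cdot> f = f" "f \<in> H" "H = units f"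
    using maximal_subgroup_units[OF H(1)] by blast
  have "principal_ideal F e = principal_ideal F f" using H(2) f(3) by auto
  from J_conjugate[OF eF ee f(1,2) this] obtain p q where
    p: "p \<in> carrier F" "f \<cdot> p = p" "p \<cdot> e = p" and q: "q \<in> carrier F" "e \<cdot> q = q" "q \<cdot> f = q"
    and pq: "p \<cdot> q = f" "q \<cdot> p = e" by blast
  obtain h where h: "\<And>k. k < n \<Longrightarrow> h k \<in> units e"
    "\<And>x i. x \<in> units e \<Longrightarrow> i \<in> GM \<Longrightarrow> \<exists>y\<in>sg_generate F (h ` {..<n}). y i = x i"
    using units_generators by blast
  define c where "c x = p \<cdot> x \<cdot> q" for x
  have cF: "c x \<in> carrier F" if "x \<in> carrier F" for x
    unfolding c_def using F_mult_closed[OF F_mult_closed[OF p(1) that] q(1)] .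
  have c_mult: "c x \<cdot> c y = c (x \<cdot> y)" if x: "x \<in> carrier F" "x \<cdot> e = x" and y: "y \<in> carrier F" for x y
  proof -
    have "c x \<cdot> c y = p \<cdot> (x \<cdot> (q \<cdot> p) \<cdot> y) \<cdot> q"
      unfolding c_def using x(1) y p(1) q(1) F_mult_closed by (simp add: F_assoc)
    then show ?thesis unfolding pq(2) x(2) c_def .
  qed
  have c_fix: "f \<cdot> c x = c x" "c x \<cdot> f = c x" if x: "x \<in> carrier F" for x
    unfolding c_def using F_assoc[OF f(1) F_mult_closed[OF p(1) x] q(1)] F_assoc[OF f(1) p(1) x]
      F_assoc[OF F_mult_closed[OF p(1) x] q(1) f(1)] p(2) q(3) by simp_all
  have ce: "c e = f" unfolding c_def p(3) pq(1) ..
  have cu: "c x \<in> units f" if x: "x \<in> units e" for x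
  proof -
    note xu = unitsD[OF x]
    obtain y where y: "y \<in> carrier F" "e \<cdot> y = y" "y \<cdot> e = y" "x \<cdot> y = e" "y \<cdot> x = e" using xu(4) by blast
    have "c x \<cdot> c y = f" "c y \<cdot> c x = f"
      using c_mult[OF xu(1,3) y(1)] c_mult[OF y(1,3) xu(1)] y(4,5) ce by simp_all
    then show ?thesis unfolding units_def mem_Collect_eq
      using cF[OF xu(1)] cF[OF y(1)] c_fix[OF xu(1)] c_fix[OF y(1)] by blast
  qed
  have "\<exists>y\<in>sg_generate F ((c \<circ> h) ` {..<n}). y i = x i" if x: "x \<in> units f" and i: "i \<in> GM" for x i
  proof -
    note xu = unitsD[OF x]
    obtain x' where x': "x' \<in> carrier F" "f \<cdot> x' = x'" "x' \<cdot> f = x'" "x \<cdot> x' = f" "x' \<cdot> x = f" using xu(4) by blast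
    define d where "d x = q \<cdot> x \<cdot> p" for x
    have dF: "d x \<in> carrier F" if "x \<in> carrier F" for x
      unfolding d_def using F_mult_closed[OF F_mult_closed[OF q(1) that] p(1)] .
    have d_mult: "d x \<cdot> d y = d (x \<cdot> y)" if x: "x \<in> carrier F" "x \<cdot> f = x" and y: "y \<in> carrier F" for x y
    proof -
      have "d x \<cdot> d y = q \<cdot> (x \<cdot> (p \<cdot> q) \<cdot> y) \<cdot> p"
        unfolding d_def using x(1) y p(1) q(1) F_mult_closed by (simp add: F_assoc)
      then show ?thesis unfolding pq(1) x(2) d_def .
    qed
    have d_fix: "e \<cdot> d x = d x" "d x \<cdot> e = d x" if x: "x \<in> carrier F" for x
      unfolding d_def using F_assoc[OF eF F_mult_closed[OF q(1) x] p(1)] F_assoc[OF eF q(1) x]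
        F_assoc[OF F_mult_closed[OF q(1) x] p(1) eF] p(3) q(2) by simp_all
    have de: "d f = e" unfolding d_def q(3) pq(2) ..
    have "d x \<cdot> d x' = e" "d x' \<cdot> d x = e"
      using d_mult[OF xu(1,3) x'(1)] d_mult[OF x'(1,3) xu(1)] x'(4,5) de by simp_all
    then have du: "d x \<in> units e" unfolding units_def mem_Collect_eq
      using dF[OF xu(1)] dF[OF x'(1)] d_fix[OF xu(1)] d_fix[OF x'(1)] by blast
    obtain y where y: "y \<in> sg_generate F (h ` {..<n})" "y i = d x i" using h(2)[OF du i] by blast
    have gen: "c y \<in> sg_generate F ((c \<circ> h) ` {..<n}) \<and> y \<in> units e" if "y \<in> sg_generate F (h ` {..<n})" for y
      using that
    proof induction
      case (base b)
      then show ?case using h(1) by (auto intro!: sg_generate.base)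
    next
      case (mult a b)
      have "c (a \<cdot> b) = c a \<cdot> c b" using c_mult mult.IH unitsD by metis
      then show ?case using mult.IH units_mult[OF eF] by (auto intro: sg_generate.mult)
    qed
    have yF: "y \<in> carrier F" using gen[OF y(1)] unitsD(1) by blast
    have "c (d x) = (p \<cdot> q) \<cdot> x \<cdot> (p \<cdot> q)"
      unfolding c_def d_def using xu(1) p(1) q(1) F_mult_closed by (simp add: F_assoc)
    then have cd: "c (d x) = x" unfolding pq(1) xu(2) xu(3) .
    have "c y i = c (d x) i" using y(2) i by (simp add: c_def)
    then show ?thesis using gen[OF y(1)] cd by auto
  qed
  then show ?thesis
    using f h(1) cu by (intro exI[of _ f] exI[of _ "c \<circ> h"]) auto
qed

end

section \<open>Maximal subgroups as profinite groups\<close>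

context pro_setting
begin

text \<open>This says that the unit group is closed. A unit that agrees with \<open>x\<close> at
  \<open>i\<close> lends its inverse there, which puts \<open>f i\<close> into the ideal of
  \<open>x i\<close>.\<close>

lemma units_closed_coordinates:
  assumes f: "f \<in> carrier F" "f \<cdot> f = f" and x: "x \<in> carrier F"
    and H: "\<And>i. i \<in> GM \<Longrightarrow> \<exists>y\<in>units f. y i = x i"
  shows "x \<in> units f"
proof (rule unit_from_coordinates[OF f x])
  have fy: "sg_mult (fst i) (f i) (y i) = y i" "sg_mult (fst i) (y i) (f i) = y i"
    if "y \<in> units f" "i \<in> GM" for y i
    using fun_cong[OF unitsD(2)[OF that(1)], of i] fun_cong[OF unitsD(3)[OF that(1)], of i] that(2) by simp_all
  have fx: "sg_mult (fst i) (f i) (x i) = x i" "sg_mult (fst i) (x i) (f i) = x i" if i: "i \<in> GM" for i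
    using H[OF i] fy[OF _ i] by metis+
  show "f \<cdot> x = x" by (rule F_eqI) (use fx f x F_mult_closed in simp_all)
  show "x \<cdot> f = x" by (rule F_eqI) (use fx f x F_mult_closed in simp_all)
  fix i assume i: "i \<in> GM"
  obtain y where y: "y \<in> units f" "y i = x i" using H[OF i] by blast
  obtain z where z: "z \<in> carrier F" "y \<cdot> z = f" using unitsD(4)[OF y(1)] by blast
  have fi: "f i \<in> carrier (fst i)" "sg_mult (fst i) (f i) (x i) = x i" "sg_mult (fst i) (x i) (z i) = f i"
    using F_at[OF f(1) i] fx(1)[OF i] fun_cong[OF z(2), of i] y(2) i by simp_all
  then show "\<exists>c\<in>carrier (fst i). \<exists>d\<in>carrier (fst i). f i = sg_mult (fst i) (sg_mult (fst i) c (x i)) d"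
    using F_at[OF z(1) i] by (intro bexI[of _ "f i"] bexI[of _ "z i"]) simp_all
qed

text \<open>
  The index set of the inverse system has to consist of subsets of the group, so a coordinate
  \<open>i\<close> is encoded by the kernel of the projection to it; \<open>c\<close> picks a coordinate with a given
  kernel.
\<close>

theorem units_profinite:
  assumes f: "f \<in> carrier F" "f \<cdot> f = f"
  shows "profinite_group (restrict_sgrp F (units f)) (subtopology \<T> (units f))"
proof -
  define H where "H = units f"
  define G where "G = restrict_sgrp F H"
  have G: "carrier G = H" "sg_mult G = sg_mult F" by (simp_all add: G_def restrict_sgrp_def)
  have HF: "H \<subseteq> carrier F" unfolding H_def using unitsD(1) by blast
  have fH: "f \<in> H" unfolding H_def units_def using f by auto
  define ker where "ker i = {h \<in> H. h i = f i}" for i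
  define I where "I = ker ` GM"
  define rel where "rel M N \<longleftrightarrow> N \<subseteq> M" for M N :: "('a gen_sgrp \<Rightarrow> nat) set"
  define c where "c N = (SOME i. i \<in> GM \<and> ker i = N)" for N
  have c: "c N \<in> GM" "ker (c N) = N" if "N \<in> I" for N
  proof -
    have "\<exists>i. i \<in> GM \<and> ker i = N" using that by (auto simp: I_def)
    from someI_ex[OF this] show "c N \<in> GM" "ker (c N) = N" unfolding c_def by blast+
  qed
  define Q where "Q N = restrict_sgrp (fst (c N)) ((\<lambda>h. h (c N)) ` H)" for N
  have Qc: "carrier (Q N) = (\<lambda>h. h (c N)) ` H" "sg_mult (Q N) = sg_mult (fst (c N))" for N
    by (simp_all add: Q_def restrict_sgrp_def)
  define tr where "tr M N z = (SOME h. h \<in> H \<and> h (c N) = z) (c M)" for M N z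
  \<comment> \<open>The projection to \<open>i\<close> factors through the one to \<open>j\<close>
    if the kernels are nested: apply this to the quotient of \<open>h\<close> by \<open>h'\<close>.
    Thus the choice made in \<open>tr\<close> is immaterial.\<close>
  have factor: "h i = h' i" if h: "h \<in> H" "h' \<in> H" and ij: "i \<in> GM" "j \<in> GM" "ker j \<subseteq> ker i" "h j = h' j"
    for h h' i j
  proof -
    note hu = unitsD[OF h(1)[unfolded H_def]] and hu' = unitsD[OF h(2)[unfolded H_def]]
    obtain k where k: "k \<in> carrier F" "f \<cdot> k = k" "k \<cdot> f = k" "h' \<cdot> k = f" "k \<cdot> h' = f" using hu'(4) by blast
    have "k \<in> units f" unfolding units_def mem_Collect_eq
      by (intro conjI bexI[of _ h']) (use k hu' in simp_all)
    then have "k \<cdot> h \<in> H" using units_mult[OF f(1)] h(1) by (simp add: H_def)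
    moreover have "(k \<cdot> h) j = f j" using fun_cong[OF k(5), of j] ij(2,4) by simp
    ultimately have "k \<cdot> h \<in> ker i" using ij(3) by (auto simp: ker_def)
    then have ki: "(k \<cdot> h) i = f i" by (simp add: ker_def)
    have "h' \<cdot> (k \<cdot> h) = h" using F_assoc[OF hu'(1) k(1) hu(1)] k(4) hu(2) by simp
    then have "h i = sg_mult (fst i) (h' i) ((k \<cdot> h) i)" using ij(1) by (metis F_mult_at)
    also have "\<dots> = (h' \<cdot> f) i" unfolding ki using ij(1) by simp
    also have "\<dots> = h' i" using hu'(3) by simp
    finally show ?thesis .
  qed
  have tr: "tr M N (h (c N)) = h (c M)" if "M \<in> I" "N \<in> I" "rel M N" "h \<in> H" for M N h
  proof -
    have "\<exists>k. k \<in> H \<and> k (c N) = h (c N)" using that(4) by blast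
    from someI_ex[OF this] have k: "(SOME k. k \<in> H \<and> k (c N) = h (c N)) \<in> H"
      "(SOME k. k \<in> H \<and> k (c N) = h (c N)) (c N) = h (c N)" by blast+
    show ?thesis
      unfolding tr_def
      by (rule factor[OF k(1) that(4) c(1)[OF that(1)] c(1)[OF that(2)] _ k(2)])
        (use c(2)[OF that(1)] c(2)[OF that(2)] that(3) in \<open>simp add: rel_def\<close>)
  qed
  have Hmult: "h \<cdot> k \<in> H" if "h \<in> H" "k \<in> H" for h k
    using units_mult[OF f(1)] that by (simp add: H_def)
  have Qgroup: "is_group (Q N)" if N: "N \<in> I" for N
  proof -
    interpret S: finite_sgrp "fst (c N)" using c(1)[OF N] by (rule GM_finite_sgrp)
    have at: "(h \<cdot> k) (c N) = S.mult (h (c N)) (k (c N))" for h k using c(1)[OF N] by simp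
    have hc: "h (c N) \<in> carrier (fst (c N))" if "h \<in> H" for h using F_at[OF _ c(1)[OF N]] that HF by blast
    have inv: "\<exists>k\<in>H. k \<cdot> h = f" if "h \<in> H" for h
    proof -
      note hu = unitsD[OF that[unfolded H_def]]
      obtain k where k: "k \<in> carrier F" "f \<cdot> k = k" "k \<cdot> f = k" "h \<cdot> k = f" "k \<cdot> h = f" using hu(4) by blast
      have "k \<in> units f" unfolding units_def mem_Collect_eq
        by (intro conjI bexI[of _ h]) (use k hu in simp_all)
      then show ?thesis using k(5) by (auto simp: H_def)
    qed
    have "group \<lparr>carrier = (\<lambda>h. h (c N)) ` H, monoid.mult = sg_mult (fst (c N)), one = f (c N)\<rparr>"
    proof (rule groupI, simp_all)
      show "S.mult x y \<in> (\<lambda>h. h (c N)) ` H" if "x \<in> (\<lambda>h. h (c N)) ` H" "y \<in> (\<lambda>h. h (c N)) ` H" for x y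
      proof -
        from that obtain h k where "h \<in> H" "x = h (c N)" "k \<in> H" "y = k (c N)" by blast
        then show ?thesis using at[of h k] by (intro image_eqI[of _ _ "h \<cdot> k"]) (simp_all add: Hmult)
      qed
      show "f (c N) \<in> (\<lambda>h. h (c N)) ` H" using fH by blast
      show "S.mult (S.mult x y) z = S.mult x (S.mult y z)"
        if "x \<in> (\<lambda>h. h (c N)) ` H" "y \<in> (\<lambda>h. h (c N)) ` H" "z \<in> (\<lambda>h. h (c N)) ` H" for x y z
        by (rule S.assoc) (use that hc in auto)
      show "S.mult (f (c N)) x = x" if "x \<in> (\<lambda>h. h (c N)) ` H" for x
      proof -
        obtain h where "h \<in> H" "x = h (c N)" using \<open>x \<in> (\<lambda>h. h (c N)) ` H\<close> by blast
        then show ?thesis using at[of f h] unitsD(2)[of h f] by (simp add: H_def)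
      qed
      show "\<exists>y\<in>H. S.mult (y (c N)) x = f (c N)" if "x \<in> (\<lambda>h. h (c N)) ` H" for x
      proof -
        obtain h where h: "h \<in> H" "x = h (c N)" using \<open>x \<in> (\<lambda>h. h (c N)) ` H\<close> by blast
        then obtain k where "k \<in> H" "k \<cdot> h = f" using inv by blast
        then show ?thesis using at[of k h] h(2) by (intro bexI[of _ k]) simp_all
      qed
    qed
    then show ?thesis unfolding is_group_def Qc by blast
  qed
  have Qsemi: "is_semigroup (Q N)" if N: "N \<in> I" for N
  proof -
    obtain u where "group \<lparr>carrier = carrier (Q N), monoid.mult = sg_mult (Q N), one = u\<rparr>"
      using Qgroup[OF N] by (auto simp: is_group_def)
    then interpret group "\<lparr>carrier = carrier (Q N), monoid.mult = sg_mult (Q N), one = u\<rparr>" .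
    show ?thesis
      unfolding is_semigroup_def
    proof (intro conjI ballI)
      show "carrier (Q N) \<noteq> {}" using one_closed by auto
      show "sg_mult (Q N) x y \<in> carrier (Q N)" if "x \<in> carrier (Q N)" "y \<in> carrier (Q N)" for x y
        using m_closed[of x y] that by simp
      show "sg_mult (Q N) (sg_mult (Q N) x y) z = sg_mult (Q N) x (sg_mult (Q N) y z)"
        if "x \<in> carrier (Q N)" "y \<in> carrier (Q N)" "z \<in> carrier (Q N)" for x y z
        using m_assoc[of x y z] that by simp
    qed
  qed
  have sys: "inverse_system I rel Q tr"
    unfolding inverse_system_def
  proof (intro conjI ballI impI allI)
    show "I \<noteq> {}" using GM_nonempty by (simp add: I_def)
    show "rel N N" for N by (simp add: rel_def)
    show "rel L N" if "rel L M \<and> rel M N" for L M N using that by (auto simp: rel_def)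
    show "\<exists>K\<in>I. rel M K \<and> rel N K" if M: "M \<in> I" and N: "N \<in> I" for M N
    proof -
      obtain k where k: "k \<in> GM" "gen_le A (c M) k" "gen_le A (c N) k"
        using directed[OF c(1)[OF M] c(1)[OF N]] by blast
      have "ker k \<subseteq> ker i" if "i \<in> GM" "gen_le A i k" for i
      proof
        fix h assume h: "h \<in> ker k"
        then have "h \<in> carrier F" using HF by (auto simp: ker_def)
        from F_trans[OF this that(1) k(1) that(2)] F_trans[OF f(1) that(1) k(1) that(2)]
        show "h \<in> ker i" using h by (simp add: ker_def)
      qed
      then have "rel M (ker k)" "rel N (ker k)"
        unfolding rel_def using c(1)[OF M] c(1)[OF N] k(2,3) c(2)[OF M] c(2)[OF N] by metis+
      moreover have "ker k \<in> I" using k(1) by (simp add: I_def)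
      ultimately show ?thesis by blast
    qed
    show "is_semigroup (Q N)" if "N \<in> I" for N using Qsemi[OF that] .
    show "tr M N \<in> sg_hom (Q N) (Q M)" if M: "M \<in> I" and N: "N \<in> I" and MN: "rel M N" for M N
      unfolding sg_hom_def mem_Collect_eq Qc
    proof (intro conjI ballI)
      show "tr M N \<in> (\<lambda>h. h (c N)) ` H \<rightarrow> (\<lambda>h. h (c M)) ` H" using tr[OF M N MN] by auto
      fix x y assume "x \<in> (\<lambda>h. h (c N)) ` H" "y \<in> (\<lambda>h. h (c N)) ` H"
      then obtain h k where hk: "h \<in> H" "x = h (c N)" "k \<in> H" "y = k (c N)" by blast
      have "sg_mult (fst (c N)) x y = (h \<cdot> k) (c N)" using hk c(1)[OF N] by simp
      then have "tr M N (sg_mult (fst (c N)) x y) = (h \<cdot> k) (c M)"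
        using tr[OF M N MN Hmult[OF hk(1,3)]] by simp
      also have "\<dots> = sg_mult (fst (c M)) (tr M N x) (tr M N y)"
        using tr[OF M N MN hk(1)] tr[OF M N MN hk(3)] hk c(1)[OF M] by simp
      finally show "tr M N (sg_mult (fst (c N)) x y) = sg_mult (fst (c M)) (tr M N x) (tr M N y)" .
    qed
    show "tr N N x = x" if N: "N \<in> I" and x: "x \<in> carrier (Q N)" for N x
    proof -
      obtain h where "h \<in> H" "x = h (c N)" using x unfolding Qc by blast
      then show ?thesis using tr[OF N N, of h] by (simp add: rel_def)
    qed
    show "tr L M (tr M N x) = tr L N x"
      if I: "L \<in> I" "M \<in> I" "N \<in> I" and r: "rel L M \<and> rel M N" and x: "x \<in> carrier (Q N)" for L M N x
    proof -
      obtain h where h: "h \<in> H" "x = h (c N)" using x unfolding Qc by blast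
      have "rel L N" using r by (auto simp: rel_def)
      then show ?thesis
        using tr[OF I(2,3) _ h(1)] tr[OF I(1,2) _ h(1)] tr[OF I(1,3) _ h(1)] r h(2) by simp
    qed
  qed
  define \<psi> where "\<psi> h = (\<lambda>N\<in>I. h (c N))" for h :: "'a gen_sgrp \<Rightarrow> nat"
  define IL where "IL = inverse_limit I rel Q tr"
  have IL: "x \<in> carrier IL \<longleftrightarrow> x \<in> (\<Pi>\<^sub>E N\<in>I. (\<lambda>h. h (c N)) ` H) \<and>
      (\<forall>M\<in>I. \<forall>N\<in>I. rel M N \<longrightarrow> tr M N (x N) = x M)" for x
    by (simp add: IL_def inverse_limit_def restrict_sgrp_def direct_prod_def Qc)
  have IL_mult: "sg_mult IL x y = (\<lambda>N\<in>I. sg_mult (fst (c N)) (x N) (y N))" for x y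
    by (simp add: IL_def inverse_limit_def restrict_sgrp_def direct_prod_def Qc)
  have \<psi>c: "\<psi> h \<in> carrier IL" if "h \<in> H" for h
    unfolding IL using that tr by (auto simp: \<psi>_def)
  have kerI: "ker i \<in> I" if "i \<in> GM" for i using that by (simp add: I_def)
  have \<psi>_determines: "h i = k i" if "h \<in> H" "k \<in> H" "i \<in> GM" "h (c (ker i)) = k (c (ker i))" for h k i
    using factor[OF that(1,2,3) c(1)[OF kerI[OF that(3)]] _ that(4)] c(2)[OF kerI[OF that(3)]] by simp
  have inj: "inj_on \<psi> H"
  proof (rule inj_onI)
    fix h k assume hk: "h \<in> H" "k \<in> H" "\<psi> h = \<psi> k"
    show "h = k"
    proof (rule F_eqI)
      fix i assume i: "i \<in> GM"
      show "h i = k i" using \<psi>_determines[OF hk(1,2) i] fun_cong[OF hk(3), of "ker i"] kerI[OF i]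
        by (simp add: \<psi>_def)
    qed (use hk HF in auto)
  qed
  have surj: "\<exists>h\<in>H. \<psi> h = x" if x: "x \<in> carrier IL" for x
  proof -
    define r where "r N = (SOME h. h \<in> H \<and> h (c N) = x N)" for N
    have r: "r N \<in> H" "r N (c N) = x N" if "N \<in> I" for N
    proof -
      have "x N \<in> (\<lambda>h. h (c N)) ` H" using x that unfolding IL by (auto simp: PiE_iff)
      then have "\<exists>h. h \<in> H \<and> h (c N) = x N" by auto
      from someI_ex[OF this] show "r N \<in> H" "r N (c N) = x N" unfolding r_def by blast+
    qed
    \<comment> \<open>Every coordinate is read off a group element that represents \<open>x\<close>
      at the kernel of that coordinate; \<open>comp\<close> makes these readings compatible.\<close>
    define h where "h = (\<lambda>i\<in>GM. r (ker i) i)"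
    have comp: "r N i = r M i" if "M \<in> I" "N \<in> I" "rel M N" "i \<in> GM" "M \<subseteq> ker i" for M N i
    proof -
      have "tr M N (x N) = x M" using x that(1-3) unfolding IL by blast
      then have "r N (c M) = r M (c M)" using tr[OF that(1-3) r(1)[OF that(2)]] r(2)[OF that(1)] r(2)[OF that(2)] by simp
      then show ?thesis
        using factor[OF r(1)[OF that(2)] r(1)[OF that(1)] that(4) c(1)[OF that(1)]] c(2)[OF that(1)] that(5) by simp
    qed
    have hF: "h \<in> carrier F"
      unfolding F_iff
    proof (intro conjI ballI impI)
      have "r (ker i) i \<in> carrier (fst i)" if "i \<in> GM" for i
        using F_at[OF subsetD[OF HF r(1)[OF kerI[OF that]]] that] .
      then show "h \<in> (\<Pi>\<^sub>E i\<in>GM. carrier (fst i))" unfolding h_def by simp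
      fix i j assume ij: "i \<in> GM" "j \<in> GM" "gen_le A i j"
      have "ker j \<subseteq> ker i"
      proof
        fix k assume k: "k \<in> ker j"
        then have "k \<in> carrier F" using HF by (auto simp: ker_def)
        from F_trans[OF this ij] F_trans[OF f(1) ij]
        show "k \<in> ker i" using k by (simp add: ker_def)
      qed
      then have "r (ker j) i = r (ker i) i"
        using comp[OF kerI[OF ij(1)] kerI[OF ij(2)] _ ij(1)] by (simp add: rel_def)
      moreover have "gen_trans A i j (r (ker j) j) = r (ker j) i"
        using r(1)[OF kerI[OF ij(2)]] HF by (intro F_trans ij) blast
      ultimately show "gen_trans A i j (h j) = h i" using ij by (simp add: h_def)
    qed
    have "h \<in> units f"
      by (rule units_closed_coordinates[OF f hF])
        (use r(1)[OF kerI] in \<open>auto simp: h_def H_def\<close>)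
    then have hH: "h \<in> H" by (simp add: H_def)
    have "\<psi> h = x"
    proof
      fix N
      show "\<psi> h N = x N"
      proof (cases "N \<in> I")
        case True
        then show ?thesis using r(2)[OF True] c[OF True] by (simp add: \<psi>_def h_def)
      next
        case False
        have "x \<in> (\<Pi>\<^sub>E N\<in>I. (\<lambda>h. h (c N)) ` H)" using x unfolding IL by (rule conjunct1)
        from PiE_arb[OF this False] show ?thesis using False by (simp add: \<psi>_def)
      qed
    qed
    then show ?thesis using hH by blast
  qed
  have bij: "bij_betw \<psi> H (carrier IL)"
    unfolding bij_betw_def using inj \<psi>c surj by blast
  have hom: "\<psi> \<in> sg_hom G IL"
    unfolding sg_hom_def mem_Collect_eq G IL_mult using \<psi>c c(1) by (auto simp: \<psi>_def)
  have iso: "\<psi> \<in> sg_iso G IL" unfolding sg_iso_def using hom bij by (simp add: G)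
  define P where "P = product_topology (\<lambda>N. discrete_topology (carrier (Q N))) I"
  have ILtop: "inverse_limit_top I rel Q tr = subtopology P (carrier IL)"
    by (simp add: inverse_limit_top_def P_def IL_def)
  have topI: "topspace (subtopology P (carrier IL)) = carrier IL"
    using IL by (auto simp: P_def Qc)
  have topH: "topspace (subtopology \<T> H) = H" using HF by auto
  have coordH: "openin (subtopology \<T> H) {h \<in> H. h i \<in> U}" if "i \<in> GM" for i U
  proof -
    have "openin (subtopology \<T> H) ({y \<in> carrier F. y i \<in> U} \<inter> H)"
      using open_coordinate[OF that] by (auto simp: openin_subtopology)
    also have "{y \<in> carrier F. y i \<in> U} \<inter> H = {h \<in> H. h i \<in> U}" using HF by auto
    finally show ?thesis .
  qed
  have cont: "continuous_map (subtopology \<T> H) (subtopology P (carrier IL)) \<psi>"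
    unfolding continuous_map_in_subtopology
  proof
    show "\<psi> \<in> topspace (subtopology \<T> H) \<rightarrow> carrier IL" unfolding topH using \<psi>c by blast
    show "continuous_map (subtopology \<T> H) P \<psi>"
      unfolding P_def continuous_map_componentwise
    proof (intro conjI ballI)
      show "\<psi> ` topspace (subtopology \<T> H) \<subseteq> extensional I" by (auto simp: \<psi>_def)
      fix N assume N: "N \<in> I"
      show "continuous_map (subtopology \<T> H) (discrete_topology (carrier (Q N))) (\<lambda>x. \<psi> x N)"
        unfolding continuous_map_def
      proof (intro conjI allI impI)
        show "(\<lambda>x. \<psi> x N) \<in> topspace (subtopology \<T> H) \<rightarrow> topspace (discrete_topology (carrier (Q N)))"
          unfolding topH using N by (auto simp: \<psi>_def Qc)
        show "openin (subtopology \<T> H) {x \<in> topspace (subtopology \<T> H). \<psi> x N \<in> U}" for U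
          unfolding topH using coordH[OF c(1)[OF N], of U] N by (simp add: \<psi>_def)
      qed
    qed
  qed
  have opn: "open_map (subtopology \<T> H) (subtopology P (carrier IL)) \<psi>"
    unfolding open_map_def
  proof (intro allI impI)
    fix U assume U: "openin (subtopology \<T> H) U"
    have UH: "U \<subseteq> H" using openin_subset[OF U] topH by simp
    have proj: "openin (subtopology P (carrier IL)) {x \<in> carrier IL. x N = z}" if N: "N \<in> I" for N z
    proof -
      have "continuous_map P (discrete_topology (carrier (Q N))) (\<lambda>x. x N)"
        unfolding P_def using N by (rule continuous_map_product_projection)
      then have "openin P {x \<in> topspace P. x N \<in> {z} \<inter> carrier (Q N)}"
        by (rule openin_continuous_map_preimage) simp
      then have "openin (subtopology P (carrier IL)) ({x \<in> topspace P. x N \<in> {z} \<inter> carrier (Q N)} \<inter> carrier IL)"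
        by (auto simp: openin_subtopology)
      also have "{x \<in> topspace P. x N \<in> {z} \<inter> carrier (Q N)} \<inter> carrier IL = {x \<in> carrier IL. x N = z}"
        using N by (auto simp: P_def IL Qc PiE_iff)
      finally show ?thesis .
    qed
    have nb: "\<exists>W. openin (subtopology P (carrier IL)) W \<and> y \<in> W \<and> W \<subseteq> \<psi> ` U" if y: "y \<in> \<psi> ` U" for y
    proof -
      obtain h where h: "h \<in> U" "y = \<psi> h" using y by blast
      obtain W where W: "openin \<T> W" "U = W \<inter> H" using U by (auto simp: openin_subtopology)
      have hW: "h \<in> W" and hH: "h \<in> H" using h(1) W(2) by auto
      obtain k where k: "k \<in> GM" "\<And>y. y \<in> carrier F \<Longrightarrow> y k = h k \<Longrightarrow> y \<in> W"
        using open_neighbourhood[OF W(1) hW] by blast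
      \<comment> \<open>The index \<open>ker k\<close> may be represented by another coordinate than
        \<open>k\<close>, but equal kernels determine each other's values by
        \<open>\<psi>_determines\<close>.\<close>
      have "{x \<in> carrier IL. x (ker k) = y (ker k)} \<subseteq> \<psi> ` U"
      proof
        fix x assume x: "x \<in> {x \<in> carrier IL. x (ker k) = y (ker k)}"
        then obtain g where g: "g \<in> H" "\<psi> g = x" using surj by blast
        have "g (c (ker k)) = h (c (ker k))" using x g(2) h(2) kerI[OF k(1)] by (auto simp: \<psi>_def)
        then have "g k = h k" by (rule \<psi>_determines[OF g(1) hH k(1)])
        then have "g \<in> U" using k(2)[of g] g(1) HF W(2) by blast
        then show "x \<in> \<psi> ` U" using g(2) by blast
      qed
      moreover have "y \<in> {x \<in> carrier IL. x (ker k) = y (ker k)}" using \<psi>c[OF hH] h(2) by simp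
      ultimately show ?thesis using proj[OF kerI[OF k(1)]] by blast
    qed
    show "openin (subtopology P (carrier IL)) (\<psi> ` U)"
      by (subst openin_subopen) (use nb in blast)
  qed
  have homeo: "homeomorphic_map (subtopology \<T> H) (inverse_limit_top I rel Q tr) \<psi>"
    unfolding ILtop
    by (rule bijective_open_imp_homeomorphic_map[OF cont opn]) (use bij topH topI in \<open>auto simp: bij_betw_def\<close>)
  have grp: "is_group G"
    unfolding is_group_def G using units_group[OF f] by (auto simp: H_def)
  have finQ: "finite (carrier (Q N)) \<and> is_group (Q N)" if N: "N \<in> I" for N
  proof -
    have "(\<lambda>h. h (c N)) ` H \<subseteq> carrier (fst (c N))" using F_at[OF _ c(1)[OF N]] HF by blast
    then show ?thesis using Qgroup[OF N] GM_D(3)[OF c(1)[OF N]] finite_subset unfolding Qc by blast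
  qed
  show ?thesis
    unfolding profinite_group_def H_def[symmetric] G_def[symmetric]
    using grp topH sys finQ iso homeo unfolding G IL_def by blast
qed

end

theorem theorem11p9:
  fixes A :: "'a set" and X :: "(int \<Rightarrow> 'a) set" and n :: nat
    and V :: "nat sgrp set" and H :: "('a gen_sgrp \<Rightarrow> nat) set"
  assumes "finite A"
    and "minimal_shift_space A X"
    and "finite_topological_rank A X"
    and "topological_rank A X = n"
    and "pseudovariety V"
    and "LSl \<subseteq> V"
    and "H \<in> schutzenberger_groups V A X"
  shows "profinite_group (restrict_sgrp (free_pro V A) H) (subtopology (free_pro_top V A) H) \<and>
         top_finitely_generated (restrict_sgrp (free_pro V A) H) (subtopology (free_pro_top V A) H) \<and>
         profinite_rank (restrict_sgrp (free_pro V A) H) (subtopology (free_pro_top V A) H) \<le> n"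
proof -
  have "\<exists>m. m \<in> representation_bounds A X" using assms(3) by (auto simp: finite_topological_rank_def)
  then have "n \<in> representation_bounds A X"
    unfolding assms(4)[symmetric] topological_rank_def by (rule LeastI_ex)
  then obtain D where D: "represented_by A X D" "bdd_above (range (\<lambda>i. card (bd_V D i)))"
    "n = (SUP i. card (bd_V D i))"
    unfolding representation_bounds_def by blast
  have card: "card (bd_V D i) \<le> n" for i
    unfolding D(3) by (rule cSUP_upper[OF _ D(2)]) simp
  obtain xs where xs: "return_structure A X xs n"
    using representation_return_structure[OF assms(1,2) D(1) card] by blast
  interpret R: return_structure A X xs n by (rule xs)
  have "A \<noteq> {}" using R.letters[OF R.xsX] by blast
  then interpret P: pro_setting V A using assms by unfold_locales
  interpret S: schutzenberger V A X xs n by unfold_locales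
  obtain e where "e \<in> carrier (free_pro V A)"
    "\<forall>i\<in>P.GM. e i \<in> S.prefix_limit i \<and> sg_mult (fst i) (e i) (e i) = e i"
    using S.idempotent_prefix_limit by blast
  then interpret E: schutzenberger_idempotent V A X xs n e by unfold_locales blast+
  obtain f h where f: "f \<in> carrier (free_pro V A)" "sg_mult (free_pro V A) f f = f" "H = P.units f"
    and h: "\<forall>k<n. h k \<in> H"
      "\<forall>x\<in>H. \<forall>i\<in>P.GM. \<exists>y\<in>sg_generate (free_pro V A) (h ` {..<n}). y i = x i"
    using E.schutzenberger_generators[OF assms(7)] by blast
  have HF: "H \<subseteq> carrier (free_pro V A)" unfolding f(3) using P.unitsD(1) by blast
  have hH: "h ` {..<n} \<subseteq> H" using h(1) by blast
  have gen: "sg_generate (restrict_sgrp (free_pro V A) H) (h ` {..<n}) = sg_generate (free_pro V A) (h ` {..<n})"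
    by (rule generate_restrict[OF hH])
  have sub: "sg_generate (free_pro V A) (h ` {..<n}) \<subseteq> H"
  proof
    fix y assume "y \<in> sg_generate (free_pro V A) (h ` {..<n})"
    then show "y \<in> H"
    proof induction
      case (mult x y)
      then show ?case unfolding f(3) using P.units_mult[OF f(1)] by blast
    qed (use hH in blast)
  qed
  have "subtopology (free_pro_top V A) H closure_of sg_generate (free_pro V A) (h ` {..<n}) = H"
    unfolding P.closure_sub[OF HF sub] using h(2) by blast
  moreover have "topspace (subtopology (free_pro_top V A) H) = H" using HF by auto
  ultimately have tg: "top_generates (restrict_sgrp (free_pro V A) H) (subtopology (free_pro_top V A) H) (h ` {..<n})"
    unfolding top_generates_def gen using hH by (simp add: restrict_sgrp_def)
  have fin: "finite (h ` {..<n})" "card (h ` {..<n}) \<le> n"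
    using card_image_le[of "{..<n}" h] by simp_all
  have "top_finitely_generated (restrict_sgrp (free_pro V A) H) (subtopology (free_pro_top V A) H)"
    unfolding top_finitely_generated_def using fin(1) tg by blast
  moreover have "profinite_rank (restrict_sgrp (free_pro V A) H) (subtopology (free_pro_top V A) H) \<le> n"
    unfolding profinite_rank_def using E.n_pos fin tg by (intro Least_le) blast
  moreover have "profinite_group (restrict_sgrp (free_pro V A) H) (subtopology (free_pro_top V A) H)"
    unfolding f(3) by (rule P.units_profinite[OF f(1,2)])
  ultimately show ?thesis by blast
qed

end
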